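(* Let $M$ be a compact oriented Riemannian 4-manifold and let $\phi$ be a harmonic 2-form on $M$. Put $\phi_+=\phi+\ast\phi$, $\phi_-=\phi-\ast\phi$, $F=\frac12|\phi_+|^2$ and $G=\frac12|\phi_-|^2$. Then at every point of $M$ $$\Delta (FG)= 8KFG+G|\nabla\phi_{+}|^{2}+F|\nabla\phi_{-}|^{2}+2\langle\nabla F, \nabla G\rangle,$$ where, at a point $p\in M$, $$K=\tfrac12\,(R_{1313}+R_{1414}+R_{2323}+R_{2424})$$ is computed in an orthonormal basis $\{e_1,e_2,e_3,e_4\}$ of $T_pM$, with dual basis $\{\omega^i\}$, such that $\phi(p)=\lambda_1\,\omega^1\wedge\omega^2+\lambda_2\,\omega^3\wedge\omega^4$ for some real $\lambda_1,\lambda_2$ (such a basis exists at every $p$).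
   Context: A 2-form $\phi$ is harmonic if $(d\delta+\delta d)\phi=0$, where $\delta$ is the adjoint of $d$. $\ast$ is the Hodge star operator. On functions, $\Delta$ denotes the Laplacian with the sign convention $\Delta f=\operatorname{div}\nabla f=\operatorname{tr}\nabla^2 f$. Norms on 2-forms are such that $\omega^i\wedge\omega^j$ ($i<j$) is orthonormal for an orthonormal coframe $\{\omega^i\}$; $\nabla$ is the Levi-Civita connection and $|\nabla\psi|^2=\sum_i|\nabla_{e_i}\psi|^2$. Curvature convention: $R(X,Y)=-\nabla_X\nabla_Y+\nabla_Y\nabla_X+\nabla_{[X,Y]}$ and $R_{ijkl}=\langle R(e_i,e_j)e_k,e_l\rangle$, so that $R_{ijij}$ is the sectional curvature of the plane spanned by the orthonormal vectors $e_i,e_j$ ($i\ne j$). *)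

theory Defs
  imports "HOL-Analysis.Analysis"
begin

section \<open>Smooth functions on open subsets of \<open>real^4\<close>\<close>

definition partial :: "4 \<Rightarrow> (real^4 \<Rightarrow> real) \<Rightarrow> real^4 \<Rightarrow> real" where
  "partial i f x = frechet_derivative f (at x) (axis i 1)"

text \<open>Only used for open \<open>S\<close>.\<close>

fun Ck_on :: "nat \<Rightarrow> (real^4) set \<Rightarrow> (real^4 \<Rightarrow> real) \<Rightarrow> bool" where
  "Ck_on 0 S f \<longleftrightarrow> continuous_on S f"
| "Ck_on (Suc k) S f \<longleftrightarrow>
     (\<forall>x\<in>S. f differentiable (at x)) \<and> (\<forall>i. Ck_on k S (partial i f))"

definition smooth_on :: "(real^4) set \<Rightarrow> (real^4 \<Rightarrow> real) \<Rightarrow> bool" where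
  "smooth_on S f \<longleftrightarrow> (\<forall>k. Ck_on k S f)"


section \<open>Oriented smooth 4-manifolds\<close>

text \<open>The manifold is the whole type \<open>'a\<close>. Its smooth structure and its orientation are given by
  an atlas of charts whose transition maps are smooth with positive Jacobian determinant. A
  compact manifold is automatically second countable, so this is not required separately.\<close>

type_synonym 'a chart = "'a set \<times> ('a \<Rightarrow> real^4)"

abbreviation chart_dom :: "'a chart \<Rightarrow> 'a set" where
  "chart_dom c \<equiv> fst c"

abbreviation chart_map :: "'a chart \<Rightarrow> 'a \<Rightarrow> real^4" where
  "chart_map c \<equiv> snd c"

definition chart_img :: "'a chart \<Rightarrow> (real^4) set" where
  "chart_img c = chart_map c ` chart_dom c"

definition chart_inv :: "'a chart \<Rightarrow> real^4 \<Rightarrow> 'a" where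
  "chart_inv c = inv_into (chart_dom c) (chart_map c)"

definition overlap :: "'a chart \<Rightarrow> 'a chart \<Rightarrow> (real^4) set" where
  "overlap c c' = chart_map c ` (chart_dom c \<inter> chart_dom c')"

definition transition :: "'a chart \<Rightarrow> 'a chart \<Rightarrow> real^4 \<Rightarrow> real^4" where
  "transition c c' x = chart_map c' (chart_inv c x)"

definition jacobian :: "'a chart \<Rightarrow> 'a chart \<Rightarrow> real^4 \<Rightarrow> real^4^4" where
  "jacobian c c' x = (\<chi> k i. partial i (\<lambda>y. transition c c' y $ k) x)"

definition smooth_oriented_atlas :: "('a::t2_space) chart set \<Rightarrow> bool" where
  "smooth_oriented_atlas A \<longleftrightarrow>
     (\<Union>c\<in>A. chart_dom c) = UNIV \<and>
     (\<forall>c\<in>A. open (chart_dom c) \<and> open (chart_img c) \<and>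
        homeomorphism (chart_dom c) (chart_img c) (chart_map c) (chart_inv c)) \<and>
     (\<forall>c\<in>A. \<forall>c'\<in>A.
        (\<forall>k. smooth_on (overlap c c') (\<lambda>x. transition c c' x $ k)) \<and>
        (\<forall>x\<in>overlap c c'. det (jacobian c c' x) > 0))"


section \<open>Tensor fields\<close>

text \<open>A tensor field is given by its components in every chart, as functions of the coordinates,
  subject to the usual transformation law. Only the values \<open>T c x\<close> with \<open>c\<close> in the atlas and
  \<open>x \<in> chart_img c\<close> are meaningful.\<close>

definition form1 :: "'a chart set \<Rightarrow> ('a chart \<Rightarrow> real^4 \<Rightarrow> real^4) \<Rightarrow> bool" where
  "form1 A \<alpha> \<longleftrightarrow>
     (\<forall>c\<in>A. \<forall>i. smooth_on (chart_img c) (\<lambda>x. \<alpha> c x $ i)) \<and>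
     (\<forall>c\<in>A. \<forall>c'\<in>A. \<forall>x\<in>overlap c c'.
        \<alpha> c x = transpose (jacobian c c' x) *v \<alpha> c' (transition c c' x))"

definition tensor2 :: "'a chart set \<Rightarrow> ('a chart \<Rightarrow> real^4 \<Rightarrow> real^4^4) \<Rightarrow> bool" where
  "tensor2 A T \<longleftrightarrow>
     (\<forall>c\<in>A. \<forall>i j. smooth_on (chart_img c) (\<lambda>x. T c x $ i $ j)) \<and>
     (\<forall>c\<in>A. \<forall>c'\<in>A. \<forall>x\<in>overlap c c'.
        T c x = transpose (jacobian c c' x) ** T c' (transition c c' x) ** jacobian c c' x)"

text \<open>Components of a 2-form: \<open>\<phi> c x $ i $ j\<close> is the value on the \<open>i\<close>-th and \<open>j\<close>-th coordinate
  vector fields.\<close>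

definition form2 :: "'a chart set \<Rightarrow> ('a chart \<Rightarrow> real^4 \<Rightarrow> real^4^4) \<Rightarrow> bool" where
  "form2 A \<phi> \<longleftrightarrow> tensor2 A \<phi> \<and> (\<forall>c\<in>A. \<forall>x\<in>chart_img c. transpose (\<phi> c x) = - \<phi> c x)"

definition riemannian_metric :: "'a chart set \<Rightarrow> ('a chart \<Rightarrow> real^4 \<Rightarrow> real^4^4) \<Rightarrow> bool" where
  "riemannian_metric A g \<longleftrightarrow> tensor2 A g \<and>
     (\<forall>c\<in>A. \<forall>x\<in>chart_img c.
        transpose (g c x) = g c x \<and> (\<forall>v. v \<noteq> 0 \<longrightarrow> v \<bullet> (g c x *v v) > 0))"


section \<open>Algebra of forms at a point\<close>

text \<open>Here \<open>G\<close> is the Gram matrix of the coordinate vectors, so \<open>matrix_inv G\<close> is the Gram matrix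
  of the coordinate covectors. The factors \<open>1/2\<close> and \<open>1/6\<close> make the products of increasing tuples
  from an orthonormal coframe orthonormal (cf. \<open>inner2_orthonormal\<close> below).\<close>

definition inner1 :: "real^4^4 \<Rightarrow> real^4 \<Rightarrow> real^4 \<Rightarrow> real" where
  "inner1 G a b = (\<Sum>i\<in>UNIV. \<Sum>k\<in>UNIV. matrix_inv G $ i $ k * a $ i * b $ k)"

definition inner2 :: "real^4^4 \<Rightarrow> real^4^4 \<Rightarrow> real^4^4 \<Rightarrow> real" where
  "inner2 G a b = 1/2 * (\<Sum>i\<in>UNIV. \<Sum>j\<in>UNIV. \<Sum>k\<in>UNIV. \<Sum>l\<in>UNIV.
     matrix_inv G $ i $ k * matrix_inv G $ j $ l * a $ i $ j * b $ k $ l)"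

definition inner3 :: "real^4^4 \<Rightarrow> real^4^4^4 \<Rightarrow> real^4^4^4 \<Rightarrow> real" where
  "inner3 G a b = 1/6 * (\<Sum>i\<in>UNIV. \<Sum>j\<in>UNIV. \<Sum>m\<in>UNIV. \<Sum>k\<in>UNIV. \<Sum>l\<in>UNIV. \<Sum>n\<in>UNIV.
     matrix_inv G $ i $ k * matrix_inv G $ j $ l * matrix_inv G $ m $ n *
     a $ i $ j $ m * b $ k $ l $ n)"

definition wedge :: "real^4 \<Rightarrow> real^4 \<Rightarrow> real^4^4" where
  "wedge a b = (\<chi> i j. a $ i * b $ j - a $ j * b $ i)"

definition levi_civita_symbol :: "4 \<Rightarrow> 4 \<Rightarrow> 4 \<Rightarrow> 4 \<Rightarrow> real" where
  "levi_civita_symbol i j k l =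
     det (\<chi> r. axis (if r = 1 then i else if r = 2 then j else if r = 3 then k else l) 1 :: real^4^4)"

text \<open>In positively oriented coordinates the volume form has components
  \<open>sqrt (det G) * levi_civita_symbol i j k l\<close>; the Hodge star of \<open>a\<close> is the 2-form with
  \<open>b \<and> \<star>a = \<langle>b, a\<rangle> vol\<close> for all 2-forms \<open>b\<close>.\<close>

definition hodge :: "real^4^4 \<Rightarrow> real^4^4 \<Rightarrow> real^4^4" where
  "hodge G a = (\<chi> i j. 1/2 * (\<Sum>k\<in>UNIV. \<Sum>l\<in>UNIV. \<Sum>m\<in>UNIV. \<Sum>n\<in>UNIV.
     sqrt (det G) * levi_civita_symbol k l i j *
     matrix_inv G $ k $ m * matrix_inv G $ l $ n * a $ m $ n))"

definition orthonormal_basis :: "real^4^4 \<Rightarrow> (4 \<Rightarrow> real^4) \<Rightarrow> bool" where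
  "orthonormal_basis G e \<longleftrightarrow> (\<forall>i j. e i \<bullet> (G *v e j) = (if i = j then 1 else 0))"

definition dual_basis :: "(4 \<Rightarrow> real^4) \<Rightarrow> (4 \<Rightarrow> real^4) \<Rightarrow> bool" where
  "dual_basis e w \<longleftrightarrow> (\<forall>i j. w i \<bullet> e j = (if i = j then 1 else 0))"

text \<open>The basis \<open>e\<close> brings the 2-form \<open>a\<close> into normal form. No orientation of \<open>e\<close> is prescribed.\<close>

definition adapted_basis :: "real^4^4 \<Rightarrow> real^4^4 \<Rightarrow> (4 \<Rightarrow> real^4) \<Rightarrow> bool" where
  "adapted_basis G a e \<longleftrightarrow> orthonormal_basis G e \<and>
     (\<exists>w l1 l2. dual_basis e w \<and> a = l1 *\<^sub>R wedge (w 1) (w 2) + l2 *\<^sub>R wedge (w 3) (w 4))"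


section \<open>Exterior derivative, codifferential, harmonic 2-forms\<close>

definition d1 :: "(real^4 \<Rightarrow> real^4) \<Rightarrow> real^4 \<Rightarrow> real^4^4" where
  "d1 \<alpha> x = (\<chi> i j. partial i (\<lambda>y. \<alpha> y $ j) x - partial j (\<lambda>y. \<alpha> y $ i) x)"

definition d2 :: "(real^4 \<Rightarrow> real^4^4) \<Rightarrow> real^4 \<Rightarrow> real^4^4^4" where
  "d2 \<phi> x = (\<chi> i j k. partial i (\<lambda>y. \<phi> y $ j $ k) x + partial j (\<lambda>y. \<phi> y $ k $ i) x
     + partial k (\<lambda>y. \<phi> y $ i $ j) x)"

text \<open>Integration over the compact manifold against the Riemannian volume: given a finite list of
  charts covering it, the manifold is the disjoint union of the pieces that lie in the \<open>i\<close>-th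
  chart domain but in no earlier one, and each piece is integrated in its chart. For the
  chart-independent continuous functions integrated below the result does not depend on the list.\<close>

definition chart_cover :: "'a chart set \<Rightarrow> 'a chart list \<Rightarrow> bool" where
  "chart_cover A cs \<longleftrightarrow> set cs \<subseteq> A \<and> (\<Union>c\<in>set cs. chart_dom c) = UNIV"

definition integral_over ::
  "('a chart \<Rightarrow> real^4 \<Rightarrow> real^4^4) \<Rightarrow> 'a chart list \<Rightarrow> ('a chart \<Rightarrow> real^4 \<Rightarrow> real) \<Rightarrow> real" where
  "integral_over g cs s = (\<Sum>i<length cs.
     set_lebesgue_integral lborel
       (chart_map (cs ! i) ` (chart_dom (cs ! i) - (\<Union>j<i. chart_dom (cs ! j))))
       (\<lambda>x. s (cs ! i) x * sqrt (det (g (cs ! i) x))))"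

text \<open>\<open>codifferential2 A g \<phi> \<eta>\<close> says \<open>\<delta>\<phi> = \<eta>\<close>, and \<open>codifferential3 A g \<xi> \<zeta>\<close> says \<open>\<delta>\<xi> = \<zeta>\<close>,
  where \<open>\<delta>\<close> is the adjoint of the exterior derivative for the global inner products; adjointness
  determines \<open>\<eta>\<close> and \<open>\<zeta>\<close> uniquely.\<close>

definition codifferential2 ::
  "'a chart set \<Rightarrow> ('a chart \<Rightarrow> real^4 \<Rightarrow> real^4^4) \<Rightarrow>
   ('a chart \<Rightarrow> real^4 \<Rightarrow> real^4^4) \<Rightarrow> ('a chart \<Rightarrow> real^4 \<Rightarrow> real^4) \<Rightarrow> bool" where
  "codifferential2 A g \<phi> \<eta> \<longleftrightarrow> form1 A \<eta> \<and>
     (\<forall>\<alpha> cs. form1 A \<alpha> \<longrightarrow> chart_cover A cs \<longrightarrow>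
        integral_over g cs (\<lambda>c x. inner2 (g c x) (d1 (\<alpha> c) x) (\<phi> c x)) =
        integral_over g cs (\<lambda>c x. inner1 (g c x) (\<alpha> c x) (\<eta> c x)))"

definition codifferential3 ::
  "'a chart set \<Rightarrow> ('a chart \<Rightarrow> real^4 \<Rightarrow> real^4^4) \<Rightarrow>
   ('a chart \<Rightarrow> real^4 \<Rightarrow> real^4^4^4) \<Rightarrow> ('a chart \<Rightarrow> real^4 \<Rightarrow> real^4^4) \<Rightarrow> bool" where
  "codifferential3 A g \<xi> \<zeta> \<longleftrightarrow> form2 A \<zeta> \<and>
     (\<forall>\<psi> cs. form2 A \<psi> \<longrightarrow> chart_cover A cs \<longrightarrow>
        integral_over g cs (\<lambda>c x. inner3 (g c x) (d2 (\<psi> c) x) (\<xi> c x)) =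
        integral_over g cs (\<lambda>c x. inner2 (g c x) (\<psi> c x) (\<zeta> c x)))"

definition harmonic_form2 ::
  "'a chart set \<Rightarrow> ('a chart \<Rightarrow> real^4 \<Rightarrow> real^4^4) \<Rightarrow> ('a chart \<Rightarrow> real^4 \<Rightarrow> real^4^4) \<Rightarrow> bool" where
  "harmonic_form2 A g \<phi> \<longleftrightarrow> form2 A \<phi> \<and>
     (\<exists>\<eta> \<zeta>. codifferential2 A g \<phi> \<eta> \<and> codifferential3 A g (\<lambda>c. d2 (\<phi> c)) \<zeta> \<and>
        (\<forall>c\<in>A. \<forall>x\<in>chart_img c. d1 (\<eta> c) x + \<zeta> c x = 0))"


section \<open>Levi-Civita connection, curvature, Laplacian\<close>

text \<open>From here on \<open>g\<close> is the metric in one fixed chart; vector fields and forms are given by their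
  components in that chart. \<open>christoffel g x i j $ k\<close> is the symbol with upper index \<open>k\<close> and lower
  indices \<open>i\<close>, \<open>j\<close>.\<close>

definition christoffel :: "(real^4 \<Rightarrow> real^4^4) \<Rightarrow> real^4 \<Rightarrow> 4 \<Rightarrow> 4 \<Rightarrow> real^4" where
  "christoffel g x i j = (\<chi> k. 1/2 * (\<Sum>l\<in>UNIV. matrix_inv (g x) $ k $ l *
     (partial i (\<lambda>y. g y $ j $ l) x + partial j (\<lambda>y. g y $ i $ l) x
      - partial l (\<lambda>y. g y $ i $ j) x)))"

definition nabla ::
  "(real^4 \<Rightarrow> real^4^4) \<Rightarrow> (real^4 \<Rightarrow> real^4) \<Rightarrow> (real^4 \<Rightarrow> real^4) \<Rightarrow> real^4 \<Rightarrow> real^4" where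
  "nabla g X Y x = frechet_derivative Y (at x) (X x) +
     (\<Sum>i\<in>UNIV. \<Sum>j\<in>UNIV. (X x $ i * Y x $ j) *\<^sub>R christoffel g x i j)"

definition lie_bracket :: "(real^4 \<Rightarrow> real^4) \<Rightarrow> (real^4 \<Rightarrow> real^4) \<Rightarrow> real^4 \<Rightarrow> real^4" where
  "lie_bracket X Y x = frechet_derivative Y (at x) (X x) - frechet_derivative X (at x) (Y x)"

definition curvature ::
  "(real^4 \<Rightarrow> real^4^4) \<Rightarrow> (real^4 \<Rightarrow> real^4) \<Rightarrow> (real^4 \<Rightarrow> real^4) \<Rightarrow> (real^4 \<Rightarrow> real^4) \<Rightarrow>
   real^4 \<Rightarrow> real^4" where
  "curvature g X Y Z x = - nabla g X (nabla g Y Z) x + nabla g Y (nabla g X Z) x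
     + nabla g (lie_bracket X Y) Z x"

text \<open>The curvature is tensorial, so tangent vectors may be extended to vector fields with constant
  components.\<close>

definition Riem :: "(real^4 \<Rightarrow> real^4^4) \<Rightarrow> real^4 \<Rightarrow> real^4 \<Rightarrow> real^4 \<Rightarrow> real^4 \<Rightarrow> real^4 \<Rightarrow> real" where
  "Riem g x u v w z = curvature g (\<lambda>_. u) (\<lambda>_. v) (\<lambda>_. w) x \<bullet> (g x *v z)"

text \<open>\<open>(\<nabla>\<^sub>u\<psi>)(Y, Z) = u(\<psi>(Y, Z)) - \<psi>(\<nabla>\<^sub>uY, Z) - \<psi>(Y, \<nabla>\<^sub>uZ)\<close> for coordinate vector fields \<open>Y\<close>, \<open>Z\<close>.\<close>

definition nabla_form2 :: "(real^4 \<Rightarrow> real^4^4) \<Rightarrow> real^4 \<Rightarrow> (real^4 \<Rightarrow> real^4^4) \<Rightarrow> real^4 \<Rightarrow> real^4^4" where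
  "nabla_form2 g u \<psi> x = (\<chi> i j.
     frechet_derivative (\<lambda>y. \<psi> y $ i $ j) (at x) u
     - nabla g (\<lambda>_. u) (\<lambda>_. axis i 1) x \<bullet> (\<psi> x *v axis j 1)
     - axis i 1 \<bullet> (\<psi> x *v nabla g (\<lambda>_. u) (\<lambda>_. axis j 1) x))"

definition norm2_nabla_form2 ::
  "(real^4 \<Rightarrow> real^4^4) \<Rightarrow> (4 \<Rightarrow> real^4) \<Rightarrow> (real^4 \<Rightarrow> real^4^4) \<Rightarrow> real^4 \<Rightarrow> real" where
  "norm2_nabla_form2 g e \<psi> x =
     (\<Sum>i\<in>UNIV. inner2 (g x) (nabla_form2 g (e i) \<psi> x) (nabla_form2 g (e i) \<psi> x))"

definition grad :: "(real^4 \<Rightarrow> real^4^4) \<Rightarrow> (real^4 \<Rightarrow> real) \<Rightarrow> real^4 \<Rightarrow> real^4" where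
  "grad g f x = matrix_inv (g x) *v (\<chi> i. partial i f x)"

definition divergence :: "(real^4 \<Rightarrow> real^4^4) \<Rightarrow> (real^4 \<Rightarrow> real^4) \<Rightarrow> real^4 \<Rightarrow> real" where
  "divergence g X x = (\<Sum>i\<in>UNIV. nabla g (\<lambda>_. axis i 1) X x $ i)"

definition laplacian :: "(real^4 \<Rightarrow> real^4^4) \<Rightarrow> (real^4 \<Rightarrow> real) \<Rightarrow> real^4 \<Rightarrow> real" where
  "laplacian g f x = divergence g (grad g f) x"


section \<open>Norm of 2-forms in orthonormal frames, compatibility of the connection with the metric\<close>

lemma levi_civita_symbol_1234: "levi_civita_symbol 1 2 3 4 = 1"
proof -
  have "(\<chi> r. axis (if r = 1 then 1 else if r = 2 then 2 else if r = 3 then 3 else 4) 1 :: real^4^4)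
      = mat 1"
    by (simp add: vec_eq_iff forall_4 mat_def axis_def)
  then show ?thesis by (simp add: levi_civita_symbol_def)
qed

lemma matrix_inv_eqI:
  fixes A B :: "real^'n^'n"
  assumes "A ** B = mat 1"
  shows "matrix_inv A = B"
proof -
  have BA: "B ** A = mat 1"
    using assms matrix_left_right_inverse by blast
  have "A ** matrix_inv A = mat 1 \<and> matrix_inv A ** A = mat 1"
    unfolding matrix_inv_def
    by (rule someI[where P = "\<lambda>A'. A ** A' = mat 1 \<and> A' ** A = mat 1" and x = B])
      (simp add: assms BA)
  then show ?thesis
    by (metis BA matrix_mul_assoc matrix_mul_lid matrix_mul_rid)
qed

lemma matrix_inv_orthonormal:
  assumes "orthonormal_basis G e"
  shows "matrix_inv G $ i $ k = (\<Sum>p\<in>UNIV. e p $ i * e p $ k)"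
proof -
  define E :: "real^4^4" where "E = (\<chi> i p. e p $ i)"
  have "transpose E ** (G ** E) = mat 1"
    using assms unfolding orthonormal_basis_def
    by (simp add: vec_eq_iff E_def matrix_matrix_mult_def transpose_def mat_def
        inner_vec_def matrix_vector_mult_def)
  then have "(G ** E) ** transpose E = mat 1"
    using matrix_left_right_inverse by blast
  then have "matrix_inv G = E ** transpose E"
    by (intro matrix_inv_eqI) (simp add: matrix_mul_assoc)
  then show ?thesis
    by (simp add: E_def matrix_matrix_mult_def transpose_def)
qed

lemma inner2_orthonormal:
  assumes "orthonormal_basis G e"
  shows "inner2 G a b =
    1/2 * (\<Sum>p\<in>UNIV. \<Sum>q\<in>UNIV. (e p \<bullet> (a *v e q)) * (e p \<bullet> (b *v e q)))"
proof -
  have swap: "(\<Sum>q\<in>Q. \<Sum>i\<in>I. \<Sum>j\<in>J. \<Sum>k\<in>K. \<Sum>l\<in>L. f q i j k l) =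
      (\<Sum>i\<in>I. \<Sum>j\<in>J. \<Sum>k\<in>K. \<Sum>l\<in>L. \<Sum>q\<in>Q. f q i j k l)"
    for Q I J K L :: "4 set" and f :: "4 \<Rightarrow> 4 \<Rightarrow> 4 \<Rightarrow> 4 \<Rightarrow> 4 \<Rightarrow> real"
    by (subst sum.swap, rule sum.cong[OF refl], subst sum.swap, rule sum.cong[OF refl],
        subst sum.swap, rule sum.cong[OF refl], rule sum.swap)
  have bil: "e p \<bullet> (c *v e q) = (\<Sum>i\<in>UNIV. \<Sum>j\<in>UNIV. e p $ i * e q $ j * c $ i $ j)"
    for p q and c :: "real^4^4"
    by (simp add: inner_vec_def matrix_vector_mult_def sum_distrib_left mult_ac)
  have "(\<Sum>p\<in>UNIV. \<Sum>q\<in>UNIV. (e p \<bullet> (a *v e q)) * (e p \<bullet> (b *v e q))) =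
     (\<Sum>p\<in>UNIV. \<Sum>q\<in>UNIV. \<Sum>i\<in>UNIV. \<Sum>j\<in>UNIV. \<Sum>k\<in>UNIV. \<Sum>l\<in>UNIV.
        (e p $ i * e p $ k) * (e q $ j * e q $ l) * a $ i $ j * b $ k $ l)"
    unfolding bil sum_distrib_right unfolding sum_distrib_left by (simp only: mult_ac)
  also have "\<dots> = (\<Sum>i\<in>UNIV. \<Sum>j\<in>UNIV. \<Sum>k\<in>UNIV. \<Sum>l\<in>UNIV. \<Sum>p\<in>UNIV. \<Sum>q\<in>UNIV.
        (e p $ i * e p $ k) * (e q $ j * e q $ l) * a $ i $ j * b $ k $ l)"
    by (rule trans[OF sum.cong[OF refl swap] swap])
  also have "\<dots> = (\<Sum>i\<in>UNIV. \<Sum>j\<in>UNIV. \<Sum>k\<in>UNIV. \<Sum>l\<in>UNIV.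
        matrix_inv G $ i $ k * matrix_inv G $ j $ l * a $ i $ j * b $ k $ l)"
    unfolding matrix_inv_orthonormal[OF assms] sum_product
    by (simp only: sum_distrib_right)
  finally show ?thesis by (simp add: inner2_def)
qed

lemma christoffel_metric:
  assumes sym: "\<forall>\<^sub>F y in nhds x. transpose (g y) = g y" and inv: "invertible (g x)"
  shows "partial k (\<lambda>y. g y $ i $ j) x =
    christoffel g x k i \<bullet> (g x *v axis j 1) + christoffel g x k j \<bullet> (g x *v axis i 1)"
proof -
  have ev: "\<forall>\<^sub>F y in at x. g y $ a $ b = g y $ b $ a" and eq: "g x $ a $ b = g x $ b $ a" for a b
  proof -
    have *: "\<forall>\<^sub>F y in nhds x. g y $ a $ b = g y $ b $ a"
      using sym
    proof eventually_elim
      case (elim y)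
      then have "transpose (g y) $ b $ a = g y $ b $ a" by (rule arg_cong)
      then show ?case by (simp add: transpose_def)
    qed
    then show "\<forall>\<^sub>F y in at x. g y $ a $ b = g y $ b $ a"
      unfolding eventually_at_filter by eventually_elim blast
    show "g x $ a $ b = g x $ b $ a"
      using * by (rule eventually_nhds_x_imp_x)
  qed
  have dsym: "((\<lambda>y. g y $ b $ a) has_derivative D) (at x)"
    if "((\<lambda>y. g y $ a $ b) has_derivative D) (at x)" for a b D
    using that ev eq UNIV_I by (rule has_derivative_transform_eventually)
  have psym: "partial c (\<lambda>y. g y $ a $ b) x = partial c (\<lambda>y. g y $ b $ a) x" for a b c
  proof -
    have "((\<lambda>y. g y $ a $ b) has_derivative D) (at x) = ((\<lambda>y. g y $ b $ a) has_derivative D) (at x)"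
      for D
      using dsym by blast
    then show ?thesis by (simp add: partial_def frechet_derivative_def)
  qed
  have ginv: "g x ** matrix_inv (g x) = mat 1"
    using inv matrix_inv_eqI unfolding invertible_def by blast
  have lower: "christoffel g x a b \<bullet> (g x *v axis c 1) =
      1/2 * (partial a (\<lambda>y. g y $ b $ c) x + partial b (\<lambda>y. g y $ a $ c) x
        - partial c (\<lambda>y. g y $ a $ b) x)" for a b c
  proof -
    define D where "D l = partial a (\<lambda>y. g y $ b $ l) x + partial b (\<lambda>y. g y $ a $ l) x
        - partial l (\<lambda>y. g y $ a $ b) x" for l
    have "christoffel g x a b \<bullet> (g x *v axis c 1) =
        (\<Sum>m\<in>UNIV. 1/2 * (\<Sum>l\<in>UNIV. matrix_inv (g x) $ m $ l * D l) * g x $ m $ c)"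
      by (simp add: christoffel_def D_def inner_vec_def matrix_vector_mult_basis column_def)
    also have "\<dots> = (\<Sum>m\<in>UNIV. \<Sum>l\<in>UNIV. 1/2 * (g x $ c $ m * matrix_inv (g x) $ m $ l) * D l)"
      by (simp add: sum_distrib_left sum_distrib_right eq[of _ c] mult_ac)
    also have "\<dots> = (\<Sum>l\<in>UNIV. 1/2 * (g x ** matrix_inv (g x)) $ c $ l * D l)"
      by (subst sum.swap) (simp add: matrix_matrix_mult_def sum_distrib_left sum_distrib_right mult_ac)
    also have "\<dots> = (\<Sum>l\<in>UNIV. if l = c then 1/2 * D l else 0)"
      unfolding ginv by (intro sum.cong) (auto simp: mat_def)
    also have "\<dots> = 1/2 * D c" by simp
    finally show ?thesis by (simp add: D_def)
  qed
  show ?thesis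
    unfolding lower psym[of k j i] by (simp add: field_simps)
qed

end

theory Submission
  imports Defs
begin

text \<open>
  On a compact manifold a harmonic 2-form \<open>\<phi>\<close> is closed and coclosed, and the Hodge star exchanges
  the two conditions, so \<open>\<phi>\<^sub>+\<close> and \<open>\<phi>\<^sub>-\<close> are closed and coclosed as well. For such a form \<open>\<psi>\<close>,
  commuting covariant derivatives gives the Bochner formula: half the Laplacian of \<open>\<bar>\<psi>\<bar>\<^sup>2\<close> is
  \<open>\<bar>\<nabla>\<psi>\<bar>\<^sup>2\<close> plus a curvature term. In a basis where \<open>\<psi>\<close> is a multiple of
  \<open>\<omega>\<^sup>1 \<and> \<omega>\<^sup>2 + s \<omega>\<^sup>3 \<and> \<omega>\<^sup>4\<close>, \<open>s = \<plusminus>1\<close>, that term is \<open>(4 K - 4 s R\<^sub>1\<^sub>2\<^sub>3\<^sub>4)\<close> times \<open>\<bar>\<psi>\<bar>\<^sup>2 / 2\<close>. Since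
  \<open>\<phi>\<^sub>+\<close> and \<open>\<phi>\<^sub>-\<close> have opposite signs \<open>s\<close>, the contributions of \<open>R\<^sub>1\<^sub>2\<^sub>3\<^sub>4\<close> cancel in
  \<open>\<Delta>(F G) = F \<Delta>G + G \<Delta>F + 2 \<langle>\<nabla>F, \<nabla>G\<rangle>\<close>.
\<close>

section \<open>Partial derivatives and smooth functions\<close>

text \<open>The codifferential is given only through global pairings, so \<delta>\<phi> = 0 is at
  first a statement about integrals. The coordinate identity needed for the Bochner formula is
  extracted by pairing with 1-forms \<open>bump\<close> times dx^m supported in one chart. As the
  integral of a non-integrable function is 0 by convention, inferring from a zero integral that a
  non-negative function vanishes requires integrability over a whole chart image, where the
  integrand need not be bounded; compactness of the manifold supplies it. An adapted basis exists at
  each point but need not extend to a smooth adapted frame. So all differentiation is done in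
  coordinates, with matrices of Christoffel symbols, and only the resulting tensor identities are
  evaluated on a basis at the point. That basis may have either orientation s. The star exchanges l1
  and l2 up to s, so, writing w12 and w34 for the two basic wedge products, the self-dual part is
  (l1 + s l2)(w12 + s w34) and the anti-self-dual part is (l1 - s l2)(w12 - s w34). One basis thus
  normalises both forms, and one K serves both Bochner formulas.\<close>

lemma partial_eqI: "(f has_derivative f') (at x) \<Longrightarrow> partial i f x = f' (axis i 1)"
  unfolding partial_def using frechet_derivative_at by metis

lemma frechet_derivative_partial:
  assumes "f differentiable (at x)"
  shows "frechet_derivative f (at x) v = (\<Sum>i\<in>UNIV. v $ i * partial i f x)"
proof -
  have l: "linear (frechet_derivative f (at x))"
    using assms by (rule linear_frechet_derivative)
  have "frechet_derivative f (at x) v = frechet_derivative f (at x) (\<Sum>i\<in>UNIV. v $ i *\<^sub>R axis i 1)"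
    using basis_expansion[of v] by (simp add: scalar_mult_eq_scaleR)
  also have "\<dots> = (\<Sum>i\<in>UNIV. v $ i * partial i f x)"
    by (simp add: linear_sum[OF l] linear_scale[OF l] partial_def o_def)
  finally show ?thesis .
qed

lemma has_derivative_partial:
  assumes "f differentiable (at x)"
  shows "(f has_derivative (\<lambda>v. \<Sum>i\<in>UNIV. v $ i * partial i f x)) (at x)"
proof -
  have "(f has_derivative frechet_derivative f (at x)) (at x)"
    using assms frechet_derivative_works by blast
  then show ?thesis
    using frechet_derivative_partial[OF assms] by (metis (no_types, lifting) ext)
qed

lemma partial_const [simp]: "partial i (\<lambda>x. c) x = 0"
  by (rule partial_eqI[THEN trans]) (auto intro!: derivative_intros)

lemma partial_component: "partial i (\<lambda>x. x $ j) x = (if i = j then 1 else 0)"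
  by (rule partial_eqI[THEN trans, OF bounded_linear.has_derivative[OF bounded_linear_vec_nth has_derivative_ident]])
    (simp add: axis_def)

lemma partial_add:
  assumes "f differentiable (at x)" "g differentiable (at x)"
  shows "partial i (\<lambda>x. f x + g x) x = partial i f x + partial i g x"
  by (rule partial_eqI[THEN trans, OF has_derivative_add])
    (use assms frechet_derivative_works in \<open>auto simp: partial_def\<close>)

lemma partial_diff:
  assumes "f differentiable (at x)" "g differentiable (at x)"
  shows "partial i (\<lambda>x. f x - g x) x = partial i f x - partial i g x"
  by (rule partial_eqI[THEN trans, OF has_derivative_diff])
    (use assms frechet_derivative_works in \<open>auto simp: partial_def\<close>)

lemma partial_minus:
  assumes "f differentiable (at x)"
  shows "partial i (\<lambda>x. - f x) x = - partial i f x"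
  by (rule partial_eqI[THEN trans, OF has_derivative_minus])
    (use assms frechet_derivative_works in \<open>auto simp: partial_def\<close>)

lemma partial_mult:
  assumes "f differentiable (at x)" "g differentiable (at x)"
  shows "partial i (\<lambda>x. f x * g x) x = partial i f x * g x + f x * partial i g x"
  by (rule partial_eqI[THEN trans, OF has_derivative_mult])
    (use assms frechet_derivative_works in \<open>auto simp: partial_def\<close>)

lemma partial_cmult:
  assumes "f differentiable (at x)"
  shows "partial i (\<lambda>x. c * f x) x = c * partial i f x"
  using partial_mult[of "\<lambda>x. c" x f i] assms by simp

lemma partial_sum:
  assumes "\<And>a. a \<in> I \<Longrightarrow> f a differentiable (at x)"
  shows "partial i (\<lambda>x. \<Sum>a\<in>I. f a x) x = (\<Sum>a\<in>I. partial i (f a) x)"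
  by (rule partial_eqI[THEN trans, OF has_derivative_sum[of I f "\<lambda>a. frechet_derivative (f a) (at x)"]])
    (use assms frechet_derivative_works in \<open>auto simp: partial_def\<close>)

lemma partial_sum2:
  fixes f :: "'a::finite \<Rightarrow> 'b::finite \<Rightarrow> real^4 \<Rightarrow> real"
  assumes "\<And>a b. f a b differentiable (at x)"
  shows "partial i (\<lambda>x. \<Sum>a\<in>UNIV. \<Sum>b\<in>UNIV. f a b x) x = (\<Sum>a\<in>UNIV. \<Sum>b\<in>UNIV. partial i (f a b) x)"
proof -
  have "partial i (\<lambda>x. \<Sum>a\<in>UNIV. \<Sum>b\<in>UNIV. f a b x) x = (\<Sum>a\<in>UNIV. partial i (\<lambda>x. \<Sum>b\<in>UNIV. f a b x) x)"
    by (intro partial_sum differentiable_sum finite ballI assms)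
  also have "\<dots> = (\<Sum>a\<in>UNIV. \<Sum>b\<in>UNIV. partial i (f a b) x)"
    by (intro sum.cong refl partial_sum assms)
  finally show ?thesis .
qed

lemma partial_chain1:
  assumes "f differentiable (at x)" "(h has_real_derivative h') (at (f x))"
  shows "partial i (\<lambda>x. h (f x)) x = h' * partial i f x"
proof -
  have "((\<lambda>x. h (f x)) has_derivative (\<lambda>v. h' * frechet_derivative f (at x) v)) (at x)"
    using has_derivative_compose[of f "frechet_derivative f (at x)" x UNIV h "(*) h'"] assms
    by (simp add: frechet_derivative_works has_field_derivative_def)
  then show ?thesis by (rule partial_eqI[THEN trans]) (simp add: partial_def)
qed

lemma differentiable_vec:
  fixes \<tau> :: "real^4 \<Rightarrow> real^4"
  assumes "\<And>a. (\<lambda>y. \<tau> y $ a) differentiable (at x)"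
  shows "(\<tau> has_derivative (\<lambda>v. \<chi> a. \<Sum>i\<in>UNIV. v $ i * partial i (\<lambda>y. \<tau> y $ a) x)) (at x)"
proof -
  have "\<And>b. b \<in> Basis \<Longrightarrow> ((\<lambda>y. \<tau> y \<bullet> b) has_derivative
      (\<lambda>v. (\<chi> a. \<Sum>i\<in>UNIV. v $ i * partial i (\<lambda>y. \<tau> y $ a) x) \<bullet> b)) (at x)"
  proof -
    fix b :: "real^4" assume "b \<in> Basis"
    then obtain a where b: "b = axis a 1" by (auto simp: Basis_vec_def)
    show "((\<lambda>y. \<tau> y \<bullet> b) has_derivative
      (\<lambda>v. (\<chi> a. \<Sum>i\<in>UNIV. v $ i * partial i (\<lambda>y. \<tau> y $ a) x) \<bullet> b)) (at x)"
      unfolding b inner_axis using has_derivative_partial[OF assms[of a]] by simp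
  qed
  then show ?thesis using has_derivative_componentwise_within by blast
qed

lemma partial_compose:
  assumes "\<And>a. (\<lambda>y. \<tau> y $ a) differentiable (at x)" "f differentiable (at (\<tau> x))"
  shows "(\<lambda>y. f (\<tau> y)) differentiable (at x)"
    and "partial i (\<lambda>y. f (\<tau> y)) x = (\<Sum>a\<in>UNIV. partial a f (\<tau> x) * partial i (\<lambda>y. \<tau> y $ a) x)"
proof -
  have *: "((\<lambda>y. f (\<tau> y)) has_derivative
      (\<lambda>v. \<Sum>a\<in>UNIV. (\<Sum>i\<in>UNIV. v $ i * partial i (\<lambda>y. \<tau> y $ a) x) * partial a f (\<tau> x))) (at x)"
    using has_derivative_compose[OF differentiable_vec[OF assms(1)] has_derivative_partial[OF assms(2)]]
    by simp
  then show "(\<lambda>y. f (\<tau> y)) differentiable (at x)" unfolding differentiable_def by blast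
  show "partial i (\<lambda>y. f (\<tau> y)) x = (\<Sum>a\<in>UNIV. partial a f (\<tau> x) * partial i (\<lambda>y. \<tau> y $ a) x)"
    by (rule partial_eqI[OF *, THEN trans])
      (simp add: axis_def if_distrib[of "\<lambda>t. t * _"] mult.commute cong: if_cong)
qed

section \<open>Locality and closure properties of smooth functions\<close>

lemma has_derivative_cong_open:
  assumes "open S" "x \<in> S" "\<And>y. y \<in> S \<Longrightarrow> f y = g y"
  shows "(f has_derivative D) (at x) \<longleftrightarrow> (g has_derivative D) (at x)"
  using assms has_derivative_transform_within_open by metis

lemma differentiable_cong_open:
  assumes "open S" "x \<in> S" "\<And>y. y \<in> S \<Longrightarrow> f y = g y"
  shows "f differentiable (at x) \<longleftrightarrow> g differentiable (at x)"
  unfolding differentiable_def using has_derivative_cong_open[of S x f g, OF assms] by simp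

lemma partial_cong_open:
  assumes "open S" "x \<in> S" "\<And>y. y \<in> S \<Longrightarrow> f y = g y"
  shows "partial i f x = partial i g x"
  unfolding partial_def frechet_derivative_def using has_derivative_cong_open[of S x f g, OF assms] by simp

text \<open>Derivatives at a point of an open set depend only on values nearby. This allows
  \<open>partial i f\<close> to be replaced by a formula valid only on \<open>S\<close>, which is
  how the closure lemmas below run their inductions.\<close>

lemma Ck_on_cong:
  assumes "open S" "\<And>y. y \<in> S \<Longrightarrow> f y = g y"
  shows "Ck_on k S f \<longleftrightarrow> Ck_on k S g"
  using assms(2)
proof (induction k arbitrary: f g)
  case 0
  then show ?case by (simp cong: continuous_on_cong)
next
  case (Suc k)
  have "Ck_on k S (partial i f) = Ck_on k S (partial i g)" for i
    by (rule Suc.IH) (rule partial_cong_open[OF assms(1)], auto simp: Suc.prems)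
  moreover have "x \<in> S \<Longrightarrow> f differentiable (at x) \<longleftrightarrow> g differentiable (at x)" for x
    by (rule differentiable_cong_open[OF assms(1)]) (auto simp: Suc.prems)
  ultimately show ?case by simp
qed

lemma Ck_on_Suc_imp: "Ck_on (Suc k) S f \<Longrightarrow> Ck_on k S f"
proof (induction k arbitrary: f)
  case 0
  then show ?case
    by (auto intro!: continuous_at_imp_continuous_on differentiable_imp_continuous_within)
next
  case (Suc k)
  then show ?case using Ck_on.simps(2)[of k S f] Ck_on.simps(2)[of "Suc k" S f] by blast
qed

lemma Ck_on_continuous: "Ck_on k S f \<Longrightarrow> continuous_on S f"
  by (induction k) (use Ck_on.simps(1) Ck_on_Suc_imp in blast)+

lemma Ck_on_subset: "Ck_on k S f \<Longrightarrow> T \<subseteq> S \<Longrightarrow> Ck_on k T f"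
  by (induction k arbitrary: f) (auto intro: continuous_on_subset)

lemma Ck_on_Un:
  assumes "open S" "open T" "Ck_on k S f" "Ck_on k T f"
  shows "Ck_on k (S \<union> T) f"
  using assms(3,4)
  by (induction k arbitrary: f) (auto intro: continuous_on_open_Un assms(1,2))

lemma Ck_on_const: "Ck_on k S (\<lambda>x. c)"
proof (induction k arbitrary: c)
  case (Suc k)
  have "partial i (\<lambda>x. c) = (\<lambda>x. 0)" for i by (rule ext) simp
  then show ?case using Suc by simp
qed simp

lemma Ck_on_add:
  assumes "open S"
  shows "Ck_on k S f \<Longrightarrow> Ck_on k S g \<Longrightarrow> Ck_on k S (\<lambda>x. f x + g x)"
proof (induction k arbitrary: f g)
  case (Suc k)
  have "Ck_on k S (partial i (\<lambda>x. f x + g x))" for i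
    by (subst Ck_on_cong[OF assms, where g = "\<lambda>x. partial i f x + partial i g x"])
      (use Suc in \<open>auto intro!: partial_add\<close>)
  then show ?case using Suc.prems by simp
qed (auto intro: continuous_intros)

lemma Ck_on_mult:
  assumes "open S"
  shows "Ck_on k S f \<Longrightarrow> Ck_on k S g \<Longrightarrow> Ck_on k S (\<lambda>x. f x * g x)"
proof (induction k arbitrary: f g)
  case (Suc k)
  have "Ck_on k S (partial i (\<lambda>x. f x * g x))" for i
  proof (subst Ck_on_cong[OF assms])
    show "Ck_on k S (\<lambda>x. partial i f x * g x + f x * partial i g x)"
      using Suc.prems by (intro Ck_on_add[OF assms] Suc.IH) (simp_all add: Ck_on_Suc_imp)
  qed (use Suc.prems in \<open>auto intro!: partial_mult\<close>)
  then show ?case using Suc.prems by (simp add: differentiable_mult)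
qed (auto intro: continuous_intros)

text \<open>The derivative is a product in which \<open>inverse (f x)\<close> itself reappears, so
  the induction hypothesis for the same \<open>f\<close> suffices. The square root below is treated
  in the same way.\<close>

lemma Ck_on_inverse:
  assumes "open S" "\<And>x. x \<in> S \<Longrightarrow> f x \<noteq> 0"
  shows "Ck_on k S f \<Longrightarrow> Ck_on k S (\<lambda>x. inverse (f x))"
proof (induction k)
  case (Suc k)
  have IH: "Ck_on k S (\<lambda>x. inverse (f x))" using Suc Ck_on_Suc_imp by blast
  have "Ck_on k S (partial i (\<lambda>x. inverse (f x)))" for i
  proof (subst Ck_on_cong[OF assms(1)])
    show "Ck_on k S (\<lambda>x. ((-1) * (inverse (f x) * inverse (f x))) * partial i f x)"
      using Suc.prems by (intro Ck_on_mult[OF assms(1)] IH Ck_on_const) simp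
    fix x assume "x \<in> S"
    then show "partial i (\<lambda>x. inverse (f x)) x = ((-1) * (inverse (f x) * inverse (f x))) * partial i f x"
      using Suc.prems assms(2)
      by (intro partial_chain1[of f x inverse]) (auto intro!: DERIV_inverse[THEN DERIV_cong] simp: power2_eq_square)
  qed
  moreover have "(\<lambda>x. inverse (f x)) differentiable (at x)" if "x \<in> S" for x
    using Suc.prems assms(2) that by (simp add: differentiable_inverse)
  ultimately show ?case by simp
qed (auto intro!: continuous_intros assms)

lemma Ck_on_sqrt:
  assumes "open S" "\<And>x. x \<in> S \<Longrightarrow> f x > 0"
  shows "Ck_on k S f \<Longrightarrow> Ck_on k S (\<lambda>x. sqrt (f x))"
proof (induction k)
  case (Suc k)
  have IH: "Ck_on k S (\<lambda>x. sqrt (f x))" using Suc Ck_on_Suc_imp by blast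
  have D: "(sqrt has_real_derivative (inverse (sqrt (f x)) * (1/2))) (at (f x))" if "x \<in> S" for x
    using DERIV_real_sqrt[OF assms(2)[OF that]] by simp
  have "Ck_on k S (partial i (\<lambda>x. sqrt (f x)))" for i
  proof (subst Ck_on_cong[OF assms(1)])
    show "Ck_on k S (\<lambda>x. (inverse (sqrt (f x)) * (1/2)) * partial i f x)"
      using Suc.prems assms(2)
      by (intro Ck_on_mult[OF assms(1)] Ck_on_inverse[OF assms(1)] IH Ck_on_const) (auto dest: assms(2))
    fix x assume "x \<in> S"
    then show "partial i (\<lambda>x. sqrt (f x)) x = (inverse (sqrt (f x)) * (1/2)) * partial i f x"
      using Suc.prems D by (intro partial_chain1[of f x sqrt]) auto
  qed
  moreover have "(\<lambda>x. sqrt (f x)) differentiable (at x)" if "x \<in> S" for x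
  proof -
    have "f differentiable (at x)" using Suc.prems that by simp
    then show ?thesis
      using has_derivative_compose[of f _ x UNIV sqrt] D[OF that]
      unfolding differentiable_def has_field_derivative_def by blast
  qed
  ultimately show ?case by simp
qed (simp add: continuous_on_real_sqrt)

lemma Ck_on_sum:
  assumes "open S" "\<And>a. a \<in> I \<Longrightarrow> Ck_on k S (f a)"
  shows "Ck_on k S (\<lambda>x. \<Sum>a\<in>I. f a x)"
  using assms(2)
  by (induction I rule: infinite_finite_induct) (auto intro!: Ck_on_const Ck_on_add assms(1))

lemma Ck_on_prod:
  assumes "open S" "\<And>a. a \<in> I \<Longrightarrow> Ck_on k S (f a)"
  shows "Ck_on k S (\<lambda>x. \<Prod>a\<in>I. f a x)"
  using assms(2)
  by (induction I rule: infinite_finite_induct) (auto intro!: Ck_on_const Ck_on_mult assms(1))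

lemma Ck_on_component: "Ck_on k S (\<lambda>x. x $ j)"
proof (cases k)
  case (Suc k')
  have "partial i (\<lambda>x. x $ j) = (\<lambda>x. if i = j then 1 else 0)" for i
    by (rule ext) (rule partial_component)
  moreover have "(\<lambda>x::real^4. x $ j) differentiable (at x)" for x
    by (rule linear_imp_differentiable) (simp add: linear_iff)
  ultimately show ?thesis using Suc by (simp add: Ck_on_const)
qed (auto intro!: continuous_intros)

text \<open>The chain rule produces the functions \<open>partial a f\<close> composed with the same
  \<tau>, so the induction varies \<open>f\<close> and keeps \<tau> fixed.\<close>

lemma Ck_on_compose:
  assumes "open S" "open T" "\<tau> ` S \<subseteq> T"
  shows "Ck_on k T f \<Longrightarrow> (\<And>a. Ck_on k S (\<lambda>x. \<tau> x $ a)) \<Longrightarrow> Ck_on k S (\<lambda>x. f (\<tau> x))"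
proof (induction k arbitrary: f)
  case 0
  then have "continuous_on S (\<lambda>x. \<chi> a. \<tau> x $ a)" by (intro continuous_on_vec_lambda) auto
  then have "continuous_on S \<tau>" by simp
  with 0 show ?case using assms(3) continuous_on_compose2[of T f S \<tau>] by simp
next
  case (Suc k)
  have c: "(\<lambda>y. f (\<tau> y)) differentiable (at x)"
    "partial i (\<lambda>y. f (\<tau> y)) x = (\<Sum>a\<in>UNIV. partial a f (\<tau> x) * partial i (\<lambda>y. \<tau> y $ a) x)"
    if "x \<in> S" for x i
  proof -
    have "f differentiable (at (\<tau> x))" using Suc.prems(1) that assms(3) by auto
    moreover have "(\<lambda>y. \<tau> y $ a) differentiable (at x)" for a using Suc.prems(2)[of a] that by simp
    ultimately show "(\<lambda>y. f (\<tau> y)) differentiable (at x)"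
      "partial i (\<lambda>y. f (\<tau> y)) x = (\<Sum>a\<in>UNIV. partial a f (\<tau> x) * partial i (\<lambda>y. \<tau> y $ a) x)"
      using partial_compose[of \<tau> x f] by blast+
  qed
  have "Ck_on k S (partial i (\<lambda>y. f (\<tau> y)))" for i
  proof -
    have "Ck_on k S (\<lambda>x. partial a f (\<tau> x))" for a
    proof (rule Suc.IH)
      show "Ck_on k T (partial a f)" using Suc.prems(1) by simp
      show "Ck_on k S (\<lambda>x. \<tau> x $ b)" for b using Suc.prems(2) Ck_on_Suc_imp by blast
    qed
    moreover have "Ck_on k S (\<lambda>x. partial i (\<lambda>y. \<tau> y $ a) x)" for a
      using Suc.prems(2)[of a] by simp
    ultimately have "Ck_on k S (\<lambda>x. \<Sum>a\<in>UNIV. partial a f (\<tau> x) * partial i (\<lambda>y. \<tau> y $ a) x)"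
      by (intro Ck_on_sum Ck_on_mult assms(1))
    then show ?thesis
      by (subst Ck_on_cong[OF assms(1) c(2)[of _ i]]) simp_all
  qed
  with c(1) show ?case by simp
qed

lemma smooth_on_const: "smooth_on S (\<lambda>x. c)"
  and smooth_on_component: "smooth_on S (\<lambda>x. x $ j)"
  by (simp_all add: smooth_on_def Ck_on_const Ck_on_component)

lemma smooth_on_add: "open S \<Longrightarrow> smooth_on S f \<Longrightarrow> smooth_on S g \<Longrightarrow> smooth_on S (\<lambda>x. f x + g x)"
  and smooth_on_mult: "open S \<Longrightarrow> smooth_on S f \<Longrightarrow> smooth_on S g \<Longrightarrow> smooth_on S (\<lambda>x. f x * g x)"
  by (simp_all add: smooth_on_def Ck_on_add Ck_on_mult)

lemma smooth_on_minus: "open S \<Longrightarrow> smooth_on S f \<Longrightarrow> smooth_on S (\<lambda>x. - f x)"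
  using smooth_on_mult[OF _ smooth_on_const[of S "-1"], of f] by simp

lemma smooth_on_diff: "open S \<Longrightarrow> smooth_on S f \<Longrightarrow> smooth_on S g \<Longrightarrow> smooth_on S (\<lambda>x. f x - g x)"
  using smooth_on_add[OF _ _ smooth_on_minus, of S f g] by simp

lemma smooth_on_sum: "open S \<Longrightarrow> (\<And>a. a \<in> I \<Longrightarrow> smooth_on S (f a)) \<Longrightarrow> smooth_on S (\<lambda>x. \<Sum>a\<in>I. f a x)"
  and smooth_on_prod: "open S \<Longrightarrow> (\<And>a. a \<in> I \<Longrightarrow> smooth_on S (f a)) \<Longrightarrow> smooth_on S (\<lambda>x. \<Prod>a\<in>I. f a x)"
  by (simp_all add: smooth_on_def Ck_on_sum Ck_on_prod)

lemma smooth_on_inverse: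
  "open S \<Longrightarrow> (\<And>x. x \<in> S \<Longrightarrow> f x \<noteq> 0) \<Longrightarrow> smooth_on S f \<Longrightarrow> smooth_on S (\<lambda>x. inverse (f x))"
  and smooth_on_sqrt:
  "open S \<Longrightarrow> (\<And>x. x \<in> S \<Longrightarrow> f x > 0) \<Longrightarrow> smooth_on S f \<Longrightarrow> smooth_on S (\<lambda>x. sqrt (f x))"
  by (simp_all add: smooth_on_def Ck_on_inverse Ck_on_sqrt)

lemma smooth_on_compose:
  assumes "open S" "open T" "\<tau> ` S \<subseteq> T" "smooth_on T f" "\<And>a. smooth_on S (\<lambda>x. \<tau> x $ a)"
  shows "smooth_on S (\<lambda>x. f (\<tau> x))"
  using assms Ck_on_compose[of S T \<tau>] by (simp add: smooth_on_def)

lemma smooth_on_partial: "smooth_on S f \<Longrightarrow> smooth_on S (partial i f)"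
  unfolding smooth_on_def
proof
  fix k assume "\<forall>k. Ck_on k S f"
  then have "Ck_on (Suc k) S f" by blast
  then show "Ck_on k S (partial i f)" by simp
qed

lemma smooth_on_partial': "smooth_on S f \<Longrightarrow> smooth_on S (\<lambda>x. partial i f x)"
  by (rule smooth_on_partial)

lemma smooth_on_cong:
  "open S \<Longrightarrow> (\<And>y. y \<in> S \<Longrightarrow> f y = g y) \<Longrightarrow> smooth_on S f \<longleftrightarrow> smooth_on S g"
  unfolding smooth_on_def using Ck_on_cong by blast

lemma smooth_on_subset: "smooth_on S f \<Longrightarrow> T \<subseteq> S \<Longrightarrow> smooth_on T f"
  unfolding smooth_on_def using Ck_on_subset by blast

lemma smooth_on_Un: "open S \<Longrightarrow> open T \<Longrightarrow> smooth_on S f \<Longrightarrow> smooth_on T f \<Longrightarrow> smooth_on (S \<union> T) f"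
  unfolding smooth_on_def using Ck_on_Un by blast

lemma smooth_on_differentiable: "smooth_on S f \<Longrightarrow> x \<in> S \<Longrightarrow> f differentiable (at x)"
  unfolding smooth_on_def by (drule spec[of _ "Suc 0"]) simp

lemma smooth_on_continuous: "smooth_on S f \<Longrightarrow> continuous_on S f"
  unfolding smooth_on_def using Ck_on_continuous by blast

lemmas smooth_intros = smooth_on_const smooth_on_component smooth_on_add smooth_on_mult smooth_on_minus
  smooth_on_diff smooth_on_sum smooth_on_prod smooth_on_partial'

section \<open>Symmetry of mixed partial derivatives\<close>

lemma line_has_derivative:
  assumes "f differentiable (at (x + t *\<^sub>R axis i 1))"
  shows "((\<lambda>t. f (x + t *\<^sub>R axis i 1)) has_real_derivative partial i f (x + t *\<^sub>R axis i 1)) (at t)"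
proof -
  have 1: "((\<lambda>t. x + t *\<^sub>R axis i 1) has_derivative (\<lambda>t. t *\<^sub>R axis i 1)) (at t)"
    by (auto intro!: derivative_eq_intros)
  have 2: "(f has_derivative frechet_derivative f (at (x + t *\<^sub>R axis i 1))) (at (x + t *\<^sub>R axis i 1))"
    using assms frechet_derivative_works by blast
  have "((\<lambda>t. f (x + t *\<^sub>R axis i 1)) has_derivative
      (\<lambda>s. frechet_derivative f (at (x + t *\<^sub>R axis i 1)) (s *\<^sub>R axis i 1))) (at t)"
    using has_derivative_compose[OF 1 2] .
  moreover have "frechet_derivative f (at (x + t *\<^sub>R axis i 1)) (s *\<^sub>R axis i 1)
      = partial i f (x + t *\<^sub>R axis i 1) * s" for s
    using linear_scale[OF linear_frechet_derivative[OF assms]] by (simp add: partial_def)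
  ultimately show ?thesis by (simp add: has_field_derivative_def)
qed

text \<open>The second difference of \<open>f\<close> over a small square is, by two applications of the mean value
  theorem, a value of either mixed second derivative.\<close>

lemma second_difference:
  assumes sub: "\<And>s t. 0 \<le> s \<Longrightarrow> s \<le> h \<Longrightarrow> 0 \<le> t \<Longrightarrow> t \<le> h \<Longrightarrow>
      x + s *\<^sub>R axis i 1 + t *\<^sub>R axis j 1 \<in> S" and h: "h > 0"
    and f: "\<And>y. y \<in> S \<Longrightarrow> f differentiable (at y)"
    and f': "\<And>y. y \<in> S \<Longrightarrow> partial i f differentiable (at y)"
  shows "\<exists>s t. 0 \<le> s \<and> s \<le> h \<and> 0 \<le> t \<and> t \<le> h \<and>
    f (x + h *\<^sub>R axis i 1 + h *\<^sub>R axis j 1) - f (x + h *\<^sub>R axis i 1) - f (x + h *\<^sub>R axis j 1) + f x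
    = h * h * partial j (partial i f) (x + s *\<^sub>R axis i 1 + t *\<^sub>R axis j 1)"
proof -
  define u where "u s = f ((x + h *\<^sub>R axis j 1) + s *\<^sub>R axis i 1) - f (x + s *\<^sub>R axis i 1)" for s
  have u: "(u has_real_derivative
      partial i f ((x + h *\<^sub>R axis j 1) + s *\<^sub>R axis i 1) - partial i f (x + s *\<^sub>R axis i 1)) (at s)"
    if "0 \<le> s" "s \<le> h" for s
    unfolding u_def
    by (intro derivative_intros line_has_derivative f) 
      (use sub[OF that, of h] sub[OF that, of 0] h in \<open>auto simp: algebra_simps\<close>)
  obtain s where s: "0 < s" "s < h" and us: "u h - u 0 = (h - 0) *
      (partial i f ((x + h *\<^sub>R axis j 1) + s *\<^sub>R axis i 1) - partial i f (x + s *\<^sub>R axis i 1))"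
    using MVT2[OF h u] by blast
  define v where "v t = partial i f ((x + s *\<^sub>R axis i 1) + t *\<^sub>R axis j 1)" for t
  have v: "(v has_real_derivative partial j (partial i f) ((x + s *\<^sub>R axis i 1) + t *\<^sub>R axis j 1)) (at t)"
    if "0 \<le> t" "t \<le> h" for t
    unfolding v_def using s that sub by (intro line_has_derivative f') auto
  obtain t where t: "0 < t" "t < h" and vt: "v h - v 0 = (h - 0) *
      partial j (partial i f) ((x + s *\<^sub>R axis i 1) + t *\<^sub>R axis j 1)"
    using MVT2[OF h v] by blast
  have "f (x + h *\<^sub>R axis i 1 + h *\<^sub>R axis j 1) - f (x + h *\<^sub>R axis i 1) - f (x + h *\<^sub>R axis j 1) + f x = u h - u 0"
    unfolding u_def by (simp add: algebra_simps)
  also have "\<dots> = h * (v h - v 0)" unfolding us v_def by (simp add: algebra_simps)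
  finally have "f (x + h *\<^sub>R axis i 1 + h *\<^sub>R axis j 1) - f (x + h *\<^sub>R axis i 1) - f (x + h *\<^sub>R axis j 1) + f x
    = h * h * partial j (partial i f) (x + s *\<^sub>R axis i 1 + t *\<^sub>R axis j 1)"
    unfolding vt by simp
  then show ?thesis using s t by (meson less_imp_le)
qed

text \<open>If the two values differed, continuity would keep the mixed derivatives apart near
  \<open>x\<close>, whereas \<open>second_difference\<close>, applied in both orders to the same
  symmetric expression, yields nearby points at which they agree.\<close>

lemma partial_commute:
  assumes "open S" "Ck_on 2 S f" "x \<in> S"
  shows "partial i (partial j f) x = partial j (partial i f) x"
proof (rule ccontr)
  assume ne: "partial i (partial j f) x \<noteq> partial j (partial i f) x"
  \<comment> \<open>Half the gap: numbers closer than \<open>e\<close> to the respective values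
    cannot coincide.\<close>
  define e where "e = \<bar>partial i (partial j f) x - partial j (partial i f) x\<bar> / 2"
  have e: "e > 0" using ne by (simp add: e_def)
  have C: "continuous_on S (partial a (partial b f))" for a b
    using assms(2) by (simp add: numeral_2_eq_2)
  have d: "\<And>y. y \<in> S \<Longrightarrow> f differentiable (at y)" "\<And>y a. y \<in> S \<Longrightarrow> partial a f differentiable (at y)"
    using assms(2) by (simp_all add: numeral_2_eq_2)
  have lim: "\<exists>r>0. \<forall>y. dist y x < r \<longrightarrow> y \<in> S \<and> \<bar>partial a (partial b f) y - partial a (partial b f) x\<bar> < e" for a b
  proof -
    have "isCont (partial a (partial b f)) x" using C assms continuous_on_eq_continuous_at by blast
    then obtain r1 where "r1 > 0" "\<forall>y. dist y x < r1 \<longrightarrow> \<bar>partial a (partial b f) y - partial a (partial b f) x\<bar> < e"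
      using e unfolding continuous_at_eps_delta dist_real_def by blast
    moreover obtain r2 where "r2 > 0" "\<forall>y. dist y x < r2 \<longrightarrow> y \<in> S"
      using assms(1,3) open_dist by metis
    ultimately show ?thesis by (intro exI[of _ "min r1 r2"]) auto
  qed
  obtain r1 where r1: "r1 > 0" "\<And>y. dist y x < r1 \<Longrightarrow> y \<in> S \<and> \<bar>partial i (partial j f) y - partial i (partial j f) x\<bar> < e"
    using lim[of i j] by blast
  obtain r2 where r2: "r2 > 0" "\<And>y. dist y x < r2 \<Longrightarrow> y \<in> S \<and> \<bar>partial j (partial i f) y - partial j (partial i f) x\<bar> < e"
    using lim[of j i] by blast
  \<comment> \<open>Points of the square of side \<open>h\<close> lie within \<open>2 * h\<close> of
    \<open>x\<close>; a third of the smaller radius keeps them inside both balls.\<close>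
  define h where "h = min r1 r2 / 3"
  have h: "h > 0" "2 * h < r1" "2 * h < r2" using r1(1) r2(1) by (auto simp: h_def)
  have near: "dist (x + s *\<^sub>R axis a 1 + t *\<^sub>R axis b 1) x \<le> 2 * h"
    if "0 \<le> s" "s \<le> h" "0 \<le> t" "t \<le> h" for s t :: real and a b :: 4
  proof -
    have "norm (s *\<^sub>R axis a (1::real) + t *\<^sub>R axis b 1) \<le> norm (s *\<^sub>R axis a (1::real)) + norm (t *\<^sub>R axis b (1::real))"
      by (rule norm_triangle_ineq)
    also have "\<dots> \<le> 2 * h" using that by (simp add: norm_axis_1)
    finally show ?thesis by (simp add: dist_norm add.assoc)
  qed
  have inS: "x + s *\<^sub>R axis a 1 + t *\<^sub>R axis b 1 \<in> S"
    if "0 \<le> s" "s \<le> h" "0 \<le> t" "t \<le> h" for s t a b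
    using near[OF that, of a b] r1(2)[of "x + s *\<^sub>R axis a 1 + t *\<^sub>R axis b 1"] h(2) by linarith
  obtain s t where st: "0 \<le> s" "s \<le> h" "0 \<le> t" "t \<le> h" and q1: "f (x + h *\<^sub>R axis i 1 + h *\<^sub>R axis j 1) - f (x + h *\<^sub>R axis i 1) - f (x + h *\<^sub>R axis j 1) + f x
    = h * h * partial j (partial i f) (x + s *\<^sub>R axis i 1 + t *\<^sub>R axis j 1)"
    using second_difference[of h x i j S f] inS h d by blast
  obtain s' t' where st': "0 \<le> s'" "s' \<le> h" "0 \<le> t'" "t' \<le> h" and q2: "f (x + h *\<^sub>R axis j 1 + h *\<^sub>R axis i 1) - f (x + h *\<^sub>R axis j 1) - f (x + h *\<^sub>R axis i 1) + f x
    = h * h * partial i (partial j f) (x + s' *\<^sub>R axis j 1 + t' *\<^sub>R axis i 1)"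
    using second_difference[of h x j i S f] inS h d by blast
  have "h * h * partial j (partial i f) (x + s *\<^sub>R axis i 1 + t *\<^sub>R axis j 1)
      = h * h * partial i (partial j f) (x + s' *\<^sub>R axis j 1 + t' *\<^sub>R axis i 1)"
    using q1 q2 by (simp add: algebra_simps)
  then have eq: "partial j (partial i f) (x + s *\<^sub>R axis i 1 + t *\<^sub>R axis j 1)
      = partial i (partial j f) (x + s' *\<^sub>R axis j 1 + t' *\<^sub>R axis i 1)"
    using h by simp
  have "\<bar>partial i (partial j f) (x + s' *\<^sub>R axis j 1 + t' *\<^sub>R axis i 1) - partial i (partial j f) x\<bar> < e"
    using r1(2)[of "x + s' *\<^sub>R axis j 1 + t' *\<^sub>R axis i 1"] near[OF st', of j i] h by linarith
  moreover have "\<bar>partial j (partial i f) (x + s *\<^sub>R axis i 1 + t *\<^sub>R axis j 1) - partial j (partial i f) x\<bar> < e"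
    using r2(2)[of "x + s *\<^sub>R axis i 1 + t *\<^sub>R axis j 1"] near[OF st, of i j] h by linarith
  ultimately have "\<bar>partial i (partial j f) x - partial j (partial i f) x\<bar> < e + e"
    unfolding eq by linarith
  then show False by (simp add: e_def)
qed

lemma smooth_partial_commute:
  "open S \<Longrightarrow> smooth_on S f \<Longrightarrow> x \<in> S \<Longrightarrow> partial i (partial j f) x = partial j (partial i f) x"
  unfolding smooth_on_def using partial_commute by blast

section \<open>Linear algebra of 2-forms\<close>

definition det_of_rows :: "real^4 \<Rightarrow> real^4 \<Rightarrow> real^4 \<Rightarrow> real^4 \<Rightarrow> real" where
  "det_of_rows u v w z =
     det (\<chi> r. if r = 1 then u else if r = 2 then v else if r = 3 then w else z :: real^4^4)"

lemma sum_axis: "(\<Sum>k\<in>UNIV. c $ k *s axis k 1) = (c :: real^4)"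
  using basis_expansion[of c] by simp

lemma det_of_rows_sum1: "det_of_rows u v w z = (\<Sum>k\<in>UNIV. u $ k * det_of_rows (axis k 1) v w z)"
proof -
  have "det_of_rows u v w z = det_of_rows (\<Sum>k\<in>UNIV. u $ k *s axis k 1) v w z" by (simp only: sum_axis)
  also have "\<dots> = (\<Sum>k\<in>UNIV. u $ k * det_of_rows (axis k 1) v w z)"
    unfolding det_of_rows_def det_linear_row_sum[OF finite_class.finite_UNIV, of "1::4" "\<lambda>r k. u $ k *s axis k 1"] det_row_mul ..
  finally show ?thesis .
qed

lemma det_of_rows_sum2: "det_of_rows u v w z = (\<Sum>k\<in>UNIV. v $ k * det_of_rows u (axis k 1) w z)"
proof -
  \<comment> \<open>With the second row tested first, the matrix has the shape to which linearity of
    the determinant in that row applies.\<close>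
  have *: "det_of_rows u v w z =
      det (\<chi> r. if r = 2 then v else if r = 1 then u else if r = 3 then w else z)" for v
    unfolding det_of_rows_def by (intro arg_cong[where f = det]) (auto simp: vec_eq_iff forall_4)
  have "det_of_rows u v w z = det_of_rows u (\<Sum>k\<in>UNIV. v $ k *s axis k 1) w z" by (simp only: sum_axis)
  also have "\<dots> = (\<Sum>k\<in>UNIV. v $ k * det_of_rows u (axis k 1) w z)"
    unfolding * det_linear_row_sum[OF finite_class.finite_UNIV, of "2::4" "\<lambda>r k. v $ k *s axis k 1"] det_row_mul ..
  finally show ?thesis .
qed

lemma det_of_rows_sum3: "det_of_rows u v w z = (\<Sum>k\<in>UNIV. w $ k * det_of_rows u v (axis k 1) z)"
proof -
  have *: "det_of_rows u v w z =
      det (\<chi> r. if r = 3 then w else if r = 1 then u else if r = 2 then v else z)" for w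
    unfolding det_of_rows_def by (intro arg_cong[where f = det]) (auto simp: vec_eq_iff forall_4)
  have "det_of_rows u v w z = det_of_rows u v (\<Sum>k\<in>UNIV. w $ k *s axis k 1) z" by (simp only: sum_axis)
  also have "\<dots> = (\<Sum>k\<in>UNIV. w $ k * det_of_rows u v (axis k 1) z)"
    unfolding * det_linear_row_sum[OF finite_class.finite_UNIV, of "3::4" "\<lambda>r k. w $ k *s axis k 1"] det_row_mul ..
  finally show ?thesis .
qed

lemma det_of_rows_sum4: "det_of_rows u v w z = (\<Sum>k\<in>UNIV. z $ k * det_of_rows u v w (axis k 1))"
proof -
  have *: "det_of_rows u v w z =
      det (\<chi> r. if r = 4 then z else if r = 1 then u else if r = 2 then v else w)" for z
    unfolding det_of_rows_def by (intro arg_cong[where f = det]) (auto simp: vec_eq_iff forall_4)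
  have "det_of_rows u v w z = det_of_rows u v w (\<Sum>k\<in>UNIV. z $ k *s axis k 1)" by (simp only: sum_axis)
  also have "\<dots> = (\<Sum>k\<in>UNIV. z $ k * det_of_rows u v w (axis k 1))"
    unfolding * det_linear_row_sum[OF finite_class.finite_UNIV, of "4::4" "\<lambda>r k. z $ k *s axis k 1"] det_row_mul ..
  finally show ?thesis .
qed

lemma levi_civita_symbol_rows:
  "levi_civita_symbol i j k l = det_of_rows (axis i 1) (axis j 1) (axis k 1) (axis l 1)"
  unfolding levi_civita_symbol_def det_of_rows_def
  by (intro arg_cong[where f = det]) (simp add: vec_eq_iff forall_4)

text \<open>Both sides are the determinant whose rows are the columns a, b, c, d of
  \<open>M\<close>. Multilinearity expands it into the sum; factoring the matrix of these rows as a
  selection matrix times \<open>transpose M\<close> gives the right-hand side.\<close>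

lemma levi_civita_transform:
  "(\<Sum>k\<in>UNIV. \<Sum>l\<in>UNIV. \<Sum>m\<in>UNIV. \<Sum>n\<in>UNIV. M $ k $ a * M $ l $ b * M $ m $ c * M $ n $ d * levi_civita_symbol k l m n)
   = det M * levi_civita_symbol a b c d"
proof -
  define S :: "real^4^4" where
    "S = (\<chi> r. axis (if r = 1 then a else if r = 2 then b else if r = 3 then c else d) 1)"
  have "(\<chi> r. if r = 1 then column a M else if r = 2 then column b M else if r = 3 then column c M
      else column d M) = S ** transpose M"
    by (simp add: S_def vec_eq_iff matrix_matrix_mult_def column_def transpose_def axis_def
        if_distrib[of "\<lambda>t. t * _"] cong: if_cong)
  then have "det_of_rows (column a M) (column b M) (column c M) (column d M) = det S * det M"
    unfolding det_of_rows_def by (simp add: det_mul)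
  moreover have "det S = levi_civita_symbol a b c d" by (simp add: S_def levi_civita_symbol_def)
  moreover have "det_of_rows (column a M) (column b M) (column c M) (column d M) =
    (\<Sum>k\<in>UNIV. \<Sum>l\<in>UNIV. \<Sum>m\<in>UNIV. \<Sum>n\<in>UNIV. M $ k $ a * M $ l $ b * M $ m $ c * M $ n $ d * levi_civita_symbol k l m n)"
    by (subst det_of_rows_sum1, subst det_of_rows_sum2, subst det_of_rows_sum3, subst det_of_rows_sum4)
      (simp add: column_def levi_civita_symbol_rows sum_distrib_left mult_ac)
  ultimately show ?thesis by simp
qed

lemma det_of_rows_perm:
  "det_of_rows v u w z = - det_of_rows u v w z"
  "det_of_rows u w v z = - det_of_rows u v w z"
  "det_of_rows u v z w = - det_of_rows u v w z"
proof -
  have sw: "det (\<chi> i. A $ Transposition.transpose p q i) = - det A" if "p \<noteq> q" for A :: "real^4^4" and p q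
    using det_permute_rows[OF permutes_swap_id[of p UNIV q], of A] that by (simp add: sign_swap_id)
  show "det_of_rows v u w z = - det_of_rows u v w z"
    unfolding det_of_rows_def sw[of 1 2, symmetric, simplified]
    by (intro arg_cong[where f = det]) (simp add: vec_eq_iff forall_4 Transposition.transpose_def)
  show "det_of_rows u w v z = - det_of_rows u v w z"
    unfolding det_of_rows_def sw[of 2 3, symmetric, simplified]
    by (intro arg_cong[where f = det]) (simp add: vec_eq_iff forall_4 Transposition.transpose_def)
  show "det_of_rows u v z w = - det_of_rows u v w z"
    unfolding det_of_rows_def sw[of 3 4, symmetric, simplified]
    by (intro arg_cong[where f = det]) (simp add: vec_eq_iff forall_4 Transposition.transpose_def)
qed

lemma levi_civita_swap:
  "levi_civita_symbol j i k l = - levi_civita_symbol i j k l"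
  "levi_civita_symbol i k j l = - levi_civita_symbol i j k l"
  "levi_civita_symbol i j l k = - levi_civita_symbol i j k l"
  unfolding levi_civita_symbol_rows by (rule det_of_rows_perm)+

lemma levi_civita_eq0:
  "levi_civita_symbol i i k l = 0" "levi_civita_symbol i j i l = 0" "levi_civita_symbol i j k i = 0"
  "levi_civita_symbol i j j l = 0" "levi_civita_symbol i j k j = 0" "levi_civita_symbol i j k k = 0"
proof -
  show 1: "levi_civita_symbol i i k l = 0" for i k l using levi_civita_swap(1)[of i i k l] by simp
  show 2: "levi_civita_symbol i j i l = 0" for i j l using levi_civita_swap(2)[of i i j l] 1 by simp
  show "levi_civita_symbol i j k i = 0" using levi_civita_swap(3)[of i j i k] 2 by simp
  show 3: "levi_civita_symbol i j j l = 0" for i j l using levi_civita_swap(2)[of i j j l] by simp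
  show "levi_civita_symbol i j k j = 0" using levi_civita_swap(3)[of i j j k] 3 by simp
  show "levi_civita_symbol i j k k = 0" using levi_civita_swap(3)[of i j k k] by simp
qed

lemma levi_civita_values:
  "levi_civita_symbol 1 2 3 4 = 1" "levi_civita_symbol 1 2 4 3 = -1"
  "levi_civita_symbol 1 3 2 4 = -1" "levi_civita_symbol 1 3 4 2 = 1"
  "levi_civita_symbol 1 4 2 3 = 1" "levi_civita_symbol 1 4 3 2 = -1"
  "levi_civita_symbol 2 1 3 4 = -1" "levi_civita_symbol 2 1 4 3 = 1"
  "levi_civita_symbol 2 3 1 4 = 1" "levi_civita_symbol 2 3 4 1 = -1"
  "levi_civita_symbol 2 4 1 3 = -1" "levi_civita_symbol 2 4 3 1 = 1"
  "levi_civita_symbol 3 1 2 4 = 1" "levi_civita_symbol 3 1 4 2 = -1"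
  "levi_civita_symbol 3 2 1 4 = -1" "levi_civita_symbol 3 2 4 1 = 1"
  "levi_civita_symbol 3 4 1 2 = 1" "levi_civita_symbol 3 4 2 1 = -1"
  "levi_civita_symbol 4 1 2 3 = -1" "levi_civita_symbol 4 1 3 2 = 1"
  "levi_civita_symbol 4 2 1 3 = 1" "levi_civita_symbol 4 2 3 1 = -1"
  "levi_civita_symbol 4 3 1 2 = -1" "levi_civita_symbol 4 3 2 1 = 1"
proof -
  note s = levi_civita_swap levi_civita_symbol_1234
  show "levi_civita_symbol 1 2 3 4 = 1" by (rule s)
  show a: "levi_civita_symbol 1 2 4 3 = -1" using s(3)[of 1 2 3 4] s(4) by simp
  show b: "levi_civita_symbol 1 3 2 4 = -1" using s(2)[of 1 2 3 4] s(4) by simp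
  show c: "levi_civita_symbol 1 3 4 2 = 1" using s(3)[of 1 3 2 4] b by simp
  show d: "levi_civita_symbol 1 4 2 3 = 1" using s(2)[of 1 2 4 3] a by simp
  show e: "levi_civita_symbol 1 4 3 2 = -1" using s(3)[of 1 4 2 3] d by simp
  show a2: "levi_civita_symbol 2 1 3 4 = -1" using s(1)[of 1 2 3 4] s(4) by simp
  show b2: "levi_civita_symbol 2 1 4 3 = 1" using s(1)[of 1 2 4 3] a by simp
  show a3: "levi_civita_symbol 3 1 2 4 = 1" using s(1)[of 1 3 2 4] b by simp
  show b3: "levi_civita_symbol 3 1 4 2 = -1" using s(1)[of 1 3 4 2] c by simp
  show a4: "levi_civita_symbol 4 1 2 3 = -1" using s(1)[of 1 4 2 3] d by simp
  show b4: "levi_civita_symbol 4 1 3 2 = 1" using s(1)[of 1 4 3 2] e by simp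
  show c2: "levi_civita_symbol 2 3 1 4 = 1" using s(2)[of 2 1 3 4] a2 by simp
  show d2: "levi_civita_symbol 2 4 1 3 = -1" using s(2)[of 2 1 4 3] b2 by simp
  show c3: "levi_civita_symbol 3 2 1 4 = -1" using s(2)[of 3 1 2 4] a3 by simp
  show d3: "levi_civita_symbol 3 4 1 2 = 1" using s(2)[of 3 1 4 2] b3 by simp
  show c4: "levi_civita_symbol 4 2 1 3 = 1" using s(2)[of 4 1 2 3] a4 by simp
  show d4: "levi_civita_symbol 4 3 1 2 = -1" using s(2)[of 4 1 3 2] b4 by simp
  show "levi_civita_symbol 2 3 4 1 = -1" using s(3)[of 2 3 1 4] c2 by simp
  show "levi_civita_symbol 2 4 3 1 = 1" using s(3)[of 2 4 1 3] d2 by simp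
  show "levi_civita_symbol 3 2 4 1 = 1" using s(3)[of 3 2 1 4] c3 by simp
  show "levi_civita_symbol 3 4 2 1 = -1" using s(3)[of 3 4 1 2] d3 by simp
  show "levi_civita_symbol 4 2 3 1 = -1" using s(3)[of 4 2 1 3] c4 by simp
  show "levi_civita_symbol 4 3 2 1 = 1" using s(3)[of 4 3 1 2] d4 by simp
qed

section \<open>Positive definite Gram matrices and orthonormal bases\<close>

definition posdef :: "real^4^4 \<Rightarrow> bool" where
  "posdef G \<longleftrightarrow> transpose G = G \<and> (\<forall>v. v \<noteq> 0 \<longrightarrow> v \<bullet> (G *v v) > 0)"

lemma posdef_mat1: "posdef (mat 1)"
  by (simp add: posdef_def transpose_mat)

lemma posdef_commute: "posdef G \<Longrightarrow> u \<bullet> (G *v v) = v \<bullet> (G *v u)"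
  unfolding posdef_def by (metis dot_lmul_matrix inner_commute vector_transpose_matrix)

text \<open>Orthogonality to \<open>S\<close> with respect to \<open>G\<close> is Euclidean
  orthogonality to the image of \<open>S\<close> under \<open>G\<close>, which spans a proper
  subspace. A nonzero vector orthogonal to that subspace is then rescaled.\<close>

lemma exists_unit_orthogonal:
  assumes "posdef G" "finite S" "card S < 4"
  shows "\<exists>w. w \<bullet> (G *v w) = 1 \<and> (\<forall>v\<in>S. v \<bullet> (G *v w) = 0 \<and> w \<bullet> (G *v v) = 0)"
proof -
  have "dim ((*v) G ` S) < DIM(real^4)"
    using dim_le_card'[of "(*v) G ` S"] assms card_image_le[of S "(*v) G"] by (simp add: le_less_trans)
  then obtain w where w: "w \<noteq> 0" "\<And>y. y \<in> span ((*v) G ` S) \<Longrightarrow> orthogonal w y"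
    using orthogonal_to_subspace_exists by blast
  then have o: "w \<bullet> (G *v v) = 0" if "v \<in> S" for v
    using that by (simp add: span_base orthogonal_def)
  define q where "q = sqrt (w \<bullet> (G *v w))"
  have q: "q > 0" "q * q = w \<bullet> (G *v w)"
    using assms(1) w(1) unfolding q_def posdef_def by (auto simp: less_imp_le)
  define w' where "w' = (1 / q) *\<^sub>R w"
  have "w' \<bullet> (G *v w') = 1"
    unfolding w'_def using q by (simp add: matrix_vector_mult_scaleR field_simps flip: q(2))
  moreover have "w' \<bullet> (G *v v) = 0" if "v \<in> S" for v using o[OF that] by (simp add: w'_def)
  ultimately show ?thesis using posdef_commute[OF assms(1)] by metis
qed

lemma exists_4:
  fixes a b c d :: 'b
  shows "\<exists>e. e (1::4) = a \<and> e 2 = b \<and> e 3 = c \<and> e 4 = d"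
  by (rule exI[of _ "\<lambda>i. if i = 1 then a else if i = 2 then b else if i = 3 then c else d"]) simp

lemma complete_orthonormal_pair:
  assumes G: "posdef G" and u: "u \<bullet> (G *v u) = 1" "v \<bullet> (G *v v) = 1" "u \<bullet> (G *v v) = 0"
  shows "\<exists>e. orthonormal_basis G e \<and> e 1 = u \<and> e 2 = v"
proof -
  note c = posdef_commute[OF G]
  obtain w where w: "w \<bullet> (G *v w) = 1" "u \<bullet> (G *v w) = 0" "v \<bullet> (G *v w) = 0"
  proof -
    have "card {u, v} < 4" using card_length[of "[u, v]"] by simp
    from exists_unit_orthogonal[OF G _ this] show ?thesis using that by blast
  qed
  have "card {u, v, w} < 4" using card_length[of "[u, v, w]"] by simp
  then obtain z where z: "z \<bullet> (G *v z) = 1" "u \<bullet> (G *v z) = 0" "v \<bullet> (G *v z) = 0" "w \<bullet> (G *v z) = 0"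
  proof -
    from exists_unit_orthogonal[OF G _ \<open>card {u, v, w} < 4\<close>] show ?thesis using that by blast
  qed
  obtain e where e: "e (1::4) = u" "e 2 = v" "e 3 = w" "e 4 = z" using exists_4[of u v w z] by auto
  have "orthonormal_basis G e"
    unfolding orthonormal_basis_def forall_4 e using u w z
    by (simp add: c[of v u] c[of w u] c[of w v] c[of z u] c[of z v] c[of z w])
  with e show ?thesis by blast
qed

lemma exists_orthonormal_basis:
  assumes "posdef G"
  shows "\<exists>e. orthonormal_basis G e"
proof -
  obtain u where u: "u \<bullet> (G *v u) = 1" using exists_unit_orthogonal[OF assms, of "{}"] by auto
  obtain v where "v \<bullet> (G *v v) = 1" "u \<bullet> (G *v v) = 0"
    using exists_unit_orthogonal[OF assms, of "{u}"] by auto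
  with u show ?thesis using complete_orthonormal_pair[OF assms] by blast
qed

definition frame_matrix :: "(4 \<Rightarrow> real^4) \<Rightarrow> real^4^4" where
  "frame_matrix e = (\<chi> i p. e p $ i)"

lemma inner_matrix_sum: "u \<bullet> (a *v v) = (\<Sum>i\<in>UNIV. \<Sum>j\<in>UNIV. u $ i * v $ j * a $ i $ j)"
  for a :: "real^4^4"
  by (simp add: inner_vec_def matrix_vector_mult_def sum_distrib_left mult_ac)

lemma frame_matrix_congruence:
  "(transpose (frame_matrix e) ** a ** frame_matrix e) $ p $ q = e p \<bullet> (a *v e q)"
  by (subst matrix_mul_assoc[symmetric])
    (simp add: frame_matrix_def matrix_matrix_mult_def transpose_def inner_vec_def matrix_vector_mult_def)

lemma frame_matrix_orthonormal:
  assumes "orthonormal_basis G e"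
  shows "transpose (frame_matrix e) ** G ** frame_matrix e = mat 1"
    and "matrix_inv G = frame_matrix e ** transpose (frame_matrix e)"
    and "matrix_inv G ** G = mat 1" "G ** matrix_inv G = mat 1"
proof -
  show 1: "transpose (frame_matrix e) ** G ** frame_matrix e = mat 1"
    unfolding vec_eq_iff frame_matrix_congruence using assms by (simp add: orthonormal_basis_def mat_def)
  show 2: "matrix_inv G = frame_matrix e ** transpose (frame_matrix e)"
    using matrix_inv_orthonormal[OF assms]
    by (simp add: vec_eq_iff frame_matrix_def matrix_matrix_mult_def transpose_def)
  show 3: "matrix_inv G ** G = mat 1"
    using 1 unfolding 2 by (metis matrix_left_right_inverse matrix_mul_assoc)
  show "G ** matrix_inv G = mat 1" using 3 matrix_left_right_inverse by blast
qed

lemma posdef_inv: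
  assumes "posdef G"
  shows "invertible G" "matrix_inv G ** G = mat 1" "G ** matrix_inv G = mat 1"
    "transpose (matrix_inv G) = matrix_inv G" "det G > 0" "det (matrix_inv G) = inverse (det G)"
proof -
  obtain e where e: "orthonormal_basis G e" using exists_orthonormal_basis[OF assms] by blast
  note f = frame_matrix_orthonormal[OF e]
  show "matrix_inv G ** G = mat 1" "G ** matrix_inv G = mat 1" by (rule f)+
  then show "invertible G" unfolding invertible_def by blast
  show "transpose (matrix_inv G) = matrix_inv G"
    unfolding f(2) by (simp add: matrix_transpose_mul)
  have "det (frame_matrix e) * det G * det (frame_matrix e) = 1"
    using arg_cong[OF f(1), of det] by (simp add: det_mul)
  then have "(det (frame_matrix e))\<^sup>2 * det G > 0" by (simp add: power2_eq_square mult_ac)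
  then show "det G > 0" by (simp add: zero_less_mult_iff)
  show "det (matrix_inv G) = inverse (det G)"
    using arg_cong[OF f(3), of det] by (simp add: det_mul inverse_eq_divide eq_divide_eq \<open>det G > 0\<close>[THEN less_imp_neq, symmetric])
qed

text \<open>The frame matrix E has inverse \<open>transpose E ** G\<close>, so the congruence by E
  that produces the values on basis pairs can be undone.\<close>

lemma orthonormal_basis_ext:
  assumes "orthonormal_basis G e" "\<And>p q. e p \<bullet> (a *v e q) = e p \<bullet> (b *v e q)"
  shows "a = b"
proof -
  let ?E = "frame_matrix e"
  have EL: "?E ** (transpose ?E ** G) = mat 1"
    using frame_matrix_orthonormal(2,3)[OF assms(1)] by (simp add: matrix_mul_assoc)
  have LE: "(G ** ?E) ** transpose ?E = mat 1"
    using frame_matrix_orthonormal(2,4)[OF assms(1)] by (simp add: matrix_mul_assoc)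
  have "transpose ?E ** a ** ?E = transpose ?E ** b ** ?E"
    unfolding vec_eq_iff frame_matrix_congruence using assms(2) by simp
  then have "(G ** ?E) ** (transpose ?E ** a ** ?E) ** (transpose ?E ** G) =
      (G ** ?E) ** (transpose ?E ** b ** ?E) ** (transpose ?E ** G)" by simp
  moreover have "(G ** ?E) ** (transpose ?E ** c ** ?E) ** (transpose ?E ** G) = c" for c :: "real^4^4"
  proof -
    have "(G ** ?E) ** (transpose ?E ** c ** ?E) ** (transpose ?E ** G) =
      ((G ** ?E) ** transpose ?E) ** c ** (?E ** (transpose ?E ** G))" by (simp only: matrix_mul_assoc)
    then show ?thesis unfolding EL LE by simp
  qed
  ultimately show ?thesis by simp
qed


section \<open>The Hodge star in coordinates and in orthonormal frames\<close>

lemma sum_pull2: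
  "(\<Sum>i\<in>I. \<Sum>j\<in>J. \<Sum>q\<in>Q. f i j q) = (\<Sum>q\<in>Q. \<Sum>i\<in>I. \<Sum>j\<in>J. f i j q)"
  for f :: "'a \<Rightarrow> 'b \<Rightarrow> 'e \<Rightarrow> 'x::comm_monoid_add"
  by (rule trans[OF sum.cong[OF refl sum.swap] sum.swap])

lemma sum_pull3:
  "(\<Sum>i\<in>I. \<Sum>j\<in>J. \<Sum>k\<in>K. \<Sum>q\<in>Q. f i j k q) = (\<Sum>q\<in>Q. \<Sum>i\<in>I. \<Sum>j\<in>J. \<Sum>k\<in>K. f i j k q)"
  for f :: "'a \<Rightarrow> 'b \<Rightarrow> 'c \<Rightarrow> 'e \<Rightarrow> 'x::comm_monoid_add"
  by (rule trans[OF sum.cong[OF refl sum_pull2] sum.swap])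

lemma sum_pull4:
  "(\<Sum>i\<in>I. \<Sum>j\<in>J. \<Sum>k\<in>K. \<Sum>l\<in>L. \<Sum>q\<in>Q. f i j k l q) =
   (\<Sum>q\<in>Q. \<Sum>i\<in>I. \<Sum>j\<in>J. \<Sum>k\<in>K. \<Sum>l\<in>L. f i j k l q)"
  for f :: "'a \<Rightarrow> 'b \<Rightarrow> 'c \<Rightarrow> 'd \<Rightarrow> 'e \<Rightarrow> 'x::comm_monoid_add"
  by (rule trans[OF sum.cong[OF refl sum_pull3] sum.swap])

lemma sum_swap22:
  "(\<Sum>i\<in>I. \<Sum>j\<in>J. \<Sum>k\<in>K. \<Sum>l\<in>L. f i j k l) = (\<Sum>k\<in>K. \<Sum>l\<in>L. \<Sum>i\<in>I. \<Sum>j\<in>J. f i j k l)"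
  for f :: "'a \<Rightarrow> 'b \<Rightarrow> 'c \<Rightarrow> 'd \<Rightarrow> 'x::comm_monoid_add"
  by (rule trans[OF sum_pull3 trans[OF sum.cong[OF refl sum_pull2] sum.swap]])

text \<open>Twice the Euclidean Hodge star; it relates \<open>\<star>a\<close> to the density \<open>\<surd>det G \<cdot> a\<^sup>i\<^sup>j\<close> and vice versa.\<close>

definition dual2 :: "real^4^4 \<Rightarrow> real^4^4" where
  "dual2 c = (\<chi> i j. \<Sum>k\<in>UNIV. \<Sum>l\<in>UNIV. levi_civita_symbol k l i j * c $ k $ l)"

lemma matrix_mult3: "(a ** b ** c) $ i $ j = (\<Sum>k\<in>UNIV. \<Sum>l\<in>UNIV. a $ i $ k * b $ k $ l * c $ l $ j)"
  for a b c :: "real^4^4"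
  unfolding matrix_matrix_mult_def by (simp add: sum_distrib_right) (rule sum.swap)

text \<open>Each of the four indices of the Levi-Civita symbol is contracted with one factor
  \<open>M\<close>: two factors come from the argument of \<open>dual2\<close>, two from outside.
  \<open>levi_civita_transform\<close> then collects them into the determinant.\<close>

lemma dual2_transform:
  "transpose M ** dual2 (M ** c ** transpose M) ** M = det M *\<^sub>R dual2 c"
proof -
  have "(transpose M ** dual2 (M ** c ** transpose M) ** M) $ p $ q = det M * dual2 c $ p $ q" for p q
  proof -
    have "(transpose M ** dual2 (M ** c ** transpose M) ** M) $ p $ q =
      (\<Sum>i\<in>UNIV. \<Sum>j\<in>UNIV. \<Sum>k\<in>UNIV. \<Sum>l\<in>UNIV. \<Sum>r\<in>UNIV. \<Sum>t\<in>UNIV.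
        c $ r $ t * (M $ k $ r * M $ l $ t * M $ i $ p * M $ j $ q * levi_civita_symbol k l i j))"
      unfolding matrix_mult3 dual2_def
      by (simp add: transpose_def sum_distrib_left sum_distrib_right mult_ac)
    also have "\<dots> = (\<Sum>r\<in>UNIV. \<Sum>t\<in>UNIV. \<Sum>i\<in>UNIV. \<Sum>j\<in>UNIV. \<Sum>k\<in>UNIV. \<Sum>l\<in>UNIV.
        c $ r $ t * (M $ k $ r * M $ l $ t * M $ i $ p * M $ j $ q * levi_civita_symbol k l i j))"
      by (rule trans[OF sum_pull4 sum.cong[OF refl sum_pull4]])
    also have "\<dots> = (\<Sum>r\<in>UNIV. \<Sum>t\<in>UNIV. \<Sum>k\<in>UNIV. \<Sum>l\<in>UNIV. \<Sum>i\<in>UNIV. \<Sum>j\<in>UNIV.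
        c $ r $ t * (M $ k $ r * M $ l $ t * M $ i $ p * M $ j $ q * levi_civita_symbol k l i j))"
      by (rule sum.cong[OF refl], rule sum.cong[OF refl], rule sum_swap22)
    also have "\<dots> = (\<Sum>r\<in>UNIV. \<Sum>t\<in>UNIV. c $ r $ t * (det M * levi_civita_symbol r t p q))"
      by (simp only: sum_distrib_left[symmetric] levi_civita_transform)
    also have "\<dots> = det M * dual2 c $ p $ q" by (simp add: dual2_def sum_distrib_left mult_ac)
    finally show ?thesis .
  qed
  then show ?thesis by (simp add: vec_eq_iff)
qed

lemma hodge_dual2:
  "hodge G a = (sqrt (det G) / 2) *\<^sub>R dual2 (matrix_inv G ** a ** transpose (matrix_inv G))"
proof -
  have "hodge G a $ i $ j = sqrt (det G) / 2 * dual2 (matrix_inv G ** a ** transpose (matrix_inv G)) $ i $ j" for i j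
    unfolding hodge_def dual2_def matrix_mult3
    by (simp add: transpose_def sum_distrib_left sum_distrib_right mult_ac)
  then show ?thesis by (simp add: vec_eq_iff)
qed

lemma scaleR_matrix_mult: "(r *\<^sub>R a) ** b = r *\<^sub>R (a ** b)" "a ** (r *\<^sub>R b) = r *\<^sub>R (a ** b)"
  for a b :: "real^4^4"
  by (simp_all add: vec_eq_iff matrix_matrix_mult_def sum_distrib_left mult_ac)

text \<open>By \<open>dual2_transform\<close> with the inverse of \<open>G\<close>, raising the
  indices of the star contributes 1 / det G, which absorbs the two factors
  \<open>sqrt (det G)\<close>. The density of the dual form is thus a constant-coefficient
  expression in \<open>a\<close>, so its divergence involves only the exterior derivative of
  \<open>a\<close>.\<close>

lemma hodge_raised:
  assumes "posdef G"
  shows "sqrt (det G) *\<^sub>R (matrix_inv G ** hodge G a ** matrix_inv G) = (1/2) *\<^sub>R dual2 a"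
proof -
  note p = posdef_inv[OF assms]
  have "matrix_inv G ** hodge G a ** matrix_inv G = (sqrt (det G) / 2) *\<^sub>R (det (matrix_inv G) *\<^sub>R dual2 a)"
    unfolding hodge_dual2 scaleR_matrix_mult
    using dual2_transform[of "matrix_inv G" a] by (simp add: p(4))
  then show ?thesis using p(5,6) by (simp add: field_simps)
qed

text \<open>The value of the volume form on the basis, hence 1 or -1 for an orthonormal basis. An
  adapted basis may have either orientation, so the sign is carried through the computation.\<close>

definition orientation :: "real^4^4 \<Rightarrow> (4 \<Rightarrow> real^4) \<Rightarrow> real" where
  "orientation G e = sqrt (det G) * det (frame_matrix e)"

lemma orientation_square:
  assumes "orthonormal_basis G e" "det G > 0"
  shows "orientation G e * orientation G e = 1"
proof -
  have "det (frame_matrix e) * det G * det (frame_matrix e) = 1"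
    using arg_cong[OF frame_matrix_orthonormal(1)[OF assms(1)], of det] by (simp add: det_mul)
  then have "(sqrt (det G) * sqrt (det G)) * (det (frame_matrix e) * det (frame_matrix e)) = 1"
    using assms(2) by (simp add: mult_ac)
  then show ?thesis unfolding orientation_def by (simp only: mult_ac)
qed

text \<open>The inverse of \<open>G\<close> is \<open>E ** transpose E\<close> for the frame matrix
  E, so \<open>dual2_transform\<close> with this matrix removes the metric and leaves the Euclidean
  star up to the orientation sign.\<close>

lemma hodge_frame:
  assumes "orthonormal_basis G e"
  shows "e p \<bullet> (hodge G a *v e q) = orientation G e / 2 *
    dual2 (transpose (frame_matrix e) ** a ** frame_matrix e) $ p $ q"
proof -
  let ?E = "frame_matrix e"
  have "matrix_inv G ** a ** transpose (matrix_inv G) = ?E ** (transpose ?E ** a ** ?E) ** transpose ?E"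
    unfolding frame_matrix_orthonormal(2)[OF assms] matrix_transpose_mul transpose_transpose
    by (simp only: matrix_mul_assoc)
  then have "transpose ?E ** hodge G a ** ?E =
      (sqrt (det G) / 2) *\<^sub>R (det ?E *\<^sub>R dual2 (transpose ?E ** a ** ?E))"
    unfolding hodge_dual2 scaleR_matrix_mult by (simp add: dual2_transform)
  from arg_cong[OF this, of "\<lambda>m. m $ p $ q"] show ?thesis
    unfolding frame_matrix_congruence by (simp add: orientation_def)
qed

section \<open>Normal form of a 2-form at a point\<close>

lemma dual_basis_orthonormal:
  assumes "orthonormal_basis G e" "posdef G"
  shows "dual_basis e (\<lambda>p. G *v e p)"
  using assms posdef_commute[OF assms(2)]
  unfolding dual_basis_def orthonormal_basis_def by (simp add: inner_commute)

lemma wedge_eval: "u \<bullet> (wedge a b *v v) = (a \<bullet> u) * (b \<bullet> v) - (a \<bullet> v) * (b \<bullet> u)"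
proof -
  have "u \<bullet> (wedge a b *v v) = (\<Sum>i\<in>UNIV. \<Sum>j\<in>UNIV. (a $ i * u $ i) * (b $ j * v $ j) - (a $ j * v $ j) * (b $ i * u $ i))"
    unfolding inner_matrix_sum wedge_def by (simp add: algebra_simps)
  also have "\<dots> = (a \<bullet> u) * (b \<bullet> v) - (\<Sum>i\<in>UNIV. \<Sum>j\<in>UNIV. (a $ j * v $ j) * (b $ i * u $ i))"
    unfolding inner_vec_def inner_real_def sum_product sum_subtractf ..
  also have "(\<Sum>i\<in>UNIV. \<Sum>j\<in>UNIV. (a $ j * v $ j) * (b $ i * u $ i)) = (a \<bullet> v) * (b \<bullet> u)"
    unfolding inner_vec_def inner_real_def sum_product by (rule sum.swap)
  finally show ?thesis .
qed

lemma matrix_vector_add_scaleR: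
  "(a + b) *v v = a *v v + b *v v" "(r *\<^sub>R a) *v v = r *\<^sub>R (a *v v)" for a b :: "real^4^4"
  by (simp_all add: vec_eq_iff matrix_vector_mult_def sum_distrib_left algebra_simps sum.distrib)

lemma adapted_basis_eval:
  assumes "adapted_basis G a e"
  obtains l1 l2 where "\<And>p q. e p \<bullet> (a *v e q) =
     l1 * ((if p = 1 \<and> q = 2 then 1 else 0) - (if p = 2 \<and> q = 1 then 1 else 0))
     + l2 * ((if p = 3 \<and> q = 4 then 1 else 0) - (if p = 4 \<and> q = 3 then 1 else 0))"
proof -
  obtain w l1 l2 where w: "dual_basis e w" "a = l1 *\<^sub>R wedge (w 1) (w 2) + l2 *\<^sub>R wedge (w 3) (w 4)"
    using assms unfolding adapted_basis_def by blast
  have "e p \<bullet> (a *v e q) = l1 * ((w 1 \<bullet> e p) * (w 2 \<bullet> e q) - (w 1 \<bullet> e q) * (w 2 \<bullet> e p))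
     + l2 * ((w 3 \<bullet> e p) * (w 4 \<bullet> e q) - (w 3 \<bullet> e q) * (w 4 \<bullet> e p))" for p q
    unfolding w(2) matrix_vector_add_scaleR by (simp add: inner_add_right wedge_eval)
  then have *: "\<forall>p q. e p \<bullet> (a *v e q) =
     l1 * ((if p = 1 \<and> q = 2 then 1 else 0) - (if p = 2 \<and> q = 1 then 1 else 0))
     + l2 * ((if p = 3 \<and> q = 4 then 1 else 0) - (if p = 4 \<and> q = 3 then 1 else 0))"
    using w(1) unfolding dual_basis_def forall_4 by simp
  show ?thesis by (rule that) (rule *[rule_format])
qed

lemma skew_eval:
  fixes a :: "real^4^4"
  assumes "transpose a = - a"
  shows "u \<bullet> (a *v v) = - (v \<bullet> (a *v u))"
proof -
  have "v $ i * u $ j * a $ i $ j = - (u $ j * v $ i * a $ j $ i)" for i j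
    using arg_cong[OF assms, of "\<lambda>m. m $ j $ i"] by (simp add: transpose_def)
  then have "v \<bullet> (a *v u) = (\<Sum>i\<in>UNIV. \<Sum>j\<in>UNIV. - (u $ j * v $ i * a $ j $ i))"
    unfolding inner_matrix_sum by simp
  also have "\<dots> = - (u \<bullet> (a *v v))" by (subst sum.swap) (simp add: inner_matrix_sum sum_negf)
  finally show ?thesis by simp
qed

text \<open>Orthonormal pairs form a compact set, so the value of the form on such pairs attains a
  maximum. At a maximising pair the form vanishes between the pair and its orthogonal complement;
  hence it splits into two skew blocks of size 2, whatever orthonormal completion is chosen.\<close>

lemma standard_skew_normal_form:
  fixes a :: "real^4^4"
  assumes skew: "transpose a = - a"
  shows "\<exists>f l1 l2. orthonormal_basis (mat 1) f \<and> (\<forall>p q. f p \<bullet> (a *v f q) =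
     l1 * ((if p = 1 \<and> q = 2 then 1 else 0) - (if p = 2 \<and> q = 1 then 1 else 0))
     + l2 * ((if p = 3 \<and> q = 4 then 1 else 0) - (if p = 4 \<and> q = 3 then 1 else 0)))"
proof -
  define K where "K = {z::(real^4) \<times> (real^4). norm (fst z) = 1 \<and> norm (snd z) = 1 \<and> fst z \<bullet> snd z = 0}"
  have "closed K"
    unfolding K_def by (intro closed_Collect_conj closed_Collect_eq continuous_intros)
  moreover have "K \<subseteq> cball 0 1 \<times> cball 0 1" by (auto simp: K_def)
  then have "bounded K" using bounded_Times[OF bounded_cball bounded_cball] bounded_subset by blast
  ultimately have cK: "compact K" by (simp add: compact_eq_bounded_closed)
  have "(axis 1 1, axis 2 1) \<in> K" by (simp add: K_def norm_axis_1 inner_axis_axis)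
  then have "K \<noteq> {}" by blast
  moreover have "continuous_on K (\<lambda>z. fst z \<bullet> (a *v snd z))"
    by (intro continuous_intros continuous_on_compose2[OF linear_continuous_on[OF matrix_vector_mul_bounded_linear, of UNIV]]) auto
  ultimately obtain z where z: "z \<in> K" and zmax: "\<And>y. y \<in> K \<Longrightarrow> fst y \<bullet> (a *v snd y) \<le> fst z \<bullet> (a *v snd z)"
    using continuous_attains_sup[OF cK] by blast
  define l where "l = fst z \<bullet> (a *v snd z)"
  have l: "(- snd z) \<bullet> (a *v fst z) = l"
    using skew_eval[OF skew, of "snd z" "fst z"] by (simp add: l_def)
  text \<open>The first variation of the maximum vanishes in every direction orthogonal to the pair.\<close>
  have crit: "u \<bullet> (a *v w) = 0"
    if uv: "(u, v) \<in> K" and m: "u \<bullet> (a *v v) = l" and w: "norm w = 1" "u \<bullet> w = 0" "v \<bullet> w = 0" for u v w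
  proof -
    define c where "c = u \<bullet> (a *v w)"
    have l0: "l \<ge> 0"
    proof -
      have "(v, u) \<in> K" using uv by (simp add: K_def inner_commute)
      from zmax[OF this] show ?thesis
        using m skew_eval[OF skew, of v u] by (simp add: l_def)
    qed
    \<comment> \<open>Turn \<open>v\<close> towards \<open>w\<close> by the amount \<open>t\<close>
      and renormalise. Maximality bounds the linear gain \<open>t * c\<close> by the second-order
      effect of the normalising factor \<open>q\<close>, which is at most 1 + t^2 / 2.\<close>
    have key: "t * c \<le> l * (t * t / 2)" for t
    proof -
      define q where "q = sqrt (1 + t * t)"
      have q: "q > 0" "q * q = 1 + t * t" unfolding q_def by (simp_all add: add_pos_nonneg)
      have q2: "q \<le> 1 + t * t / 2"
      proof -
        have "0 \<le> (t * t) * (t * t)" by (rule zero_le_square)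
        then show ?thesis
          unfolding q_def by (intro real_le_lsqrt) (auto simp: power2_eq_square algebra_simps)
      qed
      define v' where "v' = (1 / q) *\<^sub>R (v + t *\<^sub>R w)"
      have v: "norm u = 1" "v \<bullet> v = 1" "u \<bullet> v = 0" using uv by (auto simp: K_def norm_eq_sqrt_inner)
      have w': "w \<bullet> w = 1" using w by (simp add: norm_eq_sqrt_inner)
      have "v' \<bullet> v' = (v \<bullet> v + t * t * (w \<bullet> w)) / (q * q)"
        unfolding v'_def using w(3) by (simp add: inner_add_left inner_add_right inner_commute[of w v] add_divide_distrib mult_ac)
      also have "v \<bullet> v + t * t * (w \<bullet> w) = q * q" using q(2) v w' by simp
      finally have "v' \<bullet> v' = 1" using q(1) by simp
      then have "(u, v') \<in> K"
        using v w by (simp add: K_def norm_eq_sqrt_inner v'_def inner_add_right)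
      from zmax[OF this] have "u \<bullet> (a *v v') \<le> l" by (simp add: l_def)
      moreover have "u \<bullet> (a *v v') = (l + t * c) / q"
        unfolding v'_def c_def using m
        by (simp add: matrix_vector_mult_scaleR matrix_vector_right_distrib inner_add_right add_divide_distrib)
      ultimately have "l + t * c \<le> l * q" using q(1) by (simp add: divide_le_eq)
      also have "\<dots> \<le> l * (1 + t * t / 2)" using q2 l0 by (rule mult_left_mono)
      finally show ?thesis by (simp add: algebra_simps)
    qed
    \<comment> \<open>A small \<open>t\<close> with the sign of \<open>c\<close> contradicts
      \<open>key\<close> unless \<open>c\<close> is 0. Dividing by \<open>l + 1\<close> rather than
      \<open>l\<close> covers the case l = 0.\<close>
    define t where "t = c / (l + 1)"
    have c: "c = t * (l + 1)" using l0 by (simp add: t_def)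
    have "t * (t * (l + 1)) \<le> l * (t * t / 2)" using key[of t] c by simp
    then have "t * t * (l + 2) \<le> 0" by (simp add: algebra_simps)
    moreover have "t * t * (l + 2) \<ge> 0" using l0 by simp
    ultimately have "t * t * (l + 2) = 0" by linarith
    then have "c = 0" using l0 c by simp
    then show ?thesis by (simp add: c_def)
  qed
  have "fst z \<bullet> (mat 1 *v fst z) = 1" "snd z \<bullet> (mat 1 *v snd z) = 1" "fst z \<bullet> (mat 1 *v snd z) = 0"
    using z by (auto simp: K_def norm_eq_sqrt_inner)
  from complete_orthonormal_pair[OF posdef_mat1 this]
  obtain f where f: "orthonormal_basis (mat 1) f" "f 1 = fst z" "f 2 = snd z" by blast
  have o: "f p \<bullet> f q = (if p = q then 1 else 0)" for p q
    using f(1) by (simp add: orthonormal_basis_def)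
  have n: "norm (f p) = 1" for p using o[of p p] by (simp add: norm_eq_sqrt_inner)
  have c1: "f 1 \<bullet> (a *v f p) = 0" if "p \<noteq> 1" "p \<noteq> 2" for p
  proof (rule crit[of "f 1" "f 2"])
    show "(f 1, f 2) \<in> K" using z by (simp add: f)
    show "f 1 \<bullet> (a *v f 2) = l" by (simp add: f l_def)
  qed (use that o n in auto)
  \<comment> \<open>By skewness a quarter turn of the pair leaves the value of the form unchanged,
    so (-f 2, f 1) is also maximising and \<open>crit\<close> yields the statement for f 2.\<close>
  have c2: "- f 2 \<bullet> (a *v f p) = 0" if "p \<noteq> 1" "p \<noteq> 2" for p
  proof (rule crit[of "- f 2" "f 1"])
    show "(- f 2, f 1) \<in> K" using n o by (simp add: K_def)
    show "- f 2 \<bullet> (a *v f 1) = l" using l by (simp add: f)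
  qed (use that o n in auto)
  have sk: "f p \<bullet> (a *v f q) = - (f q \<bullet> (a *v f p))" for p q by (rule skew_eval[OF skew])
  have d: "f p \<bullet> (a *v f p) = 0" for p using sk[of p p] by simp
  have 34: "f 1 \<bullet> (a *v f 3) = 0" "f 1 \<bullet> (a *v f 4) = 0" "f 2 \<bullet> (a *v f 3) = 0" "f 2 \<bullet> (a *v f 4) = 0"
    using c1[of 3] c1[of 4] c2[of 3] c2[of 4] by simp_all
  have "\<forall>p q. f p \<bullet> (a *v f q) =
     (f 1 \<bullet> (a *v f 2)) * ((if p = 1 \<and> q = 2 then 1 else 0) - (if p = 2 \<and> q = 1 then 1 else 0))
     + (f 3 \<bullet> (a *v f 4)) * ((if p = 3 \<and> q = 4 then 1 else 0) - (if p = 4 \<and> q = 3 then 1 else 0))"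
    unfolding forall_4 using d 34 sk[of 2 1] sk[of 3 1] sk[of 4 1] sk[of 3 2] sk[of 4 2] sk[of 4 3] by simp
  with f(1) show ?thesis by blast
qed

lemma matrix_congruence_eval: "u \<bullet> ((transpose E ** a ** E) *v v) = (E *v u) \<bullet> (a *v (E *v v))"
  for a E :: "real^4^4"
  by (metis dot_lmul_matrix matrix_vector_mul_assoc vector_transpose_matrix transpose_transpose)

text \<open>An arbitrary orthonormal basis turns \<open>G\<close> into the identity matrix, where
  the Euclidean normal form applies; mapping the resulting basis back gives the adapted one, with
  coframe \<open>G *v e p\<close>.\<close>

lemma exists_adapted_basis:
  assumes G: "posdef G" and skew: "transpose a = - a"
  shows "\<exists>e. adapted_basis G a e"
proof -
  obtain b where b: "orthonormal_basis G b" using exists_orthonormal_basis[OF G] by blast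
  define E where "E = frame_matrix b"
  have "transpose (transpose E ** a ** E) = - (transpose E ** a ** E)"
  proof -
    have "transpose (transpose E ** a ** E) = transpose E ** (- a) ** E"
      by (simp add: matrix_transpose_mul skew matrix_mul_assoc)
    also have "\<dots> = transpose E ** ((-1) *\<^sub>R a) ** E" by simp
    also have "\<dots> = - (transpose E ** a ** E)" unfolding scaleR_matrix_mult by simp
    finally show ?thesis .
  qed
  from standard_skew_normal_form[OF this]
  obtain f l1 l2 where f: "orthonormal_basis (mat 1) f" "\<And>p q. f p \<bullet> ((transpose E ** a ** E) *v f q) =
     l1 * ((if p = 1 \<and> q = 2 then 1 else 0) - (if p = 2 \<and> q = 1 then 1 else 0))
     + l2 * ((if p = 3 \<and> q = 4 then 1 else 0) - (if p = 4 \<and> q = 3 then 1 else 0))"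
    by blast
  define e where "e p = E *v f p" for p
  have e: "orthonormal_basis G e"
    using f(1) unfolding orthonormal_basis_def e_def matrix_congruence_eval[symmetric]
    unfolding E_def frame_matrix_orthonormal(1)[OF b] .
  define w where "w p = G *v e p" for p
  have w: "dual_basis e w" unfolding w_def by (rule dual_basis_orthonormal[OF e G])
  have "a = l1 *\<^sub>R wedge (w 1) (w 2) + l2 *\<^sub>R wedge (w 3) (w 4)"
  proof (rule orthonormal_basis_ext[OF e])
    fix p q
    have "e p \<bullet> (a *v e q) =
     l1 * ((if p = 1 \<and> q = 2 then 1 else 0) - (if p = 2 \<and> q = 1 then 1 else 0))
     + l2 * ((if p = 3 \<and> q = 4 then 1 else 0) - (if p = 4 \<and> q = 3 then 1 else 0))"
      using f(2)[of p q] unfolding matrix_congruence_eval e_def .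
    also have "\<dots> = l1 * ((w 1 \<bullet> e p) * (w 2 \<bullet> e q) - (w 1 \<bullet> e q) * (w 2 \<bullet> e p))
     + l2 * ((w 3 \<bullet> e p) * (w 4 \<bullet> e q) - (w 3 \<bullet> e q) * (w 4 \<bullet> e p))"
      using w unfolding dual_basis_def by simp
    also have "\<dots> = e p \<bullet> ((l1 *\<^sub>R wedge (w 1) (w 2) + l2 *\<^sub>R wedge (w 3) (w 4)) *v e q)"
      unfolding matrix_vector_add_scaleR by (simp add: inner_add_right wedge_eval)
    finally show "e p \<bullet> (a *v e q) = e p \<bullet> ((l1 *\<^sub>R wedge (w 1) (w 2) + l2 *\<^sub>R wedge (w 3) (w 4)) *v e q)" .
  qed
  with e w show ?thesis unfolding adapted_basis_def by blast
qed

section \<open>Definiteness and invariance of the inner products of forms\<close>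

lemma inner1_orthonormal:
  assumes "orthonormal_basis G e"
  shows "inner1 G a b = (\<Sum>p\<in>UNIV. (a \<bullet> e p) * (b \<bullet> e p))"
proof -
  have "inner1 G a b = (\<Sum>i\<in>UNIV. \<Sum>k\<in>UNIV. \<Sum>p\<in>UNIV. (a $ i * e p $ i) * (b $ k * e p $ k))"
    unfolding inner1_def matrix_inv_orthonormal[OF assms] by (simp add: sum_distrib_right sum_distrib_left mult_ac)
  also have "\<dots> = (\<Sum>p\<in>UNIV. \<Sum>i\<in>UNIV. \<Sum>k\<in>UNIV. (a $ i * e p $ i) * (b $ k * e p $ k))"
    by (rule sum_pull2)
  also have "\<dots> = (\<Sum>p\<in>UNIV. (a \<bullet> e p) * (b \<bullet> e p))"
    unfolding inner_vec_def inner_real_def sum_product ..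
  finally show ?thesis .
qed

definition eval3 :: "real^4^4^4 \<Rightarrow> real^4 \<Rightarrow> real^4 \<Rightarrow> real^4 \<Rightarrow> real" where
  "eval3 a u v w = (\<Sum>i\<in>UNIV. u $ i * (v \<bullet> (a $ i *v w)))"

lemma inner3_inner2: "inner3 G a b = 1/3 * (\<Sum>i\<in>UNIV. \<Sum>k\<in>UNIV. matrix_inv G $ i $ k * inner2 G (a $ i) (b $ k))"
proof -
  have "inner3 G a b = 1/6 * (\<Sum>i\<in>UNIV. \<Sum>k\<in>UNIV. \<Sum>j\<in>UNIV. \<Sum>m\<in>UNIV. \<Sum>l\<in>UNIV. \<Sum>n\<in>UNIV.
     matrix_inv G $ i $ k * (matrix_inv G $ j $ l * matrix_inv G $ m $ n * a $ i $ j $ m * b $ k $ l $ n))"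
    unfolding inner3_def mult.assoc by (subst sum_pull2) (rule refl)
  then show ?thesis
    unfolding inner2_def by (simp add: sum_distrib_left mult_ac)
qed

lemma inner3_orthonormal:
  assumes "orthonormal_basis G e"
  shows "inner3 G a b = 1/6 * (\<Sum>r\<in>UNIV. \<Sum>p\<in>UNIV. \<Sum>q\<in>UNIV. eval3 a (e r) (e p) (e q) * eval3 b (e r) (e p) (e q))"
proof -
  have "inner3 G a b = 1/6 * (\<Sum>i\<in>UNIV. \<Sum>k\<in>UNIV. \<Sum>r\<in>UNIV. \<Sum>p\<in>UNIV. \<Sum>q\<in>UNIV.
     (e r $ i * (e p \<bullet> (a $ i *v e q))) * (e r $ k * (e p \<bullet> (b $ k *v e q))))"
    unfolding inner3_inner2 inner2_orthonormal[OF assms] matrix_inv_orthonormal[OF assms] sum_distrib_right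
    unfolding sum_distrib_left by (simp add: mult_ac)
  also have "(\<Sum>i\<in>UNIV. \<Sum>k\<in>UNIV. \<Sum>r\<in>UNIV. \<Sum>p\<in>UNIV. \<Sum>q\<in>UNIV.
     (e r $ i * (e p \<bullet> (a $ i *v e q))) * (e r $ k * (e p \<bullet> (b $ k *v e q)))) =
     (\<Sum>r\<in>UNIV. \<Sum>i\<in>UNIV. \<Sum>k\<in>UNIV. \<Sum>p\<in>UNIV. \<Sum>q\<in>UNIV.
     (e r $ i * (e p \<bullet> (a $ i *v e q))) * (e r $ k * (e p \<bullet> (b $ k *v e q))))"
    by (rule sum_pull2)
  also have "\<dots> = (\<Sum>r\<in>UNIV. \<Sum>p\<in>UNIV. \<Sum>q\<in>UNIV. \<Sum>i\<in>UNIV. \<Sum>k\<in>UNIV.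
     (e r $ i * (e p \<bullet> (a $ i *v e q))) * (e r $ k * (e p \<bullet> (b $ k *v e q))))"
    by (intro sum.cong[OF refl] sum_swap22)
  finally show ?thesis unfolding eval3_def sum_product .
qed

lemma inner1_zero:
  assumes "posdef G" "inner1 G a a = 0"
  shows "a = 0"
proof -
  obtain e where e: "orthonormal_basis G e" using exists_orthonormal_basis[OF assms(1)] by blast
  have "\<forall>p\<in>UNIV. (a \<bullet> e p) * (a \<bullet> e p) = 0"
    using assms(2) unfolding inner1_orthonormal[OF e] by (subst (asm) sum_nonneg_eq_0_iff) auto
  then have "transpose (frame_matrix e) *v a = 0"
    by (simp add: vec_eq_iff matrix_vector_mult_def transpose_def frame_matrix_def inner_vec_def mult.commute)
  then have "G ** (frame_matrix e ** transpose (frame_matrix e)) *v a = 0"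
    by (metis matrix_vector_mul_assoc matrix_vector_mult_0_right)
  then show ?thesis using frame_matrix_orthonormal(2,4)[OF e] by simp
qed

lemma inner_nonneg:
  assumes "posdef G"
  shows "inner1 G a a \<ge> 0" "inner3 G b b \<ge> 0"
proof -
  obtain e where e: "orthonormal_basis G e" using exists_orthonormal_basis[OF assms] by blast
  show "inner1 G a a \<ge> 0" unfolding inner1_orthonormal[OF e] by (intro sum_nonneg) simp
  show "inner3 G b b \<ge> 0" unfolding inner3_orthonormal[OF e] by (intro mult_nonneg_nonneg[of "1/6"] sum_nonneg zero_le_square) simp
qed

lemma inner3_zero:
  assumes "posdef G" "inner3 G a a = 0"
  shows "a = 0"
proof -
  obtain e where e: "orthonormal_basis G e" using exists_orthonormal_basis[OF assms(1)] by blast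
  have "(\<Sum>r\<in>UNIV. \<Sum>p\<in>UNIV. \<Sum>q\<in>UNIV. eval3 a (e r) (e p) (e q) * eval3 a (e r) (e p) (e q)) = 0"
    using assms(2) unfolding inner3_orthonormal[OF e] by simp
  then have z: "eval3 a (e r) (e p) (e q) = 0" for r p q
    by (simp add: sum_nonneg_eq_0_iff sum_nonneg)
  have "(\<Sum>i\<in>UNIV. e r $ i *\<^sub>R a $ i) = 0" for r
  proof (rule orthonormal_basis_ext[OF e])
    fix p q
    have "e p \<bullet> ((\<Sum>i\<in>UNIV. e r $ i *\<^sub>R a $ i) *v e q) = eval3 a (e r) (e p) (e q)"
      unfolding eval3_def UNIV_4 by (simp add: matrix_vector_add_scaleR inner_add_right)
    then show "e p \<bullet> ((\<Sum>i\<in>UNIV. e r $ i *\<^sub>R a $ i) *v e q) = e p \<bullet> (0 *v e q)" by (simp add: z)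
  qed
  then have v: "transpose (frame_matrix e) *v (\<chi> i. a $ i $ j $ k) = 0" for j k
    by (simp add: vec_eq_iff matrix_vector_mult_def transpose_def frame_matrix_def)
  have "(\<chi> i. a $ i $ j $ k) = 0" for j k
  proof -
    have "G ** (frame_matrix e ** transpose (frame_matrix e)) *v (\<chi> i. a $ i $ j $ k) = 0"
      using v[of j k] by (metis matrix_vector_mul_assoc matrix_vector_mult_0_right)
    then show ?thesis using frame_matrix_orthonormal(2,4)[OF e] by simp
  qed
  then show ?thesis by (simp add: vec_eq_iff)
qed

lemma orthonormal_basis_push:
  assumes "orthonormal_basis (transpose J ** G ** J) e"
  shows "orthonormal_basis G (\<lambda>p. J *v e p)"
  using assms unfolding orthonormal_basis_def matrix_congruence_eval .

text \<open>\<open>J\<close> maps an orthonormal basis for the pulled-back Gram matrix to one for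
  \<open>G\<close>, and evaluating the pulled-back covectors on the former is evaluating the
  original ones on the latter.\<close>

lemma inner1_invariant:
  assumes "posdef (transpose J ** G ** J)"
  shows "inner1 (transpose J ** G ** J) (transpose J *v a) (transpose J *v b) = inner1 G a b"
proof -
  obtain e where e: "orthonormal_basis (transpose J ** G ** J) e" using exists_orthonormal_basis[OF assms] by blast
  have "(transpose J *v a) \<bullet> v = a \<bullet> (J *v v)" for a v :: "real^4"
    by (metis dot_lmul_matrix vector_transpose_matrix transpose_transpose)
  then show ?thesis
    unfolding inner1_orthonormal[OF e] inner1_orthonormal[OF orthonormal_basis_push[OF e]] by simp
qed

text \<open>Pullback of a trilinear form by the linear map \<open>J\<close>, arranged so that the
  first index selects a matrix.\<close>

definition pull3 :: "real^4^4 \<Rightarrow> real^4^4^4 \<Rightarrow> real^4^4^4" where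
  "pull3 J b = (\<chi> i. \<Sum>a\<in>UNIV. J $ a $ i *\<^sub>R (transpose J ** b $ a ** J))"

lemma eval3_pull3: "eval3 (pull3 J b) u v w = eval3 b (J *v u) (J *v v) (J *v w)"
proof -
  have l: "v \<bullet> ((\<Sum>a\<in>UNIV. J $ a $ i *\<^sub>R (transpose J ** b $ a ** J)) *v w) =
      (\<Sum>a\<in>UNIV. J $ a $ i * (v \<bullet> ((transpose J ** b $ a ** J) *v w)))" for i
    unfolding UNIV_4 by (simp add: matrix_vector_add_scaleR inner_add_right)
  have "eval3 (pull3 J b) u v w =
      (\<Sum>i\<in>UNIV. \<Sum>a\<in>UNIV. u $ i * J $ a $ i * ((J *v v) \<bullet> (b $ a *v (J *v w))))"
    unfolding eval3_def pull3_def by (simp add: l matrix_congruence_eval sum_distrib_left mult_ac)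
  also have "\<dots> = (\<Sum>a\<in>UNIV. \<Sum>i\<in>UNIV. u $ i * J $ a $ i * ((J *v v) \<bullet> (b $ a *v (J *v w))))"
    by (rule sum.swap)
  finally show ?thesis unfolding eval3_def matrix_vector_mult_def by (simp add: sum_distrib_right mult_ac)
qed

lemma inner3_invariant:
  assumes "posdef (transpose J ** G ** J)"
  shows "inner3 (transpose J ** G ** J) (pull3 J a) (pull3 J b) = inner3 G a b"
proof -
  obtain e where e: "orthonormal_basis (transpose J ** G ** J) e" using exists_orthonormal_basis[OF assms] by blast
  show ?thesis
    unfolding inner3_orthonormal[OF e] inner3_orthonormal[OF orthonormal_basis_push[OF e]] eval3_pull3 ..
qed

section \<open>Integration over a compact Riemannian manifold\<close>

text \<open>A zero integral makes \<open>h\<close> vanish almost everywhere, while a positive value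
  would persist on a nonempty open set, which is not negligible. Integrability must be assumed
  because otherwise the integral is 0 by convention.\<close>

lemma continuous_nonneg_integral_0:
  fixes h :: "real^4 \<Rightarrow> real"
  assumes S: "open S" and c: "continuous_on S h" and nn: "\<And>x. x \<in> S \<Longrightarrow> 0 \<le> h x"
    and i: "set_integrable lborel S h" and z: "set_lebesgue_integral lborel S h = 0" and x: "x \<in> S"
  shows "h x = 0"
proof (rule ccontr)
  assume "h x \<noteq> 0"
  define U where "U = S \<inter> h -` {0<..}"
  have "open U" unfolding U_def using c S by (simp add: continuous_open_preimage)
  moreover have "x \<in> U" using x nn[OF x] \<open>h x \<noteq> 0\<close> by (auto simp: U_def)
  ultimately have "\<not> negligible U" using open_not_negligible by blast
  have "AE y in lborel. indicator S y *\<^sub>R h y = 0"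
    using z i nn unfolding set_lebesgue_integral_def set_integrable_def
    by (subst (asm) integral_nonneg_eq_0_iff_AE) (auto simp: indicator_def)
  then have "AE y in lborel. y \<notin> U" by eventually_elim (auto simp: U_def)
  then have "AE y in lebesgue. y \<notin> U" by (rule AE_completion)
  then have "U \<in> null_sets lebesgue"
    using \<open>open U\<close> by (subst AE_iff_null_sets) auto
  then show False using \<open>\<not> negligible U\<close> by (simp add: negligible_iff_null_sets)
qed

lemma set_integrable_borel_iff_lebesgue:
  fixes h :: "real^4 \<Rightarrow> real"
  assumes "S \<in> sets borel" "continuous_on S h"
  shows "h absolutely_integrable_on S \<longleftrightarrow> set_integrable lborel S h"
  unfolding set_integrable_def
  by (rule integrable_completion) (use borel_measurable_continuous_on_indicator[OF assms] in simp)

lemma absolutely_integrable_transform: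
  fixes h :: "real^4 \<Rightarrow> real" and \<tau> :: "real^4 \<Rightarrow> real^4"
  assumes "S \<in> sets lebesgue" "\<And>x. x \<in> S \<Longrightarrow> (\<tau> has_derivative (\<lambda>v. J x *v v)) (at x)" "inj_on \<tau> S"
    and "h absolutely_integrable_on (\<tau> ` S)"
  shows "(\<lambda>x. \<bar>det (J x)\<bar> * h (\<tau> x)) absolutely_integrable_on S"
proof -
  \<comment> \<open>The change of variables theorem is stated for functions with values in a
    Cartesian power of the reals; \<open>vec\<close> regards \<open>h\<close> as a function into
    \<open>real^1\<close>.\<close>
  have "(\<lambda>x. \<bar>det (matrix ((*v) (J x)))\<bar> *\<^sub>R (vec (h (\<tau> x)) :: real^1)) absolutely_integrable_on S"
    using has_absolute_integral_change_of_variables[OF assms(1) has_derivative_at_withinI[OF assms(2)] assms(3),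
        of "\<lambda>y. vec (h y) :: real^1" "integral (\<tau> ` S) (\<lambda>y. vec (h y))"] assms(4)
    by (simp add: absolutely_integrable_on_1_iff)
  then show ?thesis by (simp add: absolutely_integrable_on_1_iff)
qed

section \<open>Charts, transition maps and the metric\<close>

locale oriented_riemannian =
  fixes A :: "('a::t2_space) chart set" and g :: "'a chart \<Rightarrow> real^4 \<Rightarrow> real^4^4"
  assumes atlas: "smooth_oriented_atlas A"
    and comp: "compact (UNIV :: 'a set)"
    and metric: "riemannian_metric A g"
begin

lemma chart_exists: "\<exists>c\<in>A. p \<in> chart_dom c"
  using atlas unfolding smooth_oriented_atlas_def by blast

lemma chart_open: "c \<in> A \<Longrightarrow> open (chart_dom c)" "c \<in> A \<Longrightarrow> open (chart_img c)"
  and chart_homeo: "c \<in> A \<Longrightarrow> homeomorphism (chart_dom c) (chart_img c) (chart_map c) (chart_inv c)"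
  using atlas unfolding smooth_oriented_atlas_def by blast+

lemma chart_inv_map: "c \<in> A \<Longrightarrow> p \<in> chart_dom c \<Longrightarrow> chart_inv c (chart_map c p) = p"
  and chart_map_inv: "c \<in> A \<Longrightarrow> x \<in> chart_img c \<Longrightarrow> chart_map c (chart_inv c x) = x"
  and chart_inv_dom: "c \<in> A \<Longrightarrow> x \<in> chart_img c \<Longrightarrow> chart_inv c x \<in> chart_dom c"
  and chart_map_img: "c \<in> A \<Longrightarrow> p \<in> chart_dom c \<Longrightarrow> chart_map c p \<in> chart_img c"
  using chart_homeo unfolding homeomorphism_def by (blast, blast, blast, blast)

lemma chart_image_open:
  assumes "c \<in> A" "open U"
  shows "open (chart_map c ` (chart_dom c \<inter> U))"
proof -
  have "openin (top_of_set (chart_dom c)) (chart_dom c \<inter> U)" using assms(2) by blast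
  from homeomorphism_imp_open_map[OF chart_homeo[OF assms(1)] this] show ?thesis
    using chart_open(2)[OF assms(1)] openin_open_eq by blast
qed

lemma chart_inv_open:
  assumes "c \<in> A" "open V" "V \<subseteq> chart_img c"
  shows "open (chart_inv c ` V)"
proof -
  have "openin (top_of_set (chart_img c)) V" using assms(2,3) by (simp add: open_subset)
  from homeomorphism_imp_open_map[OF homeomorphism_symD[OF chart_homeo[OF assms(1)]] this] show ?thesis
    using chart_open(1)[OF assms(1)] openin_open_eq by blast
qed

lemma overlap_open: "c \<in> A \<Longrightarrow> c' \<in> A \<Longrightarrow> open (overlap c c')"
  unfolding overlap_def using chart_image_open chart_open by blast

lemma overlap_iff:
  "c \<in> A \<Longrightarrow> x \<in> overlap c c' \<longleftrightarrow> x \<in> chart_img c \<and> chart_inv c x \<in> chart_dom c'"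
  unfolding overlap_def chart_img_def[of c]
  by (auto simp: chart_inv_map intro!: imageI)

lemma overlap_subset: "overlap c c' \<subseteq> chart_img c"
  unfolding overlap_def chart_img_def by blast

lemma overlap_self: "overlap c c = chart_img c"
  unfolding overlap_def chart_img_def by simp

lemma transition_overlap:
  assumes "c \<in> A" "c' \<in> A" "x \<in> overlap c c'"
  shows "transition c c' x \<in> overlap c' c" "transition c' c (transition c c' x) = x"
    "chart_inv c' (transition c c' x) = chart_inv c x" "transition c c' x \<in> chart_img c'"
proof -
  have x: "x \<in> chart_img c" "chart_inv c x \<in> chart_dom c'" "chart_inv c x \<in> chart_dom c"
    using assms overlap_iff chart_inv_dom by auto
  show 1: "chart_inv c' (transition c c' x) = chart_inv c x"
    unfolding transition_def by (rule chart_inv_map[OF assms(2) x(2)])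
  show 2: "transition c c' x \<in> chart_img c'"
    unfolding transition_def by (rule chart_map_img[OF assms(2) x(2)])
  show "transition c c' x \<in> overlap c' c" using overlap_iff[OF assms(2)] 1 2 x by simp
  show "transition c' c (transition c c' x) = x"
    unfolding transition_def[of c' c] 1 by (rule chart_map_inv[OF assms(1) x(1)])
qed

lemma transition_inj:
  assumes "c \<in> A" "c' \<in> A"
  shows "inj_on (transition c c') (overlap c c')"
  using transition_overlap(2)[OF assms] by (metis inj_onI)

lemma transition_smooth:
  "c \<in> A \<Longrightarrow> c' \<in> A \<Longrightarrow> smooth_on (overlap c c') (\<lambda>x. transition c c' x $ k)"
  using atlas unfolding smooth_oriented_atlas_def by blast

lemma jacobian_smooth:
  "c \<in> A \<Longrightarrow> c' \<in> A \<Longrightarrow> smooth_on (overlap c c') (\<lambda>x. jacobian c c' x $ k $ i)"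
  using smooth_on_partial[OF transition_smooth] by (simp add: jacobian_def)

lemma jacobian_pos: "c \<in> A \<Longrightarrow> c' \<in> A \<Longrightarrow> x \<in> overlap c c' \<Longrightarrow> det (jacobian c c' x) > 0"
  using atlas unfolding smooth_oriented_atlas_def by blast

lemma transition_derivative:
  assumes "c \<in> A" "c' \<in> A" "x \<in> overlap c c'"
  shows "(transition c c' has_derivative (\<lambda>v. jacobian c c' x *v v)) (at x)"
proof -
  have "(\<lambda>v. \<chi> a. \<Sum>i\<in>UNIV. v $ i * partial i (\<lambda>y. transition c c' y $ a) x) = (\<lambda>v. jacobian c c' x *v v)"
    by (simp add: jacobian_def matrix_vector_mult_def mult.commute)
  then show ?thesis
    using differentiable_vec[of "transition c c'" x] smooth_on_differentiable[OF transition_smooth[OF assms(1,2)] assms(3)]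
    by simp
qed

lemma jacobian_cocycle:
  assumes "c \<in> A" "c' \<in> A" "c'' \<in> A" "x \<in> overlap c c'" "x \<in> overlap c c''"
  shows "jacobian c c'' x = jacobian c' c'' (transition c c' x) ** jacobian c c' x"
proof -
  let ?y = "transition c c' x"
  have y: "?y \<in> overlap c' c''"
    using overlap_iff[OF assms(2)] overlap_iff[OF assms(1)] transition_overlap(3,4)[OF assms(1,2,4)] assms(4,5) by simp
  have o: "open (overlap c c' \<inter> overlap c c'')" using overlap_open assms by blast
  have "(\<lambda>z. transition c' c'' (transition c c' z) $ k) z = transition c c'' z $ k" if "z \<in> overlap c c' \<inter> overlap c c''" for z k
    using transition_overlap(3)[OF assms(1,2)] that by (simp add: transition_def[of c' c''] transition_def[of c c''])
  then have "partial i (\<lambda>z. transition c c'' z $ k) x = partial i (\<lambda>z. transition c' c'' (transition c c' z) $ k) x" for i k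
    using assms(4,5) by (intro partial_cong_open[OF o]) auto
  moreover have "partial i (\<lambda>z. transition c' c'' (transition c c' z) $ k) x =
      (\<Sum>a\<in>UNIV. partial a (\<lambda>w. transition c' c'' w $ k) ?y * partial i (\<lambda>z. transition c c' z $ a) x)" for i k
    by (rule partial_compose(2)) (use assms y smooth_on_differentiable[OF transition_smooth] in auto)
  ultimately show ?thesis by (simp add: jacobian_def matrix_matrix_mult_def vec_eq_iff)
qed

lemma metric_smooth: "c \<in> A \<Longrightarrow> smooth_on (chart_img c) (\<lambda>x. g c x $ i $ j)"
  using metric by (simp add: riemannian_metric_def tensor2_def)

lemma metric_transform:
  assumes "c \<in> A" "c' \<in> A" "x \<in> overlap c c'"
  shows "g c x = transpose (jacobian c c' x) ** g c' (transition c c' x) ** jacobian c c' x"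
proof -
  have "\<forall>c\<in>A. \<forall>c'\<in>A. \<forall>x\<in>overlap c c'.
      g c x = transpose (jacobian c c' x) ** g c' (transition c c' x) ** jacobian c c' x"
    using metric[unfolded riemannian_metric_def tensor2_def, THEN conjunct1] by (rule conjunct2)
  from bspec[OF bspec[OF bspec[OF this assms(1)] assms(2)] assms(3)] show ?thesis .
qed

lemma metric_posdef:
  assumes "c \<in> A" "x \<in> chart_img c"
  shows "posdef (g c x)"
proof -
  have "\<forall>c\<in>A. \<forall>x\<in>chart_img c.
      transpose (g c x) = g c x \<and> (\<forall>v. v \<noteq> 0 \<longrightarrow> v \<bullet> (g c x *v v) > 0)"
    using metric[unfolded riemannian_metric_def] by (rule conjunct2)
  from bspec[OF bspec[OF this assms(1)] assms(2)] show ?thesis unfolding posdef_def .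
qed

text \<open>The determinant of the metric picks up the square of the Jacobian determinant; its root
  carries no absolute value because the atlas is oriented.\<close>

lemma sqrt_det_transform:
  assumes "c \<in> A" "c' \<in> A" "x \<in> overlap c c'"
  shows "sqrt (det (g c x)) = det (jacobian c c' x) * sqrt (det (g c' (transition c c' x)))"
proof -
  have "det (g c x) = (det (jacobian c c' x))\<^sup>2 * det (g c' (transition c c' x))"
    unfolding metric_transform[OF assms] det_mul det_transpose by (simp add: power2_eq_square mult_ac)
  then show ?thesis using jacobian_pos[OF assms] by (simp add: real_sqrt_mult)
qed

end

lemma smooth_on_det:
  assumes "open S" "\<And>i j. smooth_on S (\<lambda>x. m x $ i $ j)"
  shows "smooth_on S (\<lambda>x. det (m x :: real^4^4))"
  unfolding det_def by (intro smooth_intros assms)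

text \<open>Cramer's rule exhibits the entries of the inverse as quotients of polynomials in the
  entries, from which smoothness of the inverse metric follows.\<close>

lemma matrix_inv_cramer:
  fixes a :: "real^4^4"
  assumes "det a \<noteq> 0"
  shows "matrix_inv a $ i $ j = det (\<chi> p q. if q = i then axis j 1 $ p else a $ p $ q) * inverse (det a)"
proof -
  have "a ** matrix_inv a = mat 1" using assms matrix_inv_eqI unfolding invertible_det_nz[symmetric] invertible_def by blast
  then have "a *v (matrix_inv a *v axis j 1) = axis j 1" by (simp add: matrix_vector_mul_assoc)
  from cramer[OF assms, THEN iffD1, OF this] show ?thesis
    by (simp add: matrix_vector_mult_basis column_def vec_eq_iff divide_inverse)
qed

lemma smooth_on_matrix_inv:
  assumes "open S" "\<And>i j. smooth_on S (\<lambda>x. m x $ i $ j)" "\<And>x. x \<in> S \<Longrightarrow> det (m x) \<noteq> 0"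
  shows "smooth_on S (\<lambda>x. matrix_inv (m x :: real^4^4) $ i $ j)"
proof -
  have "smooth_on S (\<lambda>x. det (\<chi> p q. if q = i then axis j 1 $ p else m x $ p $ q) * inverse (det (m x)))"
  proof (intro smooth_on_mult smooth_on_det smooth_on_inverse assms)
    fix p q show "smooth_on S (\<lambda>x. (\<chi> p q. if q = i then axis j 1 $ p else m x $ p $ q) $ p $ q)"
      using assms(2) smooth_on_const by (cases "q = i") auto
  qed
  then show ?thesis
    by (subst smooth_on_cong[OF assms(1) matrix_inv_cramer[OF assms(3)]])
qed

section \<open>Integrals of continuous functions over the manifold\<close>

context oriented_riemannian
begin

lemma sqrt_det_smooth: "c \<in> A \<Longrightarrow> smooth_on (chart_img c) (\<lambda>x. sqrt (det (g c x)))"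
  using posdef_inv(5)[OF metric_posdef]
  by (intro smooth_on_sqrt smooth_on_det chart_open metric_smooth) auto

lemma inv_smooth: "c \<in> A \<Longrightarrow> smooth_on (chart_img c) (\<lambda>x. matrix_inv (g c x) $ i $ j)"
  using posdef_inv(5)[OF metric_posdef]
  by (intro smooth_on_matrix_inv chart_open metric_smooth) fastforce+

definition scalar :: "('a chart \<Rightarrow> real^4 \<Rightarrow> real) \<Rightarrow> bool" where
  "scalar s \<longleftrightarrow> (\<forall>c\<in>A. continuous_on (chart_img c) (s c)) \<and>
     (\<forall>c\<in>A. \<forall>c'\<in>A. \<forall>x\<in>overlap c c'. s c x = s c' (transition c c' x))"

text \<open>Near the boundary of the chart image the density may be unbounded, so continuity there
  is not enough. Compactness covers the manifold by finitely many coordinate balls whose closures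
  lie inside chart images. On the corresponding piece of the given chart image the integrand is the
  change-of-variables transform of a function continuous on a closed ball.\<close>

lemma scalar_integrable:
  assumes s: "scalar s" and c: "c \<in> A"
  shows "set_integrable lborel (chart_img c) (\<lambda>x. s c x * sqrt (det (g c x)))"
proof -
  define h where "h c x = s c x * sqrt (det (g c x))" for c x
  have hc: "continuous_on (chart_img c) (h c)" if "c \<in> A" for c
    unfolding h_def using s that smooth_on_continuous[OF sqrt_det_smooth[OF that]]
    by (auto simp: scalar_def intro!: continuous_on_mult)
  have ht: "h c x = \<bar>det (jacobian c c' x)\<bar> * h c' (transition c c' x)"
    if "c \<in> A" "c' \<in> A" "x \<in> overlap c c'" for c c' x
    using s that jacobian_pos[OF that] unfolding h_def sqrt_det_transform[OF that] scalar_def by simp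
  \<comment> \<open>The closed ball bounds the density; the open ball inside it supplies the open
    cover.\<close>
  have "\<exists>c' r. c' \<in> A \<and> p \<in> chart_dom c' \<and> 0 < r \<and> cball (chart_map c' p) r \<subseteq> chart_img c'" for p
    by (meson chart_exists chart_map_img chart_open(2) open_contains_cball)
  then obtain C r where C: "\<And>p. C p \<in> A" "\<And>p. p \<in> chart_dom (C p)" "\<And>p. 0 < r p"
    "\<And>p. cball (chart_map (C p) p) (r p) \<subseteq> chart_img (C p)" by metis
  define N where "N p = chart_inv (C p) ` ball (chart_map (C p) p) (r p)" for p
  have bs: "ball (chart_map (C p) p) (r p) \<subseteq> chart_img (C p)" for p
    using C(4)[of p] ball_subset_cball by blast
  have oN: "open (N p)" for p unfolding N_def by (rule chart_inv_open[OF C(1) open_ball bs])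
  have "p \<in> N p" for p
    unfolding N_def using C(3)[of p] chart_inv_map[OF C(1) C(2)] by (metis centre_in_ball imageI)
  then have "UNIV \<subseteq> (\<Union>p\<in>UNIV. N p)" by blast
  from compactE_image[OF comp oN this]
  obtain P where P: "finite P" "UNIV \<subseteq> (\<Union>p\<in>P. N p)" by metis
  define W where "W p = chart_map c ` (chart_dom c \<inter> N p)" for p
  have oW: "open (W p)" for p unfolding W_def by (rule chart_image_open[OF c oN])
  have "set_integrable lborel (W p) (h c)" for p
  proof -
    have Wo: "W p \<subseteq> overlap c (C p)"
      unfolding W_def N_def overlap_def using bs chart_inv_dom[OF C(1)] by blast
    have tW: "transition c (C p) ` W p \<subseteq> cball (chart_map (C p) p) (r p)"
    proof clarify
      fix x assume "x \<in> W p"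
      then obtain q where q: "x = chart_map c q" "q \<in> chart_dom c" "q \<in> N p" by (auto simp: W_def)
      then obtain y where y: "q = chart_inv (C p) y" "y \<in> ball (chart_map (C p) p) (r p)" by (auto simp: N_def)
      have "transition c (C p) x = chart_map (C p) q"
        unfolding transition_def q(1) chart_inv_map[OF c q(2)] ..
      also have "\<dots> = y" unfolding y(1) using chart_map_inv[OF C(1)] y(2) bs by blast
      finally show "transition c (C p) x \<in> cball (chart_map (C p) p) (r p)" using y(2) by simp
    qed
    have m: "W p \<in> sets lebesgue" using oW by (simp add: borel_open)
    have "set_integrable lborel (cball (chart_map (C p) p) (r p)) (h (C p))"
      unfolding set_integrable_def
      by (rule borel_integrable_compact) (use continuous_on_subset[OF hc[OF C(1)] C(4)] in auto)
    then have "h (C p) absolutely_integrable_on cball (chart_map (C p) p) (r p)"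
      by (subst set_integrable_borel_iff_lebesgue) (use continuous_on_subset[OF hc[OF C(1)] C(4)] in auto)
    moreover have der: "(transition c (C p) has_derivative (\<lambda>v. jacobian c (C p) x *v v)) (at x)" if "x \<in> W p" for x
      using transition_derivative[OF c C(1)] Wo that by blast
    have "transition c (C p) ` W p \<in> sets lebesgue"
      by (rule differentiable_image_in_sets_lebesgue[OF m])
        (auto simp: differentiable_on_def differentiable_def intro: has_derivative_at_withinI[OF der])
    ultimately have "h (C p) absolutely_integrable_on (transition c (C p) ` W p)"
      using tW by (rule set_integrable_subset)
    then have "(\<lambda>x. \<bar>det (jacobian c (C p) x)\<bar> * h (C p) (transition c (C p) x)) absolutely_integrable_on W p"
      using absolutely_integrable_transform[OF m der] inj_on_subset[OF transition_inj[OF c C(1)] Wo] by blast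
    then have "h c absolutely_integrable_on W p"
      unfolding set_integrable_def
      by (rule Bochner_Integration.integrable_cong[THEN iffD1, rotated -1])
        (use ht[OF c C(1)] Wo in \<open>auto simp: indicator_def\<close>)
    then show ?thesis
      by (subst (asm) set_integrable_borel_iff_lebesgue)
        (use oW continuous_on_subset[OF hc[OF c]] Wo overlap_subset in \<open>blast intro: borel_open\<close>)+
  qed
  then have "set_integrable lborel (\<Union>p\<in>P. W p) (h c)"
    using P(1) oW by (intro set_integrable_UN) (auto intro: borel_open)
  moreover have "(\<Union>p\<in>P. W p) = chart_img c"
    using P(2) unfolding W_def chart_img_def by blast
  ultimately show ?thesis by (simp add: h_def[abs_def])
qed

text \<open>\<open>integral_over\<close> removes from each chart what earlier charts cover. Placing
  \<open>c\<close> first makes its piece the whole chart image.\<close>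

lemma chart_cover_exists:
  assumes "c \<in> A"
  shows "\<exists>cs. chart_cover A (c # cs)"
proof -
  have "UNIV \<subseteq> (\<Union>c\<in>A. chart_dom c)" using chart_exists by blast
  from compactE_image[OF comp chart_open(1) this]
  obtain P where "P \<subseteq> A" "finite P" "UNIV \<subseteq> (\<Union>c\<in>P. chart_dom c)" by metis
  moreover obtain cs where "set cs = P" using finite_list[OF \<open>finite P\<close>] by blast
  ultimately show ?thesis using assms by (intro exI[of _ cs]) (auto simp: chart_cover_def)
qed

lemma integral_over_cong:
  assumes "set cs \<subseteq> A" "\<And>c x. c \<in> A \<Longrightarrow> x \<in> chart_img c \<Longrightarrow> s c x = s' c x"
  shows "integral_over g cs s = integral_over g cs s'"
  unfolding integral_over_def
proof (intro sum.cong refl)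
  fix i assume "i \<in> {..<length cs}"
  then have "cs ! i \<in> A" using assms(1) by auto
  then show "set_lebesgue_integral lborel (chart_map (cs ! i) ` (chart_dom (cs ! i) - (\<Union>j<i. chart_dom (cs ! j))))
      (\<lambda>x. s (cs ! i) x * sqrt (det (g (cs ! i) x))) =
    set_lebesgue_integral lborel (chart_map (cs ! i) ` (chart_dom (cs ! i) - (\<Union>j<i. chart_dom (cs ! j))))
      (\<lambda>x. s' (cs ! i) x * sqrt (det (g (cs ! i) x)))"
    unfolding set_lebesgue_integral_def
    by (intro Bochner_Integration.integral_cong refl)
      (auto simp: indicator_def assms(2) chart_map_img)
qed

lemma integral_over_minus: "integral_over g cs (\<lambda>c x. - s c x) = - integral_over g cs s"
  unfolding integral_over_def set_lebesgue_integral_def by (simp add: sum_negf)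

lemma integral_over_nonneg:
  assumes "set cs \<subseteq> A" "\<And>c x. c \<in> A \<Longrightarrow> x \<in> chart_img c \<Longrightarrow> 0 \<le> s c x"
  shows "0 \<le> integral_over g cs s"
  unfolding integral_over_def set_lebesgue_integral_def
proof (intro sum_nonneg integral_nonneg_AE AE_I2)
  fix i x assume "i \<in> {..<length cs}"
  then have i: "cs ! i \<in> A" using assms(1) by auto
  show "0 \<le> indicat_real (chart_map (cs ! i) ` (chart_dom (cs ! i) - (\<Union>j<i. chart_dom (cs ! j)))) x *\<^sub>R
      (s (cs ! i) x * sqrt (det (g (cs ! i) x)))"
    using assms(2)[OF i] posdef_inv(5)[OF metric_posdef[OF i]] chart_map_img[OF i]
    by (auto simp: indicator_def less_imp_le intro!: mult_nonneg_nonneg)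
qed

text \<open>All pieces of the integral are non-negative, so each is zero. With \<open>c\<close> at
  the head of the cover, one of them is the integral over the entire image of \<open>c\<close>,
  where continuity forces the integrand to vanish.\<close>

lemma integral_over_zero:
  assumes s: "scalar s" and nn: "\<And>c x. c \<in> A \<Longrightarrow> x \<in> chart_img c \<Longrightarrow> 0 \<le> s c x"
    and z: "\<And>cs. chart_cover A cs \<Longrightarrow> integral_over g cs s = 0"
    and c: "c \<in> A" and x: "x \<in> chart_img c"
  shows "s c x = 0"
proof -
  obtain cs where cs: "chart_cover A (c # cs)" using chart_cover_exists[OF c] by blast
  define t where "t i = set_lebesgue_integral lborel
       (chart_map ((c # cs) ! i) ` (chart_dom ((c # cs) ! i) - (\<Union>j<i. chart_dom ((c # cs) ! j))))
       (\<lambda>x. s ((c # cs) ! i) x * sqrt (det (g ((c # cs) ! i) x)))" for i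
  have "\<forall>i\<in>{..<length (c # cs)}. t i = 0"
  proof (subst sum_nonneg_eq_0_iff[symmetric])
    show "sum t {..<length (c # cs)} = 0" using z[OF cs] unfolding integral_over_def t_def .
    fix i assume "i \<in> {..<length (c # cs)}"
    then have i: "(c # cs) ! i \<in> A" using cs nth_mem[of i "c # cs"] unfolding chart_cover_def by blast
    show "0 \<le> t i" unfolding t_def set_lebesgue_integral_def
      using nn[OF i] posdef_inv(5)[OF metric_posdef[OF i]] chart_map_img[OF i]
      by (intro integral_nonneg_AE AE_I2) (auto simp: indicator_def less_imp_le intro!: mult_nonneg_nonneg)
  qed simp
  then have "t 0 = 0" by blast
  then have "set_lebesgue_integral lborel (chart_img c) (\<lambda>x. s c x * sqrt (det (g c x))) = 0"
    by (simp add: t_def chart_img_def)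
  moreover have "continuous_on (chart_img c) (\<lambda>x. s c x * sqrt (det (g c x)))"
    using s c smooth_on_continuous[OF sqrt_det_smooth[OF c]] by (auto simp: scalar_def intro!: continuous_on_mult)
  ultimately have "s c x * sqrt (det (g c x)) = 0"
    using continuous_nonneg_integral_0[OF chart_open(2)[OF c] _ _ scalar_integrable[OF s c] _ x]
      nn[OF c] posdef_inv(5)[OF metric_posdef[OF c]] by (simp add: less_imp_le)
  then show ?thesis using posdef_inv(5)[OF metric_posdef[OF c x]] by simp
qed

end

section \<open>Harmonic forms are closed and weakly coclosed\<close>

lemma pull3_component:
  "pull3 J b $ i $ j $ k = (\<Sum>p\<in>UNIV. \<Sum>q\<in>UNIV. \<Sum>r\<in>UNIV. J $ p $ i * J $ q $ j * J $ r $ k * b $ p $ q $ r)"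
proof -
  have "pull3 J b $ i $ j $ k = (\<Sum>p\<in>UNIV. J $ p $ i * (transpose J ** b $ p ** J) $ j $ k)"
    by (simp add: pull3_def)
  also have "\<dots> = (\<Sum>p\<in>UNIV. \<Sum>q\<in>UNIV. \<Sum>r\<in>UNIV. J $ p $ i * J $ q $ j * J $ r $ k * b $ p $ q $ r)"
    unfolding matrix_mult3 by (simp add: transpose_def sum_distrib_left mult_ac)
  finally show ?thesis .
qed

text \<open>The product rule gives a tensorial part \<open>Z\<close> and terms with second
  derivatives of \<tau>. The latter are symmetric in two indices and cancel in the cyclic sum
  defining \<open>d2\<close>; the cyclic sum of \<open>Z\<close> is the pullback of the
  3-form.\<close>

lemma d2_pullback:
  fixes \<phi> \<psi> :: "real^4 \<Rightarrow> real^4^4" and \<tau> :: "real^4 \<Rightarrow> real^4"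
  assumes U: "open U" "x \<in> U"
    and \<tau>: "\<And>a. smooth_on U (\<lambda>y. \<tau> y $ a)"
    and \<psi>: "\<And>b d. (\<lambda>y. \<psi> y $ b $ d) differentiable (at (\<tau> x))"
    and skew: "\<And>b d. \<psi> (\<tau> x) $ b $ d = - \<psi> (\<tau> x) $ d $ b"
    and J: "\<And>y. J y = (\<chi> k i. partial i (\<lambda>y. \<tau> y $ k) y)"
    and \<phi>: "\<And>y. y \<in> U \<Longrightarrow> \<phi> y = transpose (J y) ** \<psi> (\<tau> y) ** J y"
  shows "d2 \<phi> x = pull3 (J x) (d2 \<psi> (\<tau> x))"
proof -
  define j where "j b i = J x $ b $ i" for b i
  define H where "H b p i = partial p (\<lambda>y. J y $ b $ i) x" for b p i
  define P where "P a b d = partial a (\<lambda>y. \<psi> y $ b $ d) (\<tau> x)" for a b d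
  define Q where "Q b d = \<psi> (\<tau> x) $ b $ d" for b d
  \<comment> \<open>\<open>X\<close> collects the terms in which the first Jacobian factor is
    differentiated; it is symmetric in its first two indices.\<close>
  define X where "X p i k = (\<Sum>b\<in>UNIV. \<Sum>d\<in>UNIV. H b p i * Q b d * j d k)" for p i k
  define Z where "Z p i k = (\<Sum>a\<in>UNIV. \<Sum>b\<in>UNIV. \<Sum>d\<in>UNIV. j a p * j b i * j d k * P a b d)" for p i k
  have Jc: "(\<lambda>y. J y $ b $ i) = partial i (\<lambda>y. \<tau> y $ b)" for b i by (simp add: J)
  have dJ: "(\<lambda>y. J y $ b $ i) differentiable (at x)" for b i
    unfolding Jc using smooth_on_differentiable[OF smooth_on_partial[OF \<tau>] U(2)] .
  have d\<tau>: "(\<lambda>y. \<tau> y $ a) differentiable (at x)" for a using smooth_on_differentiable[OF \<tau> U(2)] .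
  have dq: "(\<lambda>y. \<psi> (\<tau> y) $ b $ d) differentiable (at x)" for b d
    using partial_compose(1)[OF d\<tau> \<psi>] .
  have pq: "partial p (\<lambda>y. \<psi> (\<tau> y) $ b $ d) x = (\<Sum>a\<in>UNIV. P a b d * j a p)" for p b d
    using partial_compose(2)[OF d\<tau> \<psi>] by (simp add: P_def j_def J)
  have Hs: "H b p i = H b i p" for b p i
    unfolding H_def Jc using smooth_partial_commute[OF U(1) \<tau> U(2)] .
  then have Xs: "X p i k = X i p k" for p i k unfolding X_def by simp
  have "partial p (\<lambda>y. \<phi> y $ i $ k) x = X p i k - X p k i + Z p i k" for p i k
  proof -
    have "partial p (\<lambda>y. \<phi> y $ i $ k) x =
        partial p (\<lambda>y. \<Sum>b\<in>UNIV. \<Sum>d\<in>UNIV. J y $ b $ i * \<psi> (\<tau> y) $ b $ d * J y $ d $ k) x"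
      by (rule partial_cong_open[OF U]) (simp add: \<phi> matrix_mult3, simp add: transpose_def)
    also have "\<dots> = (\<Sum>b\<in>UNIV. \<Sum>d\<in>UNIV. partial p (\<lambda>y. J y $ b $ i * \<psi> (\<tau> y) $ b $ d * J y $ d $ k) x)"
      by (intro partial_sum2 differentiable_mult dJ dq)
    also have "\<dots> = (\<Sum>b\<in>UNIV. \<Sum>d\<in>UNIV. H b p i * Q b d * j d k + j b i * Q b d * H d p k
        + (\<Sum>a\<in>UNIV. j a p * j b i * j d k * P a b d))"
    proof (intro sum.cong refl)
      fix b d
      have "partial p (\<lambda>y. J y $ b $ i * \<psi> (\<tau> y) $ b $ d * J y $ d $ k) x =
        (H b p i * Q b d + j b i * (\<Sum>a\<in>UNIV. P a b d * j a p)) * j d k + j b i * Q b d * H d p k"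
        by (simp only: partial_mult[OF differentiable_mult[OF dJ dq] dJ] partial_mult[OF dJ dq] pq
            flip: H_def Q_def j_def)
      then show "partial p (\<lambda>y. J y $ b $ i * \<psi> (\<tau> y) $ b $ d * J y $ d $ k) x =
        H b p i * Q b d * j d k + j b i * Q b d * H d p k + (\<Sum>a\<in>UNIV. j a p * j b i * j d k * P a b d)"
        by (simp add: algebra_simps sum_distrib_left sum_distrib_right)
    qed
    also have "\<dots> = X p i k + (\<Sum>b\<in>UNIV. \<Sum>d\<in>UNIV. j b i * Q b d * H d p k)
        + (\<Sum>b\<in>UNIV. \<Sum>d\<in>UNIV. \<Sum>a\<in>UNIV. j a p * j b i * j d k * P a b d)"
      unfolding X_def by (simp add: sum.distrib)
    also have "(\<Sum>b\<in>UNIV. \<Sum>d\<in>UNIV. \<Sum>a\<in>UNIV. j a p * j b i * j d k * P a b d) = Z p i k"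
      unfolding Z_def by (rule sum_pull2)
    \<comment> \<open>Skewness of \<psi> turns the terms with the second Jacobian factor
      differentiated into the first kind, with \<open>i\<close> and \<open>k\<close> exchanged and
      the opposite sign.\<close>
    also have "(\<Sum>b\<in>UNIV. \<Sum>d\<in>UNIV. j b i * Q b d * H d p k) = - X p k i"
    proof -
      have Qs: "j b i * Q b d * H d p k = - (H d p k * Q d b * j b i)" for b d
        using skew[of b d] by (simp add: Q_def)
      show ?thesis unfolding X_def Qs sum_negf by (rule arg_cong[OF sum.swap])
    qed
    finally show ?thesis by simp
  qed
  then have "d2 \<phi> x $ p $ i $ k = Z p i k + Z i k p + Z k p i" for p i k
    unfolding d2_def using Xs[of p i k] Xs[of p k i] Xs[of i k p] by simp
  moreover have "pull3 (J x) (d2 \<psi> (\<tau> x)) $ p $ i $ k = Z p i k + Z i k p + Z k p i" for p i k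
  proof -
    have "pull3 (J x) (d2 \<psi> (\<tau> x)) $ p $ i $ k = Z p i k
      + (\<Sum>a\<in>UNIV. \<Sum>b\<in>UNIV. \<Sum>d\<in>UNIV. j b i * j d k * j a p * P b d a)
      + (\<Sum>a\<in>UNIV. \<Sum>b\<in>UNIV. \<Sum>d\<in>UNIV. j d k * j a p * j b i * P d a b)"
      unfolding pull3_component d2_def Z_def j_def[symmetric]
      by (simp add: P_def algebra_simps sum.distrib)
    also have "(\<Sum>a\<in>UNIV. \<Sum>b\<in>UNIV. \<Sum>d\<in>UNIV. j b i * j d k * j a p * P b d a) = Z i k p"
      unfolding Z_def by (rule sum_pull2[symmetric])
    also have "(\<Sum>a\<in>UNIV. \<Sum>b\<in>UNIV. \<Sum>d\<in>UNIV. j d k * j a p * j b i * P d a b) = Z k p i"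
      unfolding Z_def by (rule sum_pull2)
    finally show ?thesis .
  qed
  ultimately show ?thesis by (simp add: vec_eq_iff)
qed

lemma inner2_commute:
  assumes "posdef G"
  shows "inner2 G a b = inner2 G b a"
proof -
  obtain e where "orthonormal_basis G e" using exists_orthonormal_basis[OF assms] by blast
  then show ?thesis by (simp add: inner2_orthonormal mult.commute)
qed

lemma inner2_minus_left: "inner2 G (- a) b = - inner2 G a b"
  unfolding inner2_def by (simp add: sum_negf)

context oriented_riemannian
begin

lemma form2_smooth: "form2 A \<phi> \<Longrightarrow> c \<in> A \<Longrightarrow> smooth_on (chart_img c) (\<lambda>x. \<phi> c x $ i $ j)"
  by (simp add: form2_def tensor2_def)

lemma form2_skew:
  assumes "form2 A \<phi>" "c \<in> A" "x \<in> chart_img c"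
  shows "transpose (\<phi> c x) = - \<phi> c x"
  using assms(1)[unfolded form2_def, THEN conjunct2] assms(2,3) by blast

lemma form2_skew_component:
  assumes "form2 A \<phi>" "c \<in> A" "x \<in> chart_img c"
  shows "\<phi> c x $ i $ j = - \<phi> c x $ j $ i"
  using arg_cong[OF form2_skew[OF assms], of "\<lambda>m. m $ j $ i"] by (simp add: transpose_def)

lemma form2_transform:
  assumes "form2 A \<phi>" "c \<in> A" "c' \<in> A" "x \<in> overlap c c'"
  shows "\<phi> c x = transpose (jacobian c c' x) ** \<phi> c' (transition c c' x) ** jacobian c c' x"
proof -
  have "\<forall>c\<in>A. \<forall>c'\<in>A. \<forall>x\<in>overlap c c'.
      \<phi> c x = transpose (jacobian c c' x) ** \<phi> c' (transition c c' x) ** jacobian c c' x"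
    using assms(1)[unfolded form2_def tensor2_def, THEN conjunct1] by (rule conjunct2)
  from bspec[OF bspec[OF bspec[OF this assms(2)] assms(3)] assms(4)] show ?thesis .
qed

lemma d2_transform:
  assumes "form2 A \<phi>" "c \<in> A" "c' \<in> A" "x \<in> overlap c c'"
  shows "d2 (\<phi> c) x = pull3 (jacobian c c' x) (d2 (\<phi> c') (transition c c' x))"
proof (rule d2_pullback[OF overlap_open[OF assms(2,3)] assms(4) transition_smooth[OF assms(2,3)]])
  note y = transition_overlap(4)[OF assms(2,3,4)]
  show "(\<lambda>y. \<phi> c' y $ b $ d) differentiable (at (transition c c' x))" for b d
    using smooth_on_differentiable[OF form2_smooth[OF assms(1,3)] y] .
  show "\<phi> c' (transition c c' x) $ b $ d = - \<phi> c' (transition c c' x) $ d $ b" for b d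
    by (rule form2_skew_component[OF assms(1,3) y])
  show "jacobian c c' y = (\<chi> k i. partial i (\<lambda>y. transition c c' y $ k) y)" for y
    by (simp add: jacobian_def)
  show "\<phi> c y = transpose (jacobian c c' y) ** \<phi> c' (transition c c' y) ** jacobian c c' y"
    if "y \<in> overlap c c'" for y
    by (rule form2_transform[OF assms(1-3) that])
qed

lemma d2_smooth:
  assumes "form2 A \<phi>" "c \<in> A"
  shows "smooth_on (chart_img c) (\<lambda>x. d2 (\<phi> c) x $ i $ j $ k)"
  unfolding d2_def by (simp, intro smooth_intros chart_open form2_smooth assms)

lemma scalar_norm_d2:
  assumes "form2 A \<phi>"
  shows "scalar (\<lambda>c x. inner3 (g c x) (d2 (\<phi> c) x) (d2 (\<phi> c) x))"
  unfolding scalar_def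
proof (intro conjI ballI)
  fix c assume c: "c \<in> A"
  show "continuous_on (chart_img c) (\<lambda>x. inner3 (g c x) (d2 (\<phi> c) x) (d2 (\<phi> c) x))"
    unfolding inner3_def
    by (intro continuous_intros smooth_on_continuous[OF inv_smooth[OF c]] smooth_on_continuous[OF d2_smooth[OF assms c]])
  fix c' x assume c': "c' \<in> A" and x: "x \<in> overlap c c'"
  show "inner3 (g c x) (d2 (\<phi> c) x) (d2 (\<phi> c) x) =
      inner3 (g c' (transition c c' x)) (d2 (\<phi> c') (transition c c' x)) (d2 (\<phi> c') (transition c c' x))"
    using metric_posdef[OF c] overlap_subset x inner3_invariant
    unfolding metric_transform[OF c c' x] d2_transform[OF assms c c' x]
    by (metis metric_transform[OF c c' x] subsetD)
qed

lemma form1_smooth: "form1 A \<alpha> \<Longrightarrow> c \<in> A \<Longrightarrow> smooth_on (chart_img c) (\<lambda>x. \<alpha> c x $ i)"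
  by (simp add: form1_def)

lemma form1_transform:
  assumes "form1 A \<alpha>" "c \<in> A" "c' \<in> A" "x \<in> overlap c c'"
  shows "\<alpha> c x = transpose (jacobian c c' x) *v \<alpha> c' (transition c c' x)"
  using bspec[OF bspec[OF bspec[OF assms(1)[unfolded form1_def, THEN conjunct2] assms(2)] assms(3)] assms(4)] .

lemma scalar_norm_form1:
  assumes "form1 A \<alpha>"
  shows "scalar (\<lambda>c x. inner1 (g c x) (\<alpha> c x) (\<alpha> c x))"
  unfolding scalar_def
proof (intro conjI ballI)
  fix c assume c: "c \<in> A"
  show "continuous_on (chart_img c) (\<lambda>x. inner1 (g c x) (\<alpha> c x) (\<alpha> c x))"
    unfolding inner1_def
    by (intro continuous_intros smooth_on_continuous[OF inv_smooth[OF c]] smooth_on_continuous[OF form1_smooth[OF assms c]])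
  fix c' x assume c': "c' \<in> A" and x: "x \<in> overlap c c'"
  show "inner1 (g c x) (\<alpha> c x) (\<alpha> c x) =
      inner1 (g c' (transition c c' x)) (\<alpha> c' (transition c c' x)) (\<alpha> c' (transition c c' x))"
    using metric_posdef[OF c] overlap_subset x inner1_invariant
    unfolding metric_transform[OF c c' x] form1_transform[OF assms c c' x]
    by (metis metric_transform[OF c c' x] subsetD)
qed

text \<open>Pairing \<open>(d\<delta> + \<delta>d)\<phi> = 0\<close> with \<open>\<phi>\<close> gives \<open>\<parallel>\<delta>\<phi>\<parallel>\<^sup>2 + \<parallel>d\<phi>\<parallel>\<^sup>2 = 0\<close>.\<close>

lemma harmonic_closed_coclosed:
  assumes "harmonic_form2 A g \<phi>"
  shows "\<And>c x. c \<in> A \<Longrightarrow> x \<in> chart_img c \<Longrightarrow> d2 (\<phi> c) x = 0"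
    and "\<And>\<alpha> cs. form1 A \<alpha> \<Longrightarrow> chart_cover A cs \<Longrightarrow>
      integral_over g cs (\<lambda>c x. inner2 (g c x) (d1 (\<alpha> c) x) (\<phi> c x)) = 0"
proof -
  obtain \<eta> \<zeta> where \<phi>: "form2 A \<phi>" and \<eta>: "codifferential2 A g \<phi> \<eta>"
    and \<zeta>: "codifferential3 A g (\<lambda>c. d2 (\<phi> c)) \<zeta>"
    and eq: "\<And>c x. c \<in> A \<Longrightarrow> x \<in> chart_img c \<Longrightarrow> d1 (\<eta> c) x + \<zeta> c x = 0"
    using assms unfolding harmonic_form2_def by blast
  have f\<eta>: "form1 A \<eta>" using \<eta> unfolding codifferential2_def by (rule conjunct1)
  have zero: "integral_over g cs (\<lambda>c x. inner1 (g c x) (\<eta> c x) (\<eta> c x)) = 0 \<and>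
      integral_over g cs (\<lambda>c x. inner3 (g c x) (d2 (\<phi> c) x) (d2 (\<phi> c) x)) = 0" if cs: "chart_cover A cs" for cs
  proof -
    have sub: "set cs \<subseteq> A" using cs unfolding chart_cover_def by blast
    \<comment> \<open>The two adjointness relations are tested on \<eta> and on \<phi>. The harmonic
      equation makes the resulting squared norms opposite to each other, so both are zero.\<close>
    have "integral_over g cs (\<lambda>c x. inner2 (g c x) (\<phi> c x) (\<zeta> c x)) =
        integral_over g cs (\<lambda>c x. - inner2 (g c x) (d1 (\<eta> c) x) (\<phi> c x))"
    proof (rule integral_over_cong[OF sub])
      fix c x assume c: "c \<in> A" "x \<in> chart_img c"
      have "\<zeta> c x = - d1 (\<eta> c) x" using eq[OF c] by (simp add: eq_neg_iff_add_eq_0 add.commute)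
      then show "inner2 (g c x) (\<phi> c x) (\<zeta> c x) = - inner2 (g c x) (d1 (\<eta> c) x) (\<phi> c x)"
        using inner2_commute[OF metric_posdef[OF c]] inner2_minus_left by metis
    qed
    moreover have "integral_over g cs (\<lambda>c x. inner3 (g c x) (d2 (\<phi> c) x) (d2 (\<phi> c) x)) =
        integral_over g cs (\<lambda>c x. inner2 (g c x) (\<phi> c x) (\<zeta> c x))"
      using \<zeta> \<phi> cs unfolding codifferential3_def by blast
    moreover have "integral_over g cs (\<lambda>c x. inner2 (g c x) (d1 (\<eta> c) x) (\<phi> c x)) =
        integral_over g cs (\<lambda>c x. inner1 (g c x) (\<eta> c x) (\<eta> c x))"
      using \<eta> f\<eta> cs unfolding codifferential2_def by blast
    moreover have "integral_over g cs (\<lambda>c x. inner1 (g c x) (\<eta> c x) (\<eta> c x)) \<ge> 0"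
      by (rule integral_over_nonneg[OF sub inner_nonneg(1)[OF metric_posdef]])
    moreover have "integral_over g cs (\<lambda>c x. inner3 (g c x) (d2 (\<phi> c) x) (d2 (\<phi> c) x)) \<ge> 0"
      by (rule integral_over_nonneg[OF sub inner_nonneg(2)[OF metric_posdef]])
    ultimately show ?thesis unfolding integral_over_minus by linarith
  qed
  show "d2 (\<phi> c) x = 0" if "c \<in> A" "x \<in> chart_img c" for c x
    by (rule inner3_zero[OF metric_posdef[OF that]],
        rule integral_over_zero[OF scalar_norm_d2[OF \<phi>] inner_nonneg(2)[OF metric_posdef] _ that])
      (use zero in blast)+
  have \<eta>0: "\<eta> c x = 0" if "c \<in> A" "x \<in> chart_img c" for c x
    by (rule inner1_zero[OF metric_posdef[OF that]],
        rule integral_over_zero[OF scalar_norm_form1[OF f\<eta>] inner_nonneg(1)[OF metric_posdef] _ that])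
      (use zero in blast)+
  \<comment> \<open>With \<eta> = 0, adjointness makes \<phi> orthogonal to every exact 2-form;
    \<open>coclosed\<close> below turns this into a pointwise statement.\<close>
  fix \<alpha> cs assume \<alpha>: "form1 A \<alpha>" and cs: "chart_cover A cs"
  have "integral_over g cs (\<lambda>c x. inner2 (g c x) (d1 (\<alpha> c) x) (\<phi> c x)) =
      integral_over g cs (\<lambda>c x. inner1 (g c x) (\<alpha> c x) (\<eta> c x))"
    using \<eta> \<alpha> cs unfolding codifferential2_def by blast
  also have "\<dots> = integral_over g cs (\<lambda>c x. 0)"
    using cs by (intro integral_over_cong) (auto simp: chart_cover_def \<eta>0 inner1_def)
  also have "\<dots> = 0" by (simp add: integral_over_def set_lebesgue_integral_def)
  finally show "integral_over g cs (\<lambda>c x. inner2 (g c x) (d1 (\<alpha> c) x) (\<phi> c x)) = 0" .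
qed

end

section \<open>Test forms and the pointwise divergence\<close>

text \<open>The case n = 0 is the flat function exp(-1/t). The powers of 1/t are included because
  the span of the family is closed under differentiation, so smoothness follows by induction over
  all n at once.\<close>

definition bump_aux :: "nat \<Rightarrow> real \<Rightarrow> real" where
  "bump_aux n t = (if t > 0 then inverse t ^ n * exp (- inverse t) else 0)"

text \<open>Substituting s = 1/t turns the right difference quotient into s^(n+1) / exp s, which
  tends to 0 as s tends to infinity; the left one is identically 0.\<close>

lemma bump_aux_at_0: "(bump_aux n has_real_derivative 0) (at 0)"
proof -
  have "((\<lambda>s. s ^ Suc n / exp s) \<longlongrightarrow> (0::real)) at_top" by (rule tendsto_power_div_exp_0)
  from filterlim_compose[OF this filterlim_inverse_at_top_right]
  have "((\<lambda>t. inverse t ^ Suc n / exp (inverse t)) \<longlongrightarrow> (0::real)) (at_right 0)" .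
  moreover have "\<forall>\<^sub>F t in at_right 0. inverse t ^ Suc n / exp (inverse t) = bump_aux n t / (t::real)"
    unfolding eventually_at_right_field
    by (rule exI[of _ 1]) (auto simp: bump_aux_def exp_minus divide_inverse mult_ac)
  ultimately have r: "((\<lambda>t. bump_aux n t / t) \<longlongrightarrow> 0) (at_right 0)"
    by (rule Lim_transform_eventually)
  have "\<forall>\<^sub>F t in at_left 0. 0 = bump_aux n t / (t::real)"
    unfolding eventually_at_left_field by (rule exI[of _ "-1"]) (auto simp: bump_aux_def)
  then have l: "((\<lambda>t. bump_aux n t / t) \<longlongrightarrow> 0) (at_left 0)"
    by (rule Lim_transform_eventually[OF tendsto_const])
  show ?thesis
    unfolding has_field_derivative_iff using filterlim_split_at[OF l r] by (simp add: bump_aux_def)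
qed

lemma bump_aux_derivative:
  "(bump_aux n has_real_derivative (bump_aux (n + 2) t - real n * bump_aux (n + 1) t)) (at t)"
proof (cases t "0::real" rule: linorder_cases)
  case equal
  then show ?thesis using bump_aux_at_0[of n] by (simp add: bump_aux_def)
next
  case less
  have "((\<lambda>t. 0) has_real_derivative 0) (at t)" by simp
  then have "(bump_aux n has_real_derivative 0) (at t)"
    by (rule has_field_derivative_transform_within_open[of _ _ _ "{..<0}"])
      (use less in \<open>auto simp: bump_aux_def\<close>)
  then show ?thesis using less by (simp add: bump_aux_def)
next
  case greater
  have "((\<lambda>t. inverse t ^ n * exp (- inverse t)) has_real_derivative
      (real n * inverse t ^ (n - 1) * (- (inverse t ^ 2)) * exp (- inverse t)
       + inverse t ^ n * (exp (- inverse t) * inverse t ^ 2))) (at t)"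
    using greater by (auto intro!: derivative_eq_intros simp: power2_eq_square mult_ac)
  \<comment> \<open>For n = 0 the exponent \<open>n - 1\<close> is truncated, but its coefficient
    \<open>real n\<close> is then 0; this is the reason for the case distinction on
    \<open>n\<close>.\<close>
  moreover have "real n * inverse t ^ (n - 1) * (- (inverse t ^ 2)) * exp (- inverse t)
       + inverse t ^ n * (exp (- inverse t) * inverse t ^ 2)
      = inverse t ^ (n + 2) * exp (- inverse t) - real n * (inverse t ^ (n + 1) * exp (- inverse t))"
    by (cases n) (simp_all add: power2_eq_square algebra_simps)
  ultimately have "((\<lambda>t. inverse t ^ n * exp (- inverse t)) has_real_derivative
      (inverse t ^ (n + 2) * exp (- inverse t) - real n * (inverse t ^ (n + 1) * exp (- inverse t)))) (at t)"
    by simp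
  then have "(bump_aux n has_real_derivative
      (inverse t ^ (n + 2) * exp (- inverse t) - real n * (inverse t ^ (n + 1) * exp (- inverse t)))) (at t)"
    by (rule has_field_derivative_transform_within_open[of _ _ _ "{0<..}"])
      (use greater in \<open>auto simp: bump_aux_def\<close>)
  then show ?thesis using greater by (simp add: bump_aux_def)
qed

lemma bump_aux_Ck:
  assumes q: "smooth_on UNIV q"
  shows "Ck_on k UNIV (\<lambda>x. bump_aux n (q x))"
proof (induction k arbitrary: n)
  case 0
  have "isCont (bump_aux n) t" for t using bump_aux_derivative DERIV_isCont by blast
  then have "continuous_on UNIV (bump_aux n)" by (simp add: continuous_on_eq_continuous_at)
  from continuous_on_compose2[OF this smooth_on_continuous[OF q]] show ?case by simp
next
  case (Suc k)
  have dq: "q differentiable (at x)" for x using smooth_on_differentiable[OF q] by simp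
  have pb: "partial i (\<lambda>x. bump_aux n (q x)) =
      (\<lambda>x. (bump_aux (n + 2) (q x) + (- real n) * bump_aux (n + 1) (q x)) * partial i q x)" for i
    by (rule ext) (simp add: partial_chain1[OF dq bump_aux_derivative])
  have "Ck_on k UNIV (partial i q)" for i
    using smooth_on_partial[OF q, of i] by (simp add: smooth_on_def)
  then have "Ck_on k UNIV (partial i (\<lambda>x. bump_aux n (q x)))" for i
    unfolding pb by (intro Ck_on_mult Ck_on_add Ck_on_const Suc.IH open_UNIV)
  moreover have "(\<lambda>x. bump_aux n (q x)) differentiable (at x)" for x
  proof -
    have "(q has_derivative frechet_derivative q (at x)) (at x)" using dq frechet_derivative_works by blast
    from has_derivative_compose[OF this bump_aux_derivative[unfolded has_field_derivative_def]]
    show ?thesis unfolding differentiable_def by blast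
  qed
  ultimately show ?case by simp
qed

text \<open>Squared radius minus squared distance is a polynomial, so the bump is smooth at its
  centre too; it is positive exactly where this polynomial is.\<close>

definition bump :: "real^4 \<Rightarrow> real \<Rightarrow> real^4 \<Rightarrow> real" where
  "bump a r x = bump_aux 0 (r * r - (\<Sum>i\<in>UNIV. (x $ i - a $ i) * (x $ i - a $ i)))"

lemma bump_smooth: "smooth_on UNIV (bump a r)"
proof -
  have "smooth_on UNIV (\<lambda>x. r * r - (\<Sum>i\<in>UNIV. (x $ i - a $ i) * (x $ i - a $ i)))"
    by (intro smooth_intros open_UNIV)
  from bump_aux_Ck[OF this] show ?thesis unfolding smooth_on_def bump_def[abs_def] by blast
qed

lemma bump_nonneg: "bump a r x \<ge> 0"
  and bump_center: "r > 0 \<Longrightarrow> bump a r a > 0"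
  by (simp_all add: bump_def bump_aux_def)

lemma bump_outside:
  assumes "r > 0" "x \<notin> cball a r"
  shows "bump a r x = 0"
proof -
  have "(\<Sum>i\<in>UNIV. (x $ i - a $ i) * (x $ i - a $ i)) = (norm (x - a))\<^sup>2"
    by (simp add: power2_norm_eq_inner inner_vec_def)
  moreover have "r\<^sup>2 < (norm (x - a))\<^sup>2"
    using assms by (intro power_strict_mono) (auto simp: dist_norm norm_minus_commute)
  ultimately show ?thesis by (simp add: bump_def bump_aux_def power2_eq_square)
qed

text \<open>The extended function is \<open>f\<close> on \<open>V\<close> and 0 on the complement of
  the closed ball. These two open sets cover the space, and smoothness is local.\<close>

lemma smooth_extend_zero:
  assumes "open V" "smooth_on V f" "cball a r \<subseteq> V" "\<And>x. x \<in> V \<Longrightarrow> x \<notin> cball a r \<Longrightarrow> f x = 0"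
  shows "smooth_on UNIV (\<lambda>x. if x \<in> V then f x else 0)"
proof -
  have "open (- cball a r)" by (rule open_Compl) simp
  have 1: "smooth_on V (\<lambda>x. if x \<in> V then f x else 0)"
    by (subst smooth_on_cong[OF assms(1), where g = f]) (simp_all add: assms(2))
  have 2: "smooth_on (- cball a r) (\<lambda>x. if x \<in> V then f x else 0)"
    by (subst smooth_on_cong[OF \<open>open (- cball a r)\<close>, where g = "\<lambda>x. 0"])
      (use assms(4) smooth_on_const in auto)
  have "V \<union> - cball a r = UNIV" using assms(3) by blast
  then show ?thesis using smooth_on_Un[OF assms(1) \<open>open (- cball a r)\<close> 1 2] by simp
qed

section \<open>Integrals of derivatives of compactly supported functions\<close>

lemma support_integrable:
  fixes f :: "real^4 \<Rightarrow> real"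
  assumes "continuous_on UNIV f" "\<And>x. x \<notin> cball a r \<Longrightarrow> f x = 0"
  shows "integrable lborel f"
proof -
  have "integrable lborel (\<lambda>x. indicator (cball a r) x *\<^sub>R f x)"
    by (rule borel_integrable_compact) (auto intro: continuous_on_subset[OF assms(1)])
  moreover have "(\<lambda>x. indicator (cball a r) x *\<^sub>R f x) = f"
  proof
    fix x show "indicator (cball a r) x *\<^sub>R f x = f x"
      using assms(2)[of x] by (cases "x \<in> cball a r") simp_all
  qed
  ultimately show ?thesis by simp
qed

text \<open>Differentiate the translation invariance of the integral.\<close>

lemma integral_partial_zero:
  assumes u: "smooth_on UNIV u" and supp: "\<And>x. x \<notin> cball a r \<Longrightarrow> u x = 0"
  shows "integrable lborel (partial i u)" "integral\<^sup>L lborel (partial i u) = 0"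
proof -
  have cont: "continuous_on UNIV u" "continuous_on UNIV (partial i u)"
    using smooth_on_continuous[OF u] smooth_on_continuous[OF smooth_on_partial[OF u]] by auto
  have d: "u differentiable (at x)" for x using smooth_on_differentiable[OF u] by simp
  have psupp: "partial i u x = 0" if "x \<notin> cball a r" for x
  proof -
    have "partial i u x = partial i (\<lambda>x. 0) x"
      by (rule partial_cong_open[of "- cball a r"]) (use that supp in auto)
    then show ?thesis by simp
  qed
  show "integrable lborel (partial i u)" by (rule support_integrable[OF cont(2) psupp])
  have iu: "integrable lborel u" by (rule support_integrable[OF cont(1) supp])
  obtain C where C: "\<And>x. \<bar>partial i u x\<bar> \<le> C"
  proof -
    have "compact (partial i u ` cball a r)"
      by (rule compact_continuous_image[OF continuous_on_subset[OF cont(2)]]) auto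
    then obtain B where B: "\<forall>y\<in>partial i u ` cball a r. norm y \<le> B"
      using compact_imp_bounded bounded_iff by blast
    have "\<bar>partial i u x\<bar> \<le> max B 0" for x
      using B psupp[of x] by (cases "x \<in> cball a r") (simp_all add: le_max_iff_disj)
    then show thesis by (rule that)
  qed
  \<comment> \<open>Steps of length at most 1 keep the support of every difference quotient in the
    ball of radius \<open>r + 1\<close>. There the mean value theorem bounds the quotient by
    \<open>C\<close>, which gives an integrable dominating function.\<close>
  define e :: "nat \<Rightarrow> real" where "e n = 1 / real (Suc n)" for n
  have e: "e n > 0" "e n \<le> 1" for n by (auto simp: e_def)
  define D where "D n x = (u (x + e n *\<^sub>R axis i 1) - u x) / e n" for n x
  have shift: "integrable lborel (\<lambda>x. u (x + v))" "(LINT x|lborel. u (x + v)) = integral\<^sup>L lborel u" for v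
  proof -
    have b: "u \<in> borel_measurable lborel" using borel_measurable_integrable[OF iu] .
    have m: "(\<lambda>x. v + x) \<in> measurable lborel borel" by simp
    have dl: "distr lborel borel (\<lambda>x. v + x) = (lborel :: (real^4) measure)"
      using lborel_distr_plus[of v] by simp
    show "integrable lborel (\<lambda>x. u (x + v))"
      using integrable_distr_eq[OF m, of u] b iu unfolding dl by (simp add: add.commute)
    show "(LINT x|lborel. u (x + v)) = integral\<^sup>L lborel u"
      using integral_distr[OF m, of u] b unfolding dl by (simp add: add.commute)
  qed
  have iD: "integral\<^sup>L lborel (D n) = 0" for n
    unfolding D_def using shift iu by simp
  have bound: "\<bar>D n x\<bar> \<le> indicator (cball a (r + 1)) x *\<^sub>R C" for n x
  proof (cases "x \<in> cball a (r + 1)")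
    case True
    have "((\<lambda>t. u (x + t *\<^sub>R axis i 1)) has_real_derivative partial i u (x + t *\<^sub>R axis i 1)) (at t)" for t
      by (rule line_has_derivative[OF d])
    then obtain t where "u (x + e n *\<^sub>R axis i 1) - u (x + 0 *\<^sub>R axis i 1) = (e n - 0) * partial i u (x + t *\<^sub>R axis i 1)"
      using MVT2[OF e(1), of n "\<lambda>t. u (x + t *\<^sub>R axis i 1)" "\<lambda>t. partial i u (x + t *\<^sub>R axis i 1)"] by blast
    then have "D n x = partial i u (x + t *\<^sub>R axis i 1)" using e(1)[of n] by (simp add: D_def)
    then show ?thesis using C True by simp
  next
    case False
    then have f: "dist a x > r + 1" by simp
    have "dist a x \<le> dist a (x + e n *\<^sub>R axis i 1) + e n"
      using dist_triangle[of a x "x + e n *\<^sub>R axis i 1"] e(1)[of n] by (simp add: dist_norm norm_axis_1)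
    then have "x + e n *\<^sub>R axis i 1 \<notin> cball a r" "x \<notin> cball a r" using f e(2)[of n] by auto
    then have "D n x = 0" using supp by (simp add: D_def)
    then show ?thesis using False by simp
  qed
  have lim: "(\<lambda>n. D n x) \<longlonglongrightarrow> partial i u x" for x
  proof -
    have "((\<lambda>t. u (x + t *\<^sub>R axis i 1)) has_real_derivative partial i u (x + 0 *\<^sub>R axis i 1)) (at 0)"
      by (rule line_has_derivative[OF d])
    then have "((\<lambda>t. (u (x + t *\<^sub>R axis i 1) - u x) / t) \<longlongrightarrow> partial i u x) (at 0)"
      by (simp add: has_field_derivative_iff)
    moreover have "filterlim e (at 0) sequentially"
      unfolding filterlim_at e_def using lim_1_over_n LIMSEQ_Suc[of "\<lambda>n. 1 / real n" 0] by simp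
    ultimately show ?thesis unfolding D_def by (rule filterlim_compose)
  qed
  have "(\<lambda>n. integral\<^sup>L lborel (D n)) \<longlonglongrightarrow> integral\<^sup>L lborel (partial i u)"
  proof (rule integral_dominated_convergence)
    show "partial i u \<in> borel_measurable lborel"
      using borel_measurable_continuous_onI[OF cont(2)] by simp
    show "D n \<in> borel_measurable lborel" for n
      using borel_measurable_integrable[OF shift(1)] borel_measurable_integrable[OF iu]
      unfolding D_def by (intro borel_measurable_divide borel_measurable_diff) auto
    show "integrable lborel (\<lambda>x. indicator (cball a (r + 1)) x *\<^sub>R C)"
      by (rule borel_integrable_compact) auto
    show "AE x in lborel. (\<lambda>n. D n x) \<longlonglongrightarrow> partial i u x" using lim by simp
    show "AE x in lborel. norm (D n x) \<le> indicator (cball a (r + 1)) x *\<^sub>R C" for n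
      using bound by simp
  qed
  then have "(\<lambda>n. 0) \<longlonglongrightarrow> integral\<^sup>L lborel (partial i u)" unfolding iD .
  then show "integral\<^sup>L lborel (partial i u) = 0" by (simp add: LIMSEQ_const_iff)
qed

text \<open>\<open>\<delta>\<psi> = 0\<close> says that this density has vanishing coordinate divergence.\<close>

definition raised :: "(real^4 \<Rightarrow> real^4^4) \<Rightarrow> (real^4 \<Rightarrow> real^4^4) \<Rightarrow> real^4 \<Rightarrow> real^4^4" where
  "raised g \<psi> y = sqrt (det (g y)) *\<^sub>R (matrix_inv (g y) ** \<psi> y ** matrix_inv (g y))"

section \<open>Test 1-forms supported in one chart\<close>

context oriented_riemannian
begin

text \<open>The 1-form bump times dx^m of the chart \<open>c\<close>, written in the coordinates of
  \<open>c'\<close> and extended by zero.\<close>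

definition test_form :: "'a chart \<Rightarrow> real^4 \<Rightarrow> real \<Rightarrow> 4 \<Rightarrow> 'a chart \<Rightarrow> real^4 \<Rightarrow> real^4" where
  "test_form c a r m c' x = (if x \<in> overlap c' c
     then bump a r (transition c' c x) *\<^sub>R (transpose (jacobian c' c x) *v axis m 1) else 0)"

lemma test_form_outside:
  assumes "c \<in> A" "c' \<in> A" "r > 0" "x \<in> chart_img c'" "chart_inv c' x \<notin> chart_inv c ` cball a r"
  shows "test_form c a r m c' x = 0"
proof (cases "x \<in> overlap c' c")
  case True
  then have "transition c' c x \<notin> cball a r"
    using transition_overlap(3)[OF assms(2,1)] assms(5) by (metis imageI)
  then show ?thesis using bump_outside[OF assms(3)] by (simp add: test_form_def)
qed (simp add: test_form_def)

text \<open>The image of the closed ball in the manifold is compact, hence closed because the space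
  is Hausdorff. So the points off the support form an open set, and the extension by zero cannot
  lose smoothness at the edge of the chart domain.\<close>

lemma outside_open:
  assumes "c \<in> A" "c' \<in> A" "cball a r \<subseteq> chart_img c"
  shows "open {x \<in> chart_img c'. chart_inv c' x \<notin> chart_inv c ` cball a r}"
proof -
  have "continuous_on (cball a r) (chart_inv c)"
    by (rule continuous_on_subset[OF homeomorphism_cont2[OF chart_homeo[OF assms(1)]] assms(3)])
  then have "closed (chart_inv c ` cball a r)"
    by (rule compact_imp_closed[OF compact_continuous_image]) (rule compact_cball)
  from chart_image_open[OF assms(2) open_Compl[OF this]]
  have "open (chart_map c' ` (chart_dom c' \<inter> - chart_inv c ` cball a r))" .
  moreover have "chart_map c' ` (chart_dom c' \<inter> - chart_inv c ` cball a r) =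
      {x \<in> chart_img c'. chart_inv c' x \<notin> chart_inv c ` cball a r}" (is "?L = ?R")
  proof
    show "?L \<subseteq> ?R" using chart_inv_map[OF assms(2)] chart_map_img[OF assms(2)] by auto
    show "?R \<subseteq> ?L"
    proof
      fix x assume "x \<in> ?R"
      then have "x = chart_map c' (chart_inv c' x)" "chart_inv c' x \<in> chart_dom c' \<inter> - chart_inv c ` cball a r"
        using chart_map_inv[OF assms(2)] chart_inv_dom[OF assms(2)] by auto
      then show "x \<in> ?L" by (rule image_eqI)
    qed
  qed
  ultimately show ?thesis by simp
qed

text \<open>Each chart image is covered by the overlap with \<open>c\<close>, where the explicit
  formula is smooth, and the open set off the support, where the form is 0. The transformation law
  is the cocycle rule for Jacobians.\<close>

lemma test_form_form1:
  assumes c: "c \<in> A" and r: "r > 0" and sub: "cball a r \<subseteq> chart_img c"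
  shows "form1 A (test_form c a r m)"
  unfolding form1_def
proof (intro conjI ballI allI)
  fix c' i assume c': "c' \<in> A"
  let ?V = "{x \<in> chart_img c'. chart_inv c' x \<notin> chart_inv c ` cball a r}"
  have V: "open ?V" by (rule outside_open[OF c c' sub])
  have "smooth_on (overlap c' c) (\<lambda>x. bump a r (transition c' c x) * jacobian c' c x $ m $ i)"
    by (intro smooth_on_mult overlap_open jacobian_smooth c c' smooth_on_compose[OF _ open_UNIV _ bump_smooth] transition_smooth) auto
  then have 1: "smooth_on (overlap c' c) (\<lambda>x. test_form c a r m c' x $ i)"
    by (subst smooth_on_cong[OF overlap_open[OF c' c]])
      (auto simp: test_form_def matrix_vector_mult_basis column_def transpose_def)
  have 2: "smooth_on ?V (\<lambda>x. test_form c a r m c' x $ i)"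
  proof (subst smooth_on_cong[OF V])
    show "test_form c a r m c' x $ i = 0" if "x \<in> ?V" for x
      using test_form_outside[OF c c' r, of x] that by simp
  qed (rule smooth_on_const)
  have "chart_img c' \<subseteq> overlap c' c \<union> ?V"
  proof
    fix x assume x: "x \<in> chart_img c'"
    show "x \<in> overlap c' c \<union> ?V"
    proof (cases "chart_inv c' x \<in> chart_inv c ` cball a r")
      case True
      then have "chart_inv c' x \<in> chart_dom c" using chart_inv_dom[OF c] sub by auto
      then have "x \<in> overlap c' c" by (subst overlap_iff[OF c']) (simp add: x)
      then show ?thesis by (rule UnI1)
    qed (simp add: x)
  qed
  then show "smooth_on (chart_img c') (\<lambda>x. test_form c a r m c' x $ i)"
    by (rule smooth_on_subset[OF smooth_on_Un[OF overlap_open[OF c' c] V 1 2]])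
next
  fix c1 c2 x assume c1: "c1 \<in> A" and c2: "c2 \<in> A" and x: "x \<in> overlap c1 c2"
  have iff: "transition c1 c2 x \<in> overlap c2 c \<longleftrightarrow> x \<in> overlap c1 c"
    using overlap_iff[OF c1] overlap_iff[OF c2] transition_overlap(3,4)[OF c1 c2 x] x by simp
  show "test_form c a r m c1 x = transpose (jacobian c1 c2 x) *v test_form c a r m c2 (transition c1 c2 x)"
  proof (cases "x \<in> overlap c1 c")
    case True
    have "transition c2 c (transition c1 c2 x) = transition c1 c x"
      using transition_overlap(3)[OF c1 c2 x] by (simp add: transition_def[of c2 c] transition_def[of c1 c])
    with True iff show ?thesis
      unfolding test_form_def jacobian_cocycle[OF c1 c2 c x True]
      by (simp add: matrix_transpose_mul matrix_vector_mult_scaleR matrix_vector_mul_assoc del: transpose_matrix_vector)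
  next
    case False
    with iff show ?thesis by (simp add: test_form_def)
  qed
qed

lemma test_form_chart:
  assumes "c \<in> A" "x \<in> chart_img c"
  shows "test_form c a r m c x = bump a r x *\<^sub>R axis m 1"
proof -
  have tr: "transition c c y = y" if "y \<in> chart_img c" for y
    unfolding transition_def by (rule chart_map_inv[OF assms(1) that])
  have "partial i (\<lambda>y. transition c c y $ k) x = partial i (\<lambda>y. y $ k) x" for i k
    by (rule partial_cong_open[OF chart_open(2)[OF assms(1)] assms(2)]) (simp add: tr)
  then have "jacobian c c x = mat 1"
    by (simp add: jacobian_def vec_eq_iff mat_def partial_component)
  then show ?thesis using assms tr by (simp add: test_form_def overlap_self transpose_mat)
qed

end

lemma inner2_raise:
  assumes "posdef G"
  shows "inner2 G a b = 1/2 * (\<Sum>i\<in>UNIV. \<Sum>j\<in>UNIV. a $ i $ j * (matrix_inv G ** b ** matrix_inv G) $ i $ j)"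
proof -
  have h: "matrix_inv G $ j $ l = matrix_inv G $ l $ j" for j l
    using arg_cong[OF posdef_inv(4)[OF assms], of "\<lambda>m. m $ l $ j"] by (simp add: transpose_def)
  have "(\<Sum>k\<in>UNIV. \<Sum>l\<in>UNIV. matrix_inv G $ i $ k * matrix_inv G $ j $ l * a $ i $ j * b $ k $ l)
      = a $ i $ j * (matrix_inv G ** b ** matrix_inv G) $ i $ j" for i j
    unfolding matrix_mult3 h[of j] by (simp add: sum_distrib_left mult_ac)
  then show ?thesis by (simp add: inner2_def)
qed

lemma raised_skew:
  assumes "posdef (g y)" "transpose (\<psi> y) = - \<psi> y"
  shows "raised g \<psi> y $ i $ j = - raised g \<psi> y $ j $ i"
proof -
  have "transpose (matrix_inv (g y) ** \<psi> y ** matrix_inv (g y)) = matrix_inv (g y) ** ((-1) *\<^sub>R \<psi> y) ** matrix_inv (g y)"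
    by (simp add: matrix_transpose_mul posdef_inv(4)[OF assms(1)] assms(2) matrix_mul_assoc)
  also have "\<dots> = - (matrix_inv (g y) ** \<psi> y ** matrix_inv (g y))"
    unfolding scaleR_matrix_mult by simp
  finally have "(matrix_inv (g y) ** \<psi> y ** matrix_inv (g y)) $ i $ j =
      - (matrix_inv (g y) ** \<psi> y ** matrix_inv (g y)) $ j $ i"
    by (drule_tac arg_cong[of _ _ "\<lambda>m. m $ j $ i"]) (simp add: transpose_def)
  then show ?thesis unfolding raised_def vector_scaleR_component by simp
qed

context oriented_riemannian
begin

lemma raised_smooth:
  assumes "c \<in> A" "\<And>i j. smooth_on (chart_img c) (\<lambda>y. \<psi> y $ i $ j)"
  shows "smooth_on (chart_img c) (\<lambda>y. raised (g c) \<psi> y $ i $ j)"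
  unfolding raised_def vector_scaleR_component real_scaleR_def matrix_mult3
  by (intro smooth_intros sqrt_det_smooth inv_smooth chart_open assms)

text \<open>The exterior derivative of b dx^m is db wedge dx^m. Paired with the skew array
  \<open>raised\<close>, its two antisymmetric halves contribute equally, which cancels the factor
  1/2 of \<open>inner2\<close>.\<close>

lemma test_form_pairing:
  assumes \<phi>: "form2 A \<phi>" and c: "c \<in> A" and x: "x \<in> chart_img c"
  shows "inner2 (g c x) (d1 (test_form c a r m c) x) (\<phi> c x) * sqrt (det (g c x)) =
    (\<Sum>i\<in>UNIV. partial i (bump a r) x * raised (g c) (\<phi> c) x $ i $ m)"
proof -
  have d: "partial i (\<lambda>y. test_form c a r m c y $ j) x = (if j = m then partial i (bump a r) x else 0)" for i j
  proof -
    have "partial i (\<lambda>y. test_form c a r m c y $ j) x = partial i (\<lambda>y. if j = m then bump a r y else 0) x"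
      by (rule partial_cong_open[OF chart_open(2)[OF c] x]) (simp add: test_form_chart[OF c] axis_def)
    then show ?thesis by simp
  qed
  let ?R = "raised (g c) (\<phi> c) x"
  have sk: "?R $ i $ j = - ?R $ j $ i" for i j
    by (rule raised_skew[of "g c" x "\<phi> c", OF metric_posdef[OF c x] form2_skew[OF \<phi> c x]])
  have "inner2 (g c x) (d1 (test_form c a r m c) x) (\<phi> c x) * sqrt (det (g c x)) =
    1/2 * (\<Sum>i\<in>UNIV. \<Sum>j\<in>UNIV. d1 (test_form c a r m c) x $ i $ j * ?R $ i $ j)"
    unfolding inner2_raise[OF metric_posdef[OF c x]] raised_def
    by (simp add: sum_distrib_left sum_distrib_right mult_ac)
  also have "(\<Sum>i\<in>UNIV. \<Sum>j\<in>UNIV. d1 (test_form c a r m c) x $ i $ j * ?R $ i $ j) =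
    (\<Sum>i\<in>UNIV. \<Sum>j\<in>UNIV. (if j = m then partial i (bump a r) x * ?R $ i $ j else 0))
    - (\<Sum>i\<in>UNIV. \<Sum>j\<in>UNIV. (if i = m then partial j (bump a r) x * ?R $ i $ j else 0))"
    unfolding sum_subtractf[symmetric] by (intro sum.cong refl) (simp add: d1_def d)
  also have "(\<Sum>i\<in>UNIV. \<Sum>j\<in>UNIV. (if i = m then partial j (bump a r) x * ?R $ i $ j else 0)) =
      (\<Sum>j\<in>UNIV. partial j (bump a r) x * ?R $ m $ j)"
    by (subst sum.swap) simp
  also have "\<dots> = - (\<Sum>j\<in>UNIV. partial j (bump a r) x * ?R $ j $ m)"
  proof -
    have "partial j (bump a r) x * ?R $ m $ j = - (partial j (bump a r) x * ?R $ j $ m)" for j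
      using sk[of m j] by simp
    then show ?thesis by (simp only: sum_negf)
  qed
  finally show ?thesis by simp
qed

text \<open>As \<open>c\<close> comes first, every later piece avoids the domain of
  \<open>c\<close>. Around its points the test form vanishes on a whole neighbourhood, so its
  exterior derivative vanishes there too.\<close>

lemma test_form_integral:
  assumes c: "c \<in> A" and r: "r > 0" and sub: "cball a r \<subseteq> chart_img c" and cs: "chart_cover A (c # cs)"
  shows "integral_over g (c # cs) (\<lambda>c' x. inner2 (g c' x) (d1 (test_form c a r m c') x) (\<phi> c' x)) =
    set_lebesgue_integral lborel (chart_img c)
      (\<lambda>x. inner2 (g c x) (d1 (test_form c a r m c) x) (\<phi> c x) * sqrt (det (g c x)))"
proof -
  define t where "t i = set_lebesgue_integral lborel
       (chart_map ((c # cs) ! i) ` (chart_dom ((c # cs) ! i) - (\<Union>j<i. chart_dom ((c # cs) ! j))))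
       (\<lambda>x. inner2 (g ((c # cs) ! i) x) (d1 (test_form c a r m ((c # cs) ! i)) x) (\<phi> ((c # cs) ! i) x)
         * sqrt (det (g ((c # cs) ! i) x)))" for i
  have "t i = 0" if i: "i \<in> {..<length (c # cs)} - {0}" for i
  proof -
    let ?c = "(c # cs) ! i"
    have c': "?c \<in> A" using cs i nth_mem[of i "c # cs"] unfolding chart_cover_def by blast
    let ?S = "chart_map ?c ` (chart_dom ?c - (\<Union>j<i. chart_dom ((c # cs) ! j)))"
    have z: "d1 (test_form c a r m ?c) x = 0" if xS: "x \<in> ?S" for x
    proof -
      obtain p where "x = chart_map ?c p" "p \<in> chart_dom ?c - (\<Union>j<i. chart_dom ((c # cs) ! j))"
        using xS by (rule imageE)
      then have p: "p \<in> chart_dom ?c" "p \<notin> (\<Union>j<i. chart_dom ((c # cs) ! j))" "x = chart_map ?c p"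
        by simp_all
      have "chart_dom c \<subseteq> (\<Union>j<i. chart_dom ((c # cs) ! j))" using i UN_upper[of 0 "{..<i}" "\<lambda>j. chart_dom ((c # cs) ! j)"] by simp
      then have "p \<notin> chart_dom c" using p(2) by blast
      then have "chart_inv ?c x \<notin> chart_inv c ` cball a r"
        unfolding p(3) chart_inv_map[OF c' p(1)] using chart_inv_dom[OF c] sub by blast
      then have x: "x \<in> {x \<in> chart_img ?c. chart_inv ?c x \<notin> chart_inv c ` cball a r}"
        using chart_map_img[OF c' p(1)] p(3) by simp
      have "partial k (\<lambda>y. test_form c a r m ?c y $ l) x = 0" for k l
      proof -
        have "partial k (\<lambda>y. test_form c a r m ?c y $ l) x = partial k (\<lambda>y. 0) x"
          by (rule partial_cong_open[OF outside_open[OF c c' sub] x])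
            (use test_form_outside[OF c c' r] in simp)
        then show ?thesis by simp
      qed
      then show ?thesis by (simp add: d1_def vec_eq_iff)
    qed
    have "inner2 (g ?c x) 0 b = 0" for x b by (simp add: inner2_def)
    then show ?thesis unfolding t_def set_lebesgue_integral_def
      by (intro integral_eq_zero_AE AE_I2) (use z in \<open>auto simp: indicator_def\<close>)
  qed
  then have "sum t {..<length (c # cs)} = t 0"
    by (subst sum.remove[of _ 0]) auto
  then show ?thesis unfolding integral_over_def t_def by (simp add: chart_img_def)
qed

text \<open>If the divergence were nonzero at \<open>a\<close>, it would keep its sign on a small
  ball. Integrating by parts against the bump of that ball gives zero for the integral of bump times
  divergence, although this product has one sign and is nonzero at \<open>a\<close>.\<close>

lemma coclosed:
  assumes h: "harmonic_form2 A g \<phi>" and c: "c \<in> A" and a: "a \<in> chart_img c"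
  shows "(\<Sum>i\<in>UNIV. partial i (\<lambda>y. raised (g c) (\<phi> c) y $ i $ m) a) = 0"
proof (rule ccontr)
  have \<phi>: "form2 A \<phi>" using h unfolding harmonic_form2_def by blast
  define V where "V = chart_img c"
  have V: "open V" unfolding V_def by (rule chart_open[OF c])
  define P where "P i y = raised (g c) (\<phi> c) y $ i $ m" for i y
  have P: "smooth_on V (P i)" for i
    unfolding P_def[abs_def] V_def by (rule raised_smooth[OF c form2_smooth[OF \<phi> c]])
  define D where "D y = (\<Sum>i\<in>UNIV. partial i (P i) y)" for y
  have D: "smooth_on V D" unfolding D_def[abs_def] by (intro smooth_intros V P)
  assume "(\<Sum>i\<in>UNIV. partial i (\<lambda>y. raised (g c) (\<phi> c) y $ i $ m) a) \<noteq> 0"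
  then have Da: "D a \<noteq> 0" unfolding D_def P_def[abs_def] .
  define s where "s = sgn (D a)"
  have "open (V \<inter> (\<lambda>y. s * D y) -` {0<..})"
    by (intro continuous_open_preimage continuous_intros smooth_on_continuous[OF D] V open_greaterThan)
  moreover have "a \<in> V \<inter> (\<lambda>y. s * D y) -` {0<..}"
    using a Da by (simp add: V_def s_def sgn_mult_self_eq abs_if sgn_if)
  ultimately obtain r where r: "r > 0" and rsub: "cball a r \<subseteq> V \<inter> (\<lambda>y. s * D y) -` {0<..}"
    using open_contains_cball by blast
  have sub: "cball a r \<subseteq> V" and pos: "\<And>y. y \<in> cball a r \<Longrightarrow> s * D y > 0" using rsub by auto
  define b where "b = bump a r"
  have b: "smooth_on V b" "\<And>x. x \<notin> cball a r \<Longrightarrow> b x = 0"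
    unfolding b_def using smooth_on_subset[OF bump_smooth] bump_outside[OF r] by auto
  have pb: "partial i b x = 0" if "x \<notin> cball a r" for x i
  proof -
    have "partial i b x = partial i (\<lambda>x. 0) x"
      by (rule partial_cong_open[of "- cball a r"]) (use that b(2) in auto)
    then show ?thesis by simp
  qed
  \<comment> \<open>The products with the bump make sense only on \<open>V\<close>. Extended by zero
    they are smooth on the whole space, where derivatives integrate to 0.\<close>
  define u where "u i x = (if x \<in> V then b x * P i x else 0)" for i x
  have u: "smooth_on UNIV (u i)" for i
    unfolding u_def[abs_def] by (rule smooth_extend_zero[OF V _ sub]) (use b V P in \<open>auto intro: smooth_on_mult\<close>)
  have u0: "u i x = 0" if "x \<notin> cball a r" for i x using b(2)[OF that] by (simp add: u_def)
  define w where "w x = (if x \<in> V then b x * D x else 0)" for x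
  have w: "smooth_on UNIV w"
    unfolding w_def[abs_def] by (rule smooth_extend_zero[OF V _ sub]) (use b V D in \<open>auto intro: smooth_on_mult\<close>)
  have w0: "w x = 0" if "x \<notin> cball a r" for x using b(2)[OF that] by (simp add: w_def)
  note wc = smooth_on_continuous[OF w]
  have iw: "integrable lborel w" by (rule support_integrable[OF wc w0])
  note iu = integral_partial_zero[OF u u0]
  obtain cs where cs: "chart_cover A (c # cs)" using chart_cover_exists[OF c] by blast
  have "set_lebesgue_integral lborel V
      (\<lambda>x. inner2 (g c x) (d1 (test_form c a r m c) x) (\<phi> c x) * sqrt (det (g c x))) = 0"
    using harmonic_closed_coclosed(2)[OF h test_form_form1[OF c r sub[unfolded V_def]] cs, of m]
      test_form_integral[OF c r sub[unfolded V_def] cs, of m \<phi>] unfolding V_def by simp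
  \<comment> \<open>The product rule: pairing the gradient of the bump with \<open>P\<close> is the
    divergence of the product minus the bump times the divergence \<open>D\<close>.\<close>
  moreover have "indicator V x *\<^sub>R (inner2 (g c x) (d1 (test_form c a r m c) x) (\<phi> c x) * sqrt (det (g c x)))
      = (\<Sum>i\<in>UNIV. partial i (u i) x) - w x" for x
  proof (cases "x \<in> V")
    case True
    have "partial i (u i) x = partial i b x * P i x + b x * partial i (P i) x" for i
    proof -
      have "partial i (u i) x = partial i (\<lambda>x. b x * P i x) x"
        by (rule partial_cong_open[OF V True]) (simp add: u_def)
      also have "\<dots> = partial i b x * P i x + b x * partial i (P i) x"
        by (rule partial_mult) (use smooth_on_differentiable[OF _ True] b P in auto)
      finally show ?thesis .
    qed
    then have "(\<Sum>i\<in>UNIV. partial i (u i) x) - w x = (\<Sum>i\<in>UNIV. partial i b x * P i x)"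
      using True by (simp add: w_def D_def sum.distrib sum_distrib_left)
    then show ?thesis
      using True test_form_pairing[OF \<phi> c, of x a r m] by (simp add: V_def b_def P_def)
  next
    case False
    then have x: "x \<in> - cball a r" using sub by blast
    have "partial i (u i) x = 0" for i
    proof -
      have "partial i (u i) x = partial i (\<lambda>x. 0) x"
        by (rule partial_cong_open[OF _ x]) (use u0 in auto)
      then show ?thesis by simp
    qed
    then show ?thesis using False by (simp add: w_def)
  qed
  ultimately have "(LINT x|lborel. (\<Sum>i\<in>UNIV. partial i (u i) x) - w x) = 0"
    unfolding set_lebesgue_integral_def by simp
  then have "integral\<^sup>L lborel w = 0"
    using iu iw by (simp add: Bochner_Integration.integral_diff Bochner_Integration.integral_sum)
  then have "set_lebesgue_integral lborel UNIV (\<lambda>x. s * w x) = 0"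
    by (simp add: set_lebesgue_integral_def)
  moreover have "set_integrable lborel UNIV (\<lambda>x. s * w x)"
    using iw by (simp add: set_integrable_def)
  moreover have "0 \<le> s * w x" for x
  proof (cases "x \<in> cball a r")
    case True
    have *: "s * w x = b x * (s * D x)" using True sub by (auto simp: w_def)
    show ?thesis unfolding *
      unfolding b_def by (rule mult_nonneg_nonneg[OF bump_nonneg less_imp_le[OF pos[OF True]]])
  qed (simp add: w0)
  ultimately have "s * w a = 0"
    using continuous_nonneg_integral_0[OF open_UNIV, of "\<lambda>x. s * w x" a] wc by (simp add: continuous_on_mult_left)
  then have "b a * (s * D a) = 0" using a by (auto simp: w_def V_def)
  then show False using pos[of a] r bump_center[OF r, of a] by (auto simp: b_def)
qed

text \<open>Counterpart of \<open>hodge_raised\<close>: the dual form is a constant-coefficient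
  expression in the density of \<phi>, so its exterior derivative consists of divergences of that
  density.\<close>

lemma hodge_raised_form: "hodge (g c y) (\<phi> c y) = (1/2) *\<^sub>R dual2 (raised (g c) (\<phi> c) y)"
  if "c \<in> A" "y \<in> chart_img c"
proof -
  have "dual2 (r *\<^sub>R a) = r *\<^sub>R dual2 a" for r a
    by (simp add: dual2_def vec_eq_iff sum_distrib_left mult_ac)
  then show ?thesis
    unfolding hodge_dual2 raised_def using posdef_inv(4)[OF metric_posdef[OF that]] by simp
qed

lemma hodge_smooth:
  assumes "form2 A \<phi>" "c \<in> A"
  shows "smooth_on (chart_img c) (\<lambda>y. hodge (g c y) (\<phi> c y) $ i $ j)"
proof -
  have "smooth_on (chart_img c) (\<lambda>y. 1/2 * (\<Sum>k\<in>UNIV. \<Sum>l\<in>UNIV. levi_civita_symbol k l i j * raised (g c) (\<phi> c) y $ k $ l))"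
    by (intro smooth_on_mult smooth_on_const smooth_on_sum raised_smooth chart_open form2_smooth assms)
  then show ?thesis
    by (subst smooth_on_cong[OF chart_open(2)[OF assms(2)]]) (simp_all add: hodge_raised_form[OF assms(2)] dual2_def)
qed

end

section \<open>The Hodge star exchanges closed and coclosed forms\<close>

lemma dual2_skew: "dual2 a $ j $ i = - dual2 a $ i $ j"
proof -
  have "levi_civita_symbol k l j i * a $ k $ l = - (levi_civita_symbol k l i j * a $ k $ l)" for k l
    using levi_civita_swap(3)[of k l i j] by simp
  then show ?thesis unfolding dual2_def by (simp add: sum_negf)
qed

lemma hodge_skew: "transpose (hodge G a) = - hodge G a"
proof -
  have "transpose (hodge G a) $ i $ j = (- hodge G a) $ i $ j" for i j
    unfolding hodge_dual2 transpose_def by (simp add: dual2_skew[of _ j i])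
  then show ?thesis by (simp add: vec_eq_iff)
qed


lemma partial_half_dual2:
  assumes "\<And>k l. (\<lambda>y. a y $ k $ l) differentiable (at x)"
  shows "partial p (\<lambda>y. ((1/2) *\<^sub>R dual2 (a y)) $ i $ j) x =
    1/2 * (\<Sum>k\<in>UNIV. \<Sum>l\<in>UNIV. levi_civita_symbol k l i j * partial p (\<lambda>y. a y $ k $ l) x)"
proof -
  note d = differentiable_mult[OF differentiable_const assms]
  have "partial p (\<lambda>y. ((1/2) *\<^sub>R dual2 (a y)) $ i $ j) x =
      1/2 * partial p (\<lambda>y. \<Sum>k\<in>UNIV. \<Sum>l\<in>UNIV. levi_civita_symbol k l i j * a y $ k $ l) x"
    unfolding dual2_def vector_scaleR_component vec_lambda_beta real_scaleR_def
    by (intro partial_cmult differentiable_sum ballI finite d)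
  also have "\<dots> = 1/2 * (\<Sum>k\<in>UNIV. \<Sum>l\<in>UNIV. levi_civita_symbol k l i j * partial p (\<lambda>y. a y $ k $ l) x)"
    unfolding partial_sum2[OF d] partial_cmult[OF assms] ..
  finally show ?thesis .
qed

text \<open>Here \<open>r p k l\<close> plays the p-th derivative of a skew density. For distinct i,
  j, k the cyclic sum of its dual is, up to sign, twice the divergence with the remaining index; if
  two indices agree, skewness of the dual cancels the terms.\<close>

lemma cyclic_from_divergence:
  fixes r :: "4 \<Rightarrow> 4 \<Rightarrow> 4 \<Rightarrow> real"
  assumes skew: "\<And>p k l. r p k l = - r p l k" and div: "\<And>m. (\<Sum>p\<in>UNIV. r p p m) = 0"
  defines "s \<equiv> \<lambda>p i j. \<Sum>k\<in>UNIV. \<Sum>l\<in>UNIV. levi_civita_symbol k l i j * r p k l"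
  shows "s i j k + s j k i + s k i j = 0"
proof -
  note sk = skew[of _ 2 1] skew[of _ 3 1] skew[of _ 4 1] skew[of _ 3 2] skew[of _ 4 2] skew[of _ 4 3]
  have d: "r p k k = 0" for p k using skew[of p k k] by simp
  have "\<forall>i j k. s i j k + s j k i + s k i j = 0"
    unfolding forall_4 s_def sum_4 levi_civita_values levi_civita_eq0
    using div[of 1] div[of 2] div[of 3] div[of 4] unfolding sum_4
    by (simp add: sk d)
  then show ?thesis by blast
qed

text \<open>For fixed m only the three other indices occur, each pair k, l twice, so the sum is, up
  to sign, twice the cyclic sum over those three indices.\<close>

lemma divergence_from_cyclic:
  fixes r :: "4 \<Rightarrow> 4 \<Rightarrow> 4 \<Rightarrow> real"
  assumes skew: "\<And>p k l. r p k l = - r p l k" and cyc: "\<And>i j k. r i j k + r j k i + r k i j = 0"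
  shows "(\<Sum>i\<in>UNIV. \<Sum>k\<in>UNIV. \<Sum>l\<in>UNIV. levi_civita_symbol k l i m * r i k l) = 0"
proof -
  note sk = skew[of _ 2 1] skew[of _ 3 1] skew[of _ 4 1] skew[of _ 3 2] skew[of _ 4 2] skew[of _ 4 3]
  have d: "r p k k = 0" for p k using skew[of p k k] by simp
  have "\<forall>m. (\<Sum>i\<in>UNIV. \<Sum>k\<in>UNIV. \<Sum>l\<in>UNIV. levi_civita_symbol k l i m * r i k l) = 0"
    unfolding forall_4 sum_4 levi_civita_values levi_civita_eq0
    using cyc[of 1 2 3] cyc[of 1 2 4] cyc[of 1 3 4] cyc[of 2 3 4]
    by (simp add: sk d)
  then show ?thesis by blast
qed

context oriented_riemannian
begin

lemma hodge_closed:
  assumes h: "harmonic_form2 A g \<phi>" and c: "c \<in> A" and x: "x \<in> chart_img c"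
  shows "d2 (\<lambda>y. hodge (g c y) (\<phi> c y)) x = 0"
proof -
  have \<phi>: "form2 A \<phi>" using h unfolding harmonic_form2_def by blast
  define r where "r p k l = partial p (\<lambda>y. raised (g c) (\<phi> c) y $ k $ l) x" for p k l
  note sm = raised_smooth[OF c form2_smooth[OF \<phi> c]]
  note df = smooth_on_differentiable[OF sm x]
  have skew: "r p k l = - r p l k" for p k l
  proof -
    have "r p k l = partial p (\<lambda>y. - raised (g c) (\<phi> c) y $ l $ k) x"
      unfolding r_def
    proof (rule partial_cong_open[OF chart_open(2)[OF c] x])
      fix y assume y: "y \<in> chart_img c"
      show "raised (g c) (\<phi> c) y $ k $ l = - raised (g c) (\<phi> c) y $ l $ k"
        by (rule raised_skew[of "g c" y "\<phi> c", OF metric_posdef[OF c y] form2_skew[OF \<phi> c y]])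
    qed
    also have "\<dots> = - r p l k" unfolding r_def by (rule partial_minus[OF df])
    finally show ?thesis .
  qed
  have div: "(\<Sum>p\<in>UNIV. r p p m) = 0" for m unfolding r_def by (rule coclosed[OF h c x])
  have H: "partial p (\<lambda>y. hodge (g c y) (\<phi> c y) $ i $ j) x =
      1/2 * (\<Sum>k\<in>UNIV. \<Sum>l\<in>UNIV. levi_civita_symbol k l i j * r p k l)" for p i j
  proof -
    have "partial p (\<lambda>y. hodge (g c y) (\<phi> c y) $ i $ j) x =
      partial p (\<lambda>y. ((1/2) *\<^sub>R dual2 (raised (g c) (\<phi> c) y)) $ i $ j) x"
      by (rule partial_cong_open[OF chart_open(2)[OF c] x]) (simp only: hodge_raised_form[OF c])
    then show ?thesis unfolding partial_half_dual2[OF df] r_def .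
  qed
  have "d2 (\<lambda>y. hodge (g c y) (\<phi> c y)) x $ i $ j $ k = 0" for i j k
    using cyclic_from_divergence[of r, OF skew div, of i j k] unfolding d2_def vec_lambda_beta H by linarith
  then show ?thesis by (simp add: vec_eq_iff)
qed

lemma hodge_coclosed:
  assumes h: "harmonic_form2 A g \<phi>" and c: "c \<in> A" and x: "x \<in> chart_img c"
  shows "(\<Sum>i\<in>UNIV. partial i (\<lambda>y. raised (g c) (\<lambda>y. hodge (g c y) (\<phi> c y)) y $ i $ m) x) = 0"
proof -
  have \<phi>: "form2 A \<phi>" using h unfolding harmonic_form2_def by blast
  define r where "r p k l = partial p (\<lambda>y. \<phi> c y $ k $ l) x" for p k l
  note df = smooth_on_differentiable[OF form2_smooth[OF \<phi> c] x]
  have skew: "r p k l = - r p l k" for p k l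
  proof -
    have "r p k l = partial p (\<lambda>y. - \<phi> c y $ l $ k) x"
      unfolding r_def
      by (rule partial_cong_open[OF chart_open(2)[OF c] x]) (rule form2_skew_component[OF \<phi> c])
    also have "\<dots> = - r p l k" unfolding r_def by (rule partial_minus[OF df])
    finally show ?thesis .
  qed
  have cyc: "r i j k + r j k i + r k i j = 0" for i j k
    using arg_cong[OF harmonic_closed_coclosed(1)[OF h c x], of "\<lambda>t. t $ i $ j $ k"]
    by (simp add: d2_def r_def)
  have H: "partial p (\<lambda>y. raised (g c) (\<lambda>y. hodge (g c y) (\<phi> c y)) y $ i $ j) x =
      1/2 * (\<Sum>k\<in>UNIV. \<Sum>l\<in>UNIV. levi_civita_symbol k l i j * r p k l)" for p i j
  proof -
    have "partial p (\<lambda>y. raised (g c) (\<lambda>y. hodge (g c y) (\<phi> c y)) y $ i $ j) x =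
      partial p (\<lambda>y. ((1/2) *\<^sub>R dual2 (\<phi> c y)) $ i $ j) x"
    proof (rule partial_cong_open[OF chart_open(2)[OF c] x])
      fix y assume y: "y \<in> chart_img c"
      show "raised (g c) (\<lambda>y. hodge (g c y) (\<phi> c y)) y $ i $ j = ((1/2) *\<^sub>R dual2 (\<phi> c y)) $ i $ j"
        unfolding raised_def hodge_raised[OF metric_posdef[OF c y]] ..
    qed
    then show ?thesis unfolding partial_half_dual2[OF df] r_def .
  qed
  have "(\<Sum>i\<in>UNIV. partial i (\<lambda>y. raised (g c) (\<lambda>y. hodge (g c y) (\<phi> c y)) y $ i $ m) x) =
      1/2 * (\<Sum>i\<in>UNIV. \<Sum>k\<in>UNIV. \<Sum>l\<in>UNIV. levi_civita_symbol k l i m * r i k l)"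
    unfolding H by (rule sum_distrib_left[symmetric])
  also have "\<dots> = 0" unfolding divergence_from_cyclic[of r, OF skew cyc] by simp
  finally show ?thesis .
qed

end

section \<open>Covariant derivatives in a chart\<close>

definition pd :: "4 \<Rightarrow> (real^4 \<Rightarrow> real^4^4) \<Rightarrow> real^4 \<Rightarrow> real^4^4" where
  "pd m \<Psi> y = (\<chi> i j. partial m (\<lambda>z. \<Psi> z $ i $ j) y)"

definition smooth_matrix :: "(real^4) set \<Rightarrow> (real^4 \<Rightarrow> real^4^4) \<Rightarrow> bool" where
  "smooth_matrix S \<Psi> \<longleftrightarrow> (\<forall>i j. smooth_on S (\<lambda>y. \<Psi> y $ i $ j))"

lemma smooth_matrix_component: "smooth_matrix S \<Psi> \<Longrightarrow> smooth_on S (\<lambda>y. \<Psi> y $ i $ j)"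
  by (simp add: smooth_matrix_def)

lemma smooth_matrix_differentiable:
  "smooth_matrix S \<Psi> \<Longrightarrow> y \<in> S \<Longrightarrow> (\<lambda>y. \<Psi> y $ i $ j) differentiable (at y)"
  using smooth_on_differentiable[OF smooth_matrix_component] .

lemma smooth_matrix_pd: "smooth_matrix S \<Psi> \<Longrightarrow> smooth_matrix S (pd m \<Psi>)"
  by (simp add: smooth_matrix_def pd_def smooth_on_partial')

lemma smooth_matrix_transpose: "smooth_matrix S \<Psi> \<Longrightarrow> smooth_matrix S (\<lambda>y. transpose (\<Psi> y))"
  by (simp add: smooth_matrix_def transpose_def)

lemma smooth_matrix_add:
  "open S \<Longrightarrow> smooth_matrix S a \<Longrightarrow> smooth_matrix S b \<Longrightarrow> smooth_matrix S (\<lambda>y. a y + b y)"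
  by (simp add: smooth_matrix_def smooth_on_add)

lemma smooth_matrix_diff:
  "open S \<Longrightarrow> smooth_matrix S a \<Longrightarrow> smooth_matrix S b \<Longrightarrow> smooth_matrix S (\<lambda>y. a y - b y)"
  by (simp add: smooth_matrix_def smooth_on_diff)

lemma smooth_matrix_mult:
  "open S \<Longrightarrow> smooth_matrix S a \<Longrightarrow> smooth_matrix S b \<Longrightarrow> smooth_matrix S (\<lambda>y. a y ** b y)"
  by (simp add: smooth_matrix_def matrix_matrix_mult_def smooth_on_sum smooth_on_mult)

lemma pd_cong_open:
  assumes "open S" "x \<in> S" "\<And>y. y \<in> S \<Longrightarrow> a y = b y"
  shows "pd m a x = pd m b x"
proof -
  have "partial m (\<lambda>z. a z $ i $ j) x = partial m (\<lambda>z. b z $ i $ j) x" for i j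
    by (rule partial_cong_open[OF assms(1,2)]) (simp add: assms(3))
  then show ?thesis by (simp add: pd_def)
qed

lemma pd_diff:
  assumes "smooth_matrix S a" "smooth_matrix S b" "x \<in> S"
  shows "pd m (\<lambda>y. a y - b y) x = pd m a x - pd m b x"
  by (simp add: pd_def vec_eq_iff partial_diff smooth_matrix_differentiable[OF _ assms(3)] assms(1,2))

lemma pd_transpose: "pd m (\<lambda>y. transpose (a y)) x = transpose (pd m a x)"
  by (simp add: pd_def transpose_def)

lemma pd_const: "pd m (\<lambda>y. k) x = 0"
  by (simp add: pd_def vec_eq_iff)

lemma pd_mult:
  assumes "smooth_matrix S a" "smooth_matrix S b" "x \<in> S"
  shows "pd m (\<lambda>y. a y ** b y) x = pd m a x ** b x + a x ** pd m b x"
proof -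
  note d = smooth_matrix_differentiable[OF _ assms(3)]
  have "partial m (\<lambda>y. \<Sum>k\<in>UNIV. a y $ i $ k * b y $ k $ j) x =
      (\<Sum>k\<in>UNIV. partial m (\<lambda>y. a y $ i $ k) x * b x $ k $ j + a x $ i $ k * partial m (\<lambda>y. b y $ k $ j) x)" for i j
    by (subst partial_sum) (auto intro!: differentiable_mult d assms(1,2) partial_mult sum.cong)
  then show ?thesis by (simp add: pd_def vec_eq_iff matrix_matrix_mult_def sum.distrib)
qed

lemma pd_commute:
  assumes "open S" "smooth_matrix S a" "x \<in> S"
  shows "pd m (pd n a) x = pd n (pd m a) x"
  by (simp add: pd_def vec_eq_iff smooth_partial_commute[OF assms(1) smooth_matrix_component[OF assms(2)] assms(3)])

lemma matrix_mult_add: "a ** (b + c) = a ** b + a ** c" "(b + c) ** a = b ** a + c ** a"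
  and matrix_mult_diff: "a ** (b - c) = a ** b - a ** c" "(b - c) ** a = b ** a - c ** a"
  and matrix_mult_minus: "a ** (- b) = - (a ** b)" "(- b) ** a = - (b ** a)"
  and matrix_mult_zero: "a ** 0 = 0" "0 ** a = 0"
  for a b c :: "real^4^4"
  by (simp_all add: vec_eq_iff matrix_matrix_mult_def algebra_simps sum_subtractf sum_negf sum.distrib)

lemma transpose_linear:
  "transpose (a + b) = transpose a + transpose b" "transpose (a - b) = transpose a - transpose b"
  "transpose (- a) = - transpose a"
  for a b :: "real^4^4"
  by (simp_all add: vec_eq_iff transpose_def)

lemmas matrix_distribs = matrix_mult_add matrix_mult_diff matrix_mult_minus matrix_mult_zero

text \<open>In matrix notation the covariant derivative of a 2-tensor reads
  \<open>\<partial>\<^sub>m \<psi> - \<Gamma>\<^sub>m\<^sup>T \<psi> - \<psi> \<Gamma>\<^sub>m\<close>, where \<open>\<Gamma>\<^sub>m\<close> has the upper Christoffel index as row index.\<close>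

definition gam :: "(real^4 \<Rightarrow> real^4^4) \<Rightarrow> 4 \<Rightarrow> real^4 \<Rightarrow> real^4^4" where
  "gam g m y = (\<chi> k i. christoffel g y m i $ k)"

definition cov :: "(real^4 \<Rightarrow> real^4^4) \<Rightarrow> 4 \<Rightarrow> (real^4 \<Rightarrow> real^4^4) \<Rightarrow> real^4 \<Rightarrow> real^4^4" where
  "cov g m \<psi> y = pd m \<psi> y - transpose (gam g m y) ** \<psi> y - \<psi> y ** gam g m y"

text \<open>In trace form the product rule applies to whole matrices, and cyclicity of the trace is
  available.\<close>

lemma inner2_trace:
  assumes "posdef G"
  shows "inner2 G a b = 1/2 * trace (transpose a ** (matrix_inv G ** b ** matrix_inv G))"
proof -
  have "trace (transpose a ** c) = (\<Sum>i\<in>UNIV. \<Sum>j\<in>UNIV. a $ i $ j * c $ i $ j)" for c :: "real^4^4"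
    unfolding trace_def matrix_matrix_mult_def transpose_def by simp (rule sum.swap)
  then show ?thesis unfolding inner2_raise[OF assms] by simp
qed

lemma trace_linear: "trace (a + b) = trace a + trace b" "trace (a - b) = trace a - trace b" "trace (- a) = - trace a"
  for a b :: "real^4^4"
  by (simp_all add: trace_def sum.distrib sum_subtractf sum_negf)

lemma partial_trace:
  assumes "smooth_matrix S a" "x \<in> S"
  shows "partial m (\<lambda>y. trace (a y)) x = trace (pd m a x)"
  unfolding trace_def pd_def
  by (subst partial_sum) (auto intro!: smooth_matrix_differentiable assms)

lemma inner2_linear_left:
  "inner2 G (a + a') b = inner2 G a b + inner2 G a' b"
  "inner2 G (a - a') b = inner2 G a b - inner2 G a' b"
  "inner2 G (r *\<^sub>R a) b = r * inner2 G a b"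
  unfolding inner2_def by (simp_all add: algebra_simps sum.distrib sum_subtractf sum_distrib_left)

lemma inner2_sum_left: "inner2 G (\<Sum>k\<in>I. a k) b = (\<Sum>k\<in>I. inner2 G (a k) b)"
proof (induction I rule: infinite_finite_induct)
  case (insert k I)
  then show ?case by (simp add: inner2_linear_left)
qed (simp_all add: inner2_def)

section \<open>Levi-Civita calculus for a metric on an open subset of coordinate space\<close>

locale metric_patch =
  fixes U :: "(real^4) set" and g :: "real^4 \<Rightarrow> real^4^4"
  assumes U: "open U" and gs: "smooth_matrix U g" and gp: "\<And>y. y \<in> U \<Longrightarrow> posdef (g y)"
begin

lemma g_sym: "y \<in> U \<Longrightarrow> g y $ i $ j = g y $ j $ i"
proof -
  assume "y \<in> U"
  then have "transpose (g y) = g y" using gp posdef_def by blast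
  from arg_cong[OF this, of "\<lambda>m. m $ j $ i"] show ?thesis by (simp add: transpose_def)
qed

lemma pg_sym: "y \<in> U \<Longrightarrow> partial l (\<lambda>y. g y $ i $ j) y = partial l (\<lambda>y. g y $ j $ i) y"
  by (rule partial_cong_open[OF U]) (auto intro: g_sym)

lemma inv_smooth: "smooth_matrix U (\<lambda>y. matrix_inv (g y))"
  unfolding smooth_matrix_def
proof (intro allI smooth_on_matrix_inv[OF U])
  show "smooth_on U (\<lambda>x. g x $ i $ j)" for i j by (rule smooth_matrix_component[OF gs])
  show "det (g x) \<noteq> 0" if "x \<in> U" for x using posdef_inv(5)[OF gp[OF that]] by simp
qed

lemma gam_smooth: "smooth_matrix U (gam g m)"
  unfolding smooth_matrix_def gam_def christoffel_def vec_lambda_beta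
  by (intro allI smooth_intros U smooth_matrix_component[OF gs] smooth_matrix_component[OF inv_smooth])

lemma gam_sym:
  assumes "y \<in> U"
  shows "gam g m y $ k $ i = gam g i y $ k $ m"
  unfolding gam_def christoffel_def vec_lambda_beta using pg_sym[OF assms, of _ m i]
  by (simp add: algebra_simps)

lemma cov_metric:
  assumes y: "y \<in> U"
  shows "cov g m g y = 0"
proof -
  have "\<forall>\<^sub>F z in nhds y. z \<in> U" using U y by (rule eventually_nhds_in_open)
  then have ev: "\<forall>\<^sub>F z in nhds y. transpose (g z) = g z"
    by eventually_elim (use gp posdef_def in blast)
  have "partial m (\<lambda>y. g y $ i $ j) y =
      (transpose (gam g m y) ** g y) $ i $ j + (g y ** gam g m y) $ i $ j" for i j
  proof -
    have "(transpose (gam g m y) ** g y) $ i $ j = christoffel g y m i \<bullet> (g y *v axis j 1)"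
      by (simp add: gam_def transpose_def matrix_matrix_mult_def matrix_vector_mult_basis column_def inner_vec_def)
    moreover have "(g y ** gam g m y) $ i $ j = (\<Sum>k\<in>UNIV. g y $ i $ k * christoffel g y m j $ k)"
      by (simp add: gam_def matrix_matrix_mult_def)
    then have "(g y ** gam g m y) $ i $ j = christoffel g y m j \<bullet> (g y *v axis i 1)"
      unfolding matrix_vector_mult_basis column_def inner_vec_def g_sym[OF y, of i] by (simp add: mult.commute)
    ultimately show ?thesis using christoffel_metric[OF ev posdef_inv(1)[OF gp[OF y]], of m i j] by simp
  qed
  then show ?thesis by (simp add: cov_def vec_eq_iff pd_def)
qed

text \<open>Differentiate the identity that the metric times its inverse is constant, and insert the
  derivative of the metric from \<open>cov_metric\<close>. In effect the inverse metric is
  parallel.\<close>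

lemma pd_inv:
  assumes y: "y \<in> U"
  shows "pd m (\<lambda>y. matrix_inv (g y)) y =
    - (gam g m y ** matrix_inv (g y)) - matrix_inv (g y) ** transpose (gam g m y)"
proof -
  let ?h = "\<lambda>y. matrix_inv (g y)"
  note i = posdef_inv(2,3)[OF gp[OF y]]
  have "pd m (\<lambda>y. g y ** ?h y) y = pd m (\<lambda>y. mat 1) y"
    by (rule pd_cong_open[OF U y]) (rule posdef_inv(3)[OF gp])
  then have "pd m g y ** ?h y + g y ** pd m ?h y = 0"
    using pd_mult[OF gs inv_smooth y] by (simp add: pd_const)
  then have "?h y ** (pd m g y ** ?h y + g y ** pd m ?h y) = 0" by (simp add: matrix_mult_zero)
  then have e: "?h y ** pd m g y ** ?h y + pd m ?h y = 0"
    unfolding matrix_mult_add matrix_mul_assoc i by simp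
  have "pd m g y = transpose (gam g m y) ** g y + g y ** gam g m y"
    using cov_metric[OF y, of m] by (simp add: cov_def algebra_simps)
  then have "?h y ** pd m g y ** ?h y = ?h y ** transpose (gam g m y) ** (g y ** ?h y) + (?h y ** g y) ** gam g m y ** ?h y"
    by (simp add: matrix_distribs matrix_mul_assoc)
  then have "?h y ** pd m g y ** ?h y = ?h y ** transpose (gam g m y) + gam g m y ** ?h y"
    unfolding i by simp
  with e show ?thesis by (simp add: algebra_simps eq_neg_iff_add_eq_0)
qed

lemma cov_smooth: "smooth_matrix U \<psi> \<Longrightarrow> smooth_matrix U (cov g m \<psi>)"
  unfolding cov_def[abs_def]
  by (intro smooth_matrix_diff smooth_matrix_mult smooth_matrix_transpose smooth_matrix_pd gam_smooth U)

text \<open>The Christoffel terms produced by \<open>pd_inv\<close> are exactly those which complete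
  the partial derivatives of \<open>a\<close> and \<open>b\<close> to covariant ones.\<close>

lemma partial_inner2:
  assumes a: "smooth_matrix U a" and b: "smooth_matrix U b" and y: "y \<in> U"
  shows "partial m (\<lambda>y. inner2 (g y) (a y) (b y)) y =
    inner2 (g y) (cov g m a y) (b y) + inner2 (g y) (a y) (cov g m b y)"
proof -
  let ?h = "\<lambda>y. matrix_inv (g y)" and ?M = "gam g m y" and ?N = "transpose (gam g m y)"
  note sm = smooth_matrix_transpose[OF a] smooth_matrix_mult[OF U inv_smooth b]
    smooth_matrix_mult[OF U smooth_matrix_mult[OF U inv_smooth b] inv_smooth]
  note smt = smooth_matrix_mult[OF U sm(1) sm(3)]
  have "partial m (\<lambda>y. inner2 (g y) (a y) (b y)) y =
      partial m (\<lambda>y. 1/2 * trace (transpose (a y) ** (?h y ** b y ** ?h y))) y"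
    by (rule partial_cong_open[OF U y]) (rule inner2_trace[OF gp])
  also have "\<dots> = 1/2 * partial m (\<lambda>y. trace (transpose (a y) ** (?h y ** b y ** ?h y))) y"
    unfolding trace_def
    by (rule partial_cmult) (intro differentiable_sum ballI finite smooth_matrix_differentiable[OF smt y])
  also have "partial m (\<lambda>y. trace (transpose (a y) ** (?h y ** b y ** ?h y))) y =
      trace (transpose (pd m a y) ** (?h y ** b y ** ?h y)
        + transpose (a y) ** ((pd m ?h y ** b y + ?h y ** pd m b y) ** ?h y + ?h y ** b y ** pd m ?h y))"
    unfolding partial_trace[OF smt y] pd_mult[OF sm(1) sm(3) y] pd_mult[OF sm(2) inv_smooth y]
      pd_mult[OF inv_smooth b y] pd_transpose ..
  also have "\<dots> = trace (transpose (cov g m a y) ** (?h y ** b y ** ?h y))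
      + trace (transpose (a y) ** (?h y ** cov g m b y ** ?h y))"
  proof -
    \<comment> \<open>One Christoffel factor arrives at the right end of the product but belongs at
      the left end, next to \<open>transpose (a y)\<close>; cyclicity of the trace moves it.\<close>
    have "trace (transpose (a y) ** ?h y ** b y ** ?h y ** ?N) = trace (?N ** transpose (a y) ** ?h y ** b y ** ?h y)"
      using trace_mul_sym[of "transpose (a y) ** ?h y ** b y ** ?h y" ?N] by (simp only: matrix_mul_assoc)
    then show ?thesis
      unfolding cov_def pd_inv[OF y] transpose_linear matrix_transpose_mul transpose_transpose
      by (simp add: matrix_distribs matrix_mul_assoc trace_linear)
  qed
  finally show ?thesis
    unfolding inner2_trace[OF gp[OF y]] by simp
qed

text \<open>This is the trace of the Hessian. Differentiating the inverse metric inside the gradient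
  gives two Christoffel sums: one cancels the Christoffel term of the divergence, the other is the
  correction in the Hessian.\<close>

lemma laplacian_formula:
  assumes f: "smooth_on U f" and x: "x \<in> U"
  shows "laplacian g f x = (\<Sum>n\<in>UNIV. \<Sum>m\<in>UNIV. matrix_inv (g x) $ n $ m *
    (partial n (partial m f) x - (\<Sum>a\<in>UNIV. gam g n x $ a $ m * partial a f x)))"
proof -
  let ?h = "\<lambda>y. matrix_inv (g y)"
  define w where "w m = partial m f x" for m
  have gc: "grad g f y $ n = (\<Sum>m\<in>UNIV. ?h y $ n $ m * partial m f y)" for y n
    by (simp add: grad_def matrix_vector_mult_def)
  have sg: "smooth_on U (\<lambda>y. grad g f y $ n)" for n
    unfolding gc by (intro smooth_intros U f smooth_matrix_component[OF inv_smooth])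
  have dg: "(\<lambda>y. grad g f y $ n) differentiable (at x)" for n
    using smooth_on_differentiable[OF sg x] .
  note di = smooth_matrix_differentiable[OF inv_smooth x]
  have df: "partial m f differentiable (at x)" for m
    using smooth_on_differentiable[OF smooth_on_partial[OF f] x] .
  have pgrad: "partial n (\<lambda>y. grad g f y $ n) x =
      (\<Sum>m\<in>UNIV. pd n ?h x $ n $ m * w m + ?h x $ n $ m * partial n (partial m f) x)" for n
    unfolding gc pd_def vec_lambda_beta w_def
    by (subst partial_sum) (auto intro!: differentiable_mult di df partial_mult sum.cong)
  have nab: "nabla g (\<lambda>_. axis n 1) (grad g f) x $ n =
      partial n (\<lambda>y. grad g f y $ n) x + (\<Sum>j\<in>UNIV. gam g n x $ n $ j * grad g f x $ j)" for n
  proof -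
    have "frechet_derivative (grad g f) (at x) (axis n 1) =
        (\<chi> a. \<Sum>i\<in>UNIV. axis n 1 $ i * partial i (\<lambda>y. grad g f y $ a) x)"
      by (subst frechet_derivative_at[symmetric, OF differentiable_vec[OF dg]]) (rule refl)
    then have 1: "frechet_derivative (grad g f) (at x) (axis n 1) $ n = partial n (\<lambda>y. grad g f y $ n) x"
      by (simp add: axis_def if_distrib[of "\<lambda>t. t * _"] cong: if_cong)
    have "(\<Sum>i\<in>UNIV. \<Sum>j\<in>UNIV. (axis n 1 $ i * grad g f x $ j) *\<^sub>R christoffel g x i j) $ n =
        (\<Sum>i\<in>UNIV. if i = n then (\<Sum>j\<in>UNIV. grad g f x $ j * christoffel g x i j $ n) else 0)"
      unfolding sum_component by (intro sum.cong refl) (simp add: axis_def)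
    also have "\<dots> = (\<Sum>j\<in>UNIV. gam g n x $ n $ j * grad g f x $ j)"
      by (simp add: gam_def mult.commute)
    finally show ?thesis unfolding nabla_def vector_add_component 1 by simp
  qed
  have hs: "?h x $ i $ j = ?h x $ j $ i" for i j
    using arg_cong[OF posdef_inv(4)[OF gp[OF x]], of "\<lambda>m. m $ j $ i"] by (simp add: transpose_def)
  have "laplacian g f x = (\<Sum>n\<in>UNIV. \<Sum>m\<in>UNIV. pd n ?h x $ n $ m * w m)
     + (\<Sum>n\<in>UNIV. \<Sum>m\<in>UNIV. ?h x $ n $ m * partial n (partial m f) x)
     + (\<Sum>n\<in>UNIV. \<Sum>j\<in>UNIV. \<Sum>m\<in>UNIV. gam g n x $ n $ j * ?h x $ j $ m * w m)"
    unfolding laplacian_def divergence_def nab pgrad unfolding gc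
    by (simp add: sum.distrib sum_distrib_left w_def mult_ac)
  also have "(\<Sum>n\<in>UNIV. \<Sum>m\<in>UNIV. pd n ?h x $ n $ m * w m) =
     - (\<Sum>n\<in>UNIV. \<Sum>m\<in>UNIV. \<Sum>j\<in>UNIV. gam g n x $ n $ j * ?h x $ j $ m * w m)
     - (\<Sum>n\<in>UNIV. \<Sum>m\<in>UNIV. \<Sum>j\<in>UNIV. ?h x $ n $ j * gam g n x $ m $ j * w m)"
    unfolding pd_inv[OF x]
    by (simp add: matrix_matrix_mult_def transpose_def sum_negf sum_subtractf algebra_simps sum_distrib_left sum.distrib)
  also have "(\<Sum>n\<in>UNIV. \<Sum>m\<in>UNIV. \<Sum>j\<in>UNIV. gam g n x $ n $ j * ?h x $ j $ m * w m) =
     (\<Sum>n\<in>UNIV. \<Sum>j\<in>UNIV. \<Sum>m\<in>UNIV. gam g n x $ n $ j * ?h x $ j $ m * w m)"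
    by (intro sum.cong refl sum.swap)
  also have "(\<Sum>n\<in>UNIV. \<Sum>m\<in>UNIV. \<Sum>j\<in>UNIV. ?h x $ n $ j * gam g n x $ m $ j * w m) =
     (\<Sum>n\<in>UNIV. \<Sum>j\<in>UNIV. \<Sum>m\<in>UNIV. ?h x $ n $ j * gam g n x $ m $ j * w m)"
    by (intro sum.cong refl sum.swap)
  finally have "laplacian g f x = (\<Sum>n\<in>UNIV. \<Sum>m\<in>UNIV. ?h x $ n $ m * partial n (partial m f) x)
     - (\<Sum>n\<in>UNIV. \<Sum>j\<in>UNIV. \<Sum>m\<in>UNIV. ?h x $ n $ j * gam g n x $ m $ j * w m)" by simp
  then show ?thesis
    by (simp add: right_diff_distrib sum_subtractf sum_distrib_left w_def mult_ac)
qed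

end

text \<open>Component of \<open>\<nabla>\<^sup>2\<psi>\<close> along the coordinate fields \<open>n\<close> (outer derivative) and \<open>m\<close>; \<^const>\<open>cov\<close>
  itself does not correct for the index \<open>m\<close> it produces.\<close>

definition cov2 :: "(real^4 \<Rightarrow> real^4^4) \<Rightarrow> 4 \<Rightarrow> 4 \<Rightarrow> (real^4 \<Rightarrow> real^4^4) \<Rightarrow> real^4 \<Rightarrow> real^4^4" where
  "cov2 g n m \<psi> x = cov g n (cov g m \<psi>) x - (\<Sum>a\<in>UNIV. gam g n x $ a $ m *\<^sub>R cov g a \<psi> x)"

text \<open>The sign is the opposite of that of \<^const>\<open>curvature\<close>.\<close>

definition curv :: "(real^4 \<Rightarrow> real^4^4) \<Rightarrow> 4 \<Rightarrow> 4 \<Rightarrow> real^4 \<Rightarrow> real^4^4" where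
  "curv g n m x = pd n (gam g m) x - pd m (gam g n) x + gam g n x ** gam g m x - gam g m x ** gam g n x"

lemma cov_component:
  "cov g m \<psi> y $ i $ j = partial m (\<lambda>z. \<psi> z $ i $ j) y
    - (\<Sum>a\<in>UNIV. gam g m y $ a $ i * \<psi> y $ a $ j) - (\<Sum>a\<in>UNIV. gam g m y $ a $ j * \<psi> y $ i $ a)"
  by (simp add: cov_def pd_def matrix_matrix_mult_def transpose_def mult.commute)

lemma cov2_component:
  "cov2 g n m \<psi> x $ i $ j = partial n (\<lambda>z. cov g m \<psi> z $ i $ j) x
    - (\<Sum>a\<in>UNIV. gam g n x $ a $ i * cov g m \<psi> x $ a $ j)
    - (\<Sum>a\<in>UNIV. gam g n x $ a $ j * cov g m \<psi> x $ i $ a)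
    - (\<Sum>a\<in>UNIV. gam g n x $ a $ m * cov g a \<psi> x $ i $ j)"
  by (simp add: cov2_def cov_component[of g n "cov g m \<psi>"])

text \<open>Jacobi's formula, reduced to the case where \<open>a x\<close> is the identity matrix.\<close>

lemma partial_det:
  assumes a: "smooth_matrix S a" and x: "x \<in> S" and d: "det (a x) \<noteq> 0"
  shows "partial m (\<lambda>y. det (a y)) x = det (a x) * trace (matrix_inv (a x) ** pd m a x)"
proof -
  let ?h = "matrix_inv (a x)"
  define b where "b y = ?h ** a y" for y
  have bx: "b x = mat 1"
    using d matrix_inv_eqI matrix_left_right_inverse unfolding b_def invertible_det_nz[symmetric] invertible_def
    by metis
  have db: "(\<lambda>y. b y $ i $ j) differentiable (at x)" for i j
    unfolding b_def matrix_matrix_mult_def vec_lambda_beta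
    by (intro differentiable_sum differentiable_mult finite ballI differentiable_const smooth_matrix_differentiable[OF a x])
  have pb: "partial m (\<lambda>y. b y $ i $ j) x = (?h ** pd m a x) $ i $ j" for i j
    unfolding b_def matrix_matrix_mult_def pd_def vec_lambda_beta
    by (subst partial_sum) (auto intro!: sum.cong partial_cmult differentiable_mult smooth_matrix_differentiable[OF a x])
  \<comment> \<open>\<open>levi_civita_transform\<close> at the columns 1, 2, 3, 4 writes the
    determinant as a polynomial in the entries. After differentiation at the identity matrix each
    term has three diagonal factors, which force the fourth index and leave the trace.\<close>
  have detb: "det (b y) = (\<Sum>k\<in>UNIV. \<Sum>l\<in>UNIV. \<Sum>p\<in>UNIV. \<Sum>q\<in>UNIV.
      b y $ k $ 1 * b y $ l $ 2 * b y $ p $ 3 * b y $ q $ 4 * levi_civita_symbol k l p q)" for y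
    unfolding levi_civita_transform levi_civita_values by simp
  have dT: "(\<lambda>y. b y $ k $ 1 * b y $ l $ 2 * b y $ p $ 3 * b y $ q $ 4 * levi_civita_symbol k l p q) differentiable (at x)"
    for k l p q by (intro differentiable_mult differentiable_const db)
  have pT: "partial m (\<lambda>y. b y $ k $ 1 * b y $ l $ 2 * b y $ p $ 3 * b y $ q $ 4 * levi_civita_symbol k l p q) x =
      (((partial m (\<lambda>y. b y $ k $ 1) x * b x $ l $ 2 + b x $ k $ 1 * partial m (\<lambda>y. b y $ l $ 2) x) * b x $ p $ 3
       + b x $ k $ 1 * b x $ l $ 2 * partial m (\<lambda>y. b y $ p $ 3) x) * b x $ q $ 4
       + b x $ k $ 1 * b x $ l $ 2 * b x $ p $ 3 * partial m (\<lambda>y. b y $ q $ 4) x) * levi_civita_symbol k l p q"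
    for k l p q
    by (simp add: partial_mult db differentiable_mult)
  have "partial m (\<lambda>y. det (b y)) x = (\<Sum>k\<in>UNIV. \<Sum>l\<in>UNIV. \<Sum>p\<in>UNIV. \<Sum>q\<in>UNIV.
      partial m (\<lambda>y. b y $ k $ 1 * b y $ l $ 2 * b y $ p $ 3 * b y $ q $ 4 * levi_civita_symbol k l p q) x)"
    unfolding detb by (simp only: partial_sum differentiable_sum dT finite ball_simps simp_thms)
  also have "\<dots> = trace (?h ** pd m a x)"
    unfolding pT pb bx trace_def sum_4 by (simp add: mat_def levi_civita_values levi_civita_eq0)
  finally have 1: "partial m (\<lambda>y. det (b y)) x = trace (?h ** pd m a x)" .
  have "det ?h * det (a x) = 1" using arg_cong[OF bx, of det] by (simp add: b_def det_mul)
  then have "det (a x) * det (b y) = det (a y)" for y by (simp add: b_def det_mul mult_ac)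
  then have "partial m (\<lambda>y. det (a y)) x = partial m (\<lambda>y. det (a x) * det (b y)) x" by simp
  also have "\<dots> = det (a x) * partial m (\<lambda>y. det (b y)) x"
    unfolding detb by (intro partial_cmult differentiable_sum finite ballI dT)
  finally show ?thesis unfolding 1 .
qed

section \<open>Closedness and coclosedness in terms of covariant derivatives\<close>

context metric_patch
begin

lemma cov_cong: "x \<in> U \<Longrightarrow> (\<And>y. y \<in> U \<Longrightarrow> a y = b y) \<Longrightarrow> cov g m a x = cov g m b x"
  unfolding cov_def using pd_cong_open[OF U, of x a b m] by simp

lemma cov_zero: "cov g m (\<lambda>y. 0) x = 0"
  by (simp add: cov_def pd_const matrix_mult_zero)

lemma cov_skew:
  assumes "smooth_matrix U \<psi>" "\<And>y. y \<in> U \<Longrightarrow> transpose (\<psi> y) = - \<psi> y" "y \<in> U"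
  shows "transpose (cov g m \<psi> y) = - cov g m \<psi> y"
proof -
  have "transpose (pd m \<psi> y) = pd m (\<lambda>y. 0 - \<psi> y) y"
    unfolding pd_transpose[symmetric] by (rule pd_cong_open[OF U assms(3)]) (simp add: assms(2))
  also have "\<dots> = - pd m \<psi> y"
    by (subst pd_diff[OF _ assms(1,3)]) (simp_all add: smooth_matrix_def smooth_on_const pd_const)
  finally have "transpose (pd m \<psi> y) = - pd m \<psi> y" .
  then show ?thesis
    unfolding cov_def transpose_linear matrix_transpose_mul transpose_transpose assms(2)[OF assms(3)]
    by (simp add: matrix_distribs)
qed

text \<open>The Christoffel symbols are symmetric in the lower indices and \<psi> is skew, so the
  six correction terms cancel in pairs and only the exterior derivative remains.\<close>

lemma cov_cyclic:
  assumes skew: "\<And>y. y \<in> U \<Longrightarrow> transpose (\<psi> y) = - \<psi> y" and closed: "\<And>y. y \<in> U \<Longrightarrow> d2 \<psi> y = 0"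
    and y: "y \<in> U"
  shows "cov g m \<psi> y $ i $ j + cov g i \<psi> y $ j $ m + cov g j \<psi> y $ m $ i = 0"
proof -
  have sk: "\<psi> y $ p $ q = - \<psi> y $ q $ p" for p q
    using arg_cong[OF skew[OF y], of "\<lambda>m. m $ q $ p"] by (simp add: transpose_def)
  have d: "partial m (\<lambda>z. \<psi> z $ i $ j) y + partial i (\<lambda>z. \<psi> z $ j $ m) y + partial j (\<lambda>z. \<psi> z $ m $ i) y = 0"
    using arg_cong[OF closed[OF y], of "\<lambda>t. t $ m $ i $ j"] by (simp add: d2_def)
  have c: "(\<Sum>a\<in>UNIV. gam g p y $ a $ q * \<psi> y $ a $ r) = - (\<Sum>a\<in>UNIV. gam g q y $ a $ p * \<psi> y $ r $ a)" for p q r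
    unfolding sum_negf[symmetric]
  proof (rule sum.cong[OF refl])
    fix a show "gam g p y $ a $ q * \<psi> y $ a $ r = - (gam g q y $ a $ p * \<psi> y $ r $ a)"
      using sk[of a r] gam_sym[OF y, of p a q] by simp
  qed
  show ?thesis
    unfolding cov_component using d c[of m i j] c[of i j m] c[of j m i] by linarith
qed

text \<open>Differentiate \<open>cov_cyclic\<close>. The corrections in \<open>cov2\<close> group,
  by the index of the Christoffel symbol that they share, into three further instances of the same
  identity.\<close>

lemma cov2_cyclic:
  assumes \<psi>: "smooth_matrix U \<psi>" and skew: "\<And>y. y \<in> U \<Longrightarrow> transpose (\<psi> y) = - \<psi> y"
    and closed: "\<And>y. y \<in> U \<Longrightarrow> d2 \<psi> y = 0" and x: "x \<in> U"
  shows "cov2 g n m \<psi> x $ i $ j + cov2 g n i \<psi> x $ j $ m + cov2 g n j \<psi> x $ m $ i = 0"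
proof -
  have C: "cov g m \<psi> y $ i $ j + cov g i \<psi> y $ j $ m + cov g j \<psi> y $ m $ i = 0" if "y \<in> U" for y m i j
    by (rule cov_cyclic) (simp_all add: skew closed that)
  note dc = smooth_matrix_differentiable[OF cov_smooth[OF \<psi>] x]
  have "partial n (\<lambda>z. cov g m \<psi> z $ i $ j + cov g i \<psi> z $ j $ m + cov g j \<psi> z $ m $ i) x = partial n (\<lambda>z. 0) x"
    by (rule partial_cong_open[OF U x]) (rule C)
  then have d: "partial n (\<lambda>z. cov g m \<psi> z $ i $ j) x + partial n (\<lambda>z. cov g i \<psi> z $ j $ m) x
      + partial n (\<lambda>z. cov g j \<psi> z $ m $ i) x = 0"
    by (simp add: partial_add dc differentiable_add)
  have c: "(\<Sum>a\<in>UNIV. gam g n x $ a $ p * cov g q \<psi> x $ a $ r) + (\<Sum>a\<in>UNIV. gam g n x $ a $ p * cov g a \<psi> x $ r $ q)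
      + (\<Sum>a\<in>UNIV. gam g n x $ a $ p * cov g r \<psi> x $ q $ a) = 0" for p q r
    unfolding sum.distrib[symmetric] distrib_left[symmetric] C[OF x] by simp
  show ?thesis
    unfolding cov2_component using d c[of i m j] c[of j i m] c[of m j i] by linarith
qed

text \<open>Jacobi's formula requires the trace of the inverse metric times the derivative of the
  metric; by \<open>cov_metric\<close> this is twice the trace of the Christoffel matrix.\<close>

lemma partial_sqrt_det:
  assumes y: "y \<in> U"
  shows "partial m (\<lambda>y. sqrt (det (g y))) y = sqrt (det (g y)) * trace (gam g m y)"
proof -
  have pos: "det (g y) > 0" using posdef_inv(5)[OF gp[OF y]] .
  have pg: "pd m g y = transpose (gam g m y) ** g y + g y ** gam g m y"
    using cov_metric[OF y, of m] by (simp add: cov_def algebra_simps)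
  have "trace (matrix_inv (g y) ** pd m g y) = trace (matrix_inv (g y) ** (transpose (gam g m y) ** g y)) + trace (gam g m y)"
    unfolding pg matrix_mult_add trace_linear by (simp add: matrix_mul_assoc posdef_inv(2)[OF gp[OF y]])
  also have "trace (matrix_inv (g y) ** (transpose (gam g m y) ** g y)) = trace (transpose (gam g m y) ** g y ** matrix_inv (g y))"
    by (rule trace_mul_sym)
  also have "\<dots> = trace (transpose (gam g m y) ** (g y ** matrix_inv (g y)))" by (simp only: matrix_mul_assoc)
  also have "\<dots> = trace (gam g m y)"
    unfolding posdef_inv(3)[OF gp[OF y]] by (simp add: trace_def transpose_def)
  finally have t: "trace (matrix_inv (g y) ** pd m g y) = 2 * trace (gam g m y)" by simp
  have "(\<lambda>y. det (g y)) differentiable (at y)"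
    by (rule smooth_on_differentiable[OF smooth_on_det[OF U smooth_matrix_component[OF gs]] y])
  then have "partial m (\<lambda>y. sqrt (det (g y))) y = inverse (sqrt (det (g y))) / 2 * partial m (\<lambda>y. det (g y)) y"
    by (rule partial_chain1) (rule DERIV_real_sqrt[OF pos])
  also have "\<dots> = det (g y) / sqrt (det (g y)) * trace (gam g m y)"
  proof -
    have d: "det (g y) \<noteq> 0" using pos by simp
    have "inverse s / 2 * (d * (2 * t)) = d / s * t" for s d t :: real
      by (cases "s = 0") (simp_all add: field_simps)
    then show ?thesis unfolding partial_det[OF gs y d, of m] t .
  qed
  also have "\<dots> = sqrt (det (g y)) * trace (gam g m y)" using pos by (simp add: real_div_sqrt)
  finally show ?thesis .
qed

text \<open>Expand the divergence of the density. The derivative of \<open>sqrt (det (g y))\<close>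
  cancels the Christoffel term of the contracted index (\<open>z2\<close>), and the other one
  vanishes as a skew array paired with a symmetric one (\<open>z1\<close>). What remains is the
  divergence of \<psi> with its free index raised.\<close>

lemma cov_trace:
  assumes \<psi>: "smooth_matrix U \<psi>" and skew: "\<And>y. y \<in> U \<Longrightarrow> transpose (\<psi> y) = - \<psi> y"
    and coclosed: "\<And>y j. y \<in> U \<Longrightarrow> (\<Sum>m\<in>UNIV. partial m (\<lambda>y. raised g \<psi> y $ m $ j) y) = 0" and y: "y \<in> U"
  shows "(\<Sum>m\<in>UNIV. \<Sum>i\<in>UNIV. matrix_inv (g y) $ m $ i * cov g m \<psi> y $ i $ j) = 0"
proof -
  let ?h = "\<lambda>y. matrix_inv (g y)"
  define Q where "Q = ?h y ** \<psi> y ** ?h y"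
  define r where "r = sqrt (det (g y))"
  have r: "r > 0" unfolding r_def using posdef_inv(5)[OF gp[OF y]] by simp
  note sh = smooth_matrix_mult[OF U inv_smooth \<psi>]
  note sQ = smooth_matrix_mult[OF U sh inv_smooth]
  have ds: "(\<lambda>y. sqrt (det (g y))) differentiable (at y)"
    by (rule smooth_on_differentiable[OF smooth_on_sqrt[OF U _ smooth_on_det[OF U smooth_matrix_component[OF gs]]] y])
      (rule posdef_inv(5)[OF gp])
  have pQ: "pd m (\<lambda>y. ?h y ** \<psi> y ** ?h y) y =
      ?h y ** cov g m \<psi> y ** ?h y - gam g m y ** Q - Q ** transpose (gam g m y)" for m
    unfolding pd_mult[OF sh inv_smooth y] pd_mult[OF inv_smooth \<psi> y] pd_inv[OF y] cov_def Q_def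
    by (simp add: matrix_distribs matrix_mul_assoc algebra_simps)
  have praised: "partial m (\<lambda>y. raised g \<psi> y $ m $ j) y =
      r * (trace (gam g m y) * Q $ m $ j + (?h y ** cov g m \<psi> y ** ?h y) $ m $ j
        - (gam g m y ** Q) $ m $ j - (Q ** transpose (gam g m y)) $ m $ j)" for m j
  proof -
    have "partial m (\<lambda>y. raised g \<psi> y $ m $ j) y =
        partial m (\<lambda>y. sqrt (det (g y)) * (?h y ** \<psi> y ** ?h y) $ m $ j) y"
      by (simp add: raised_def)
    also have "\<dots> = partial m (\<lambda>y. sqrt (det (g y))) y * Q $ m $ j + r * pd m (\<lambda>y. ?h y ** \<psi> y ** ?h y) y $ m $ j"
      unfolding Q_def r_def pd_def vec_lambda_beta by (rule partial_mult[OF ds smooth_matrix_differentiable[OF sQ y]])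
    finally show ?thesis unfolding partial_sqrt_det[OF y] pQ r_def by (simp add: algebra_simps)
  qed
  have qs: "Q $ i $ j = - Q $ j $ i" for i j
  proof -
    have "transpose Q = - Q"
      unfolding Q_def matrix_transpose_mul posdef_inv(4)[OF gp[OF y]] skew[OF y]
      by (simp add: matrix_distribs matrix_mul_assoc)
    from arg_cong[OF this, of "\<lambda>m. m $ j $ i"] show ?thesis by (simp add: transpose_def)
  qed
  have z1: "(\<Sum>m\<in>UNIV. (Q ** transpose (gam g m y)) $ m $ j) = 0" for j
  proof -
    have "(\<Sum>m\<in>UNIV. (Q ** transpose (gam g m y)) $ m $ j) = (\<Sum>m\<in>UNIV. \<Sum>a\<in>UNIV. Q $ m $ a * gam g m y $ j $ a)"
      by (simp add: matrix_matrix_mult_def transpose_def)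
    also have "\<dots> = (\<Sum>m\<in>UNIV. \<Sum>a\<in>UNIV. - (Q $ a $ m * gam g a y $ j $ m))"
    proof (intro sum.cong refl)
      fix m a show "Q $ m $ a * gam g m y $ j $ a = - (Q $ a $ m * gam g a y $ j $ m)"
        using qs[of m a] gam_sym[OF y, of m j a] by simp
    qed
    also have "\<dots> = - (\<Sum>m\<in>UNIV. \<Sum>a\<in>UNIV. Q $ m $ a * gam g m y $ j $ a)"
      by (subst sum.swap) (simp add: sum_negf)
    finally show ?thesis by (simp add: matrix_matrix_mult_def transpose_def)
  qed
  have z2: "(\<Sum>m\<in>UNIV. trace (gam g m y) * Q $ m $ j) = (\<Sum>m\<in>UNIV. (gam g m y ** Q) $ m $ j)" for j
  proof -
    have "(\<Sum>m\<in>UNIV. trace (gam g m y) * Q $ m $ j) = (\<Sum>m\<in>UNIV. \<Sum>a\<in>UNIV. gam g a y $ a $ m * Q $ m $ j)"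
      unfolding trace_def sum_distrib_right
      by (intro sum.cong refl) (simp add: gam_sym[OF y])
    also have "\<dots> = (\<Sum>m\<in>UNIV. (gam g m y ** Q) $ m $ j)"
      by (subst sum.swap) (simp add: matrix_matrix_mult_def)
    finally show ?thesis .
  qed
  have "r * (\<Sum>m\<in>UNIV. (?h y ** cov g m \<psi> y ** ?h y) $ m $ j) = 0" for j
    using coclosed[OF y, of j] z1[of j] z2[of j]
    unfolding praised sum_distrib_left[symmetric] by (simp add: sum.distrib sum_subtractf)
  then have z: "(\<Sum>m\<in>UNIV. (?h y ** cov g m \<psi> y ** ?h y) $ m $ j) = 0" for j using r by simp
  \<comment> \<open>Multiplying by the metric on the right lowers the free index again.\<close>
  have "(\<Sum>m\<in>UNIV. (?h y ** cov g m \<psi> y) $ m $ j) = (\<Sum>m\<in>UNIV. ((?h y ** cov g m \<psi> y ** ?h y) ** g y) $ m $ j)"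
    unfolding matrix_mul_assoc[symmetric] posdef_inv(2)[OF gp[OF y]] by simp
  also have "\<dots> = (\<Sum>m\<in>UNIV. \<Sum>k\<in>UNIV. (?h y ** cov g m \<psi> y ** ?h y) $ m $ k * g y $ k $ j)"
    by (simp add: matrix_matrix_mult_def[of _ "g y"])
  also have "\<dots> = (\<Sum>k\<in>UNIV. (\<Sum>m\<in>UNIV. (?h y ** cov g m \<psi> y ** ?h y) $ m $ k) * g y $ k $ j)"
    by (subst sum.swap) (simp add: sum_distrib_right)
  finally show ?thesis unfolding z by (simp add: matrix_matrix_mult_def)
qed

text \<open>Differentiate \<open>cov_trace\<close>. The derivative of the inverse metric accounts
  for the corrections in the two contracted indices (\<open>s1\<close>, \<open>s2\<close>); the
  correction in the free index is itself a combination of traces that vanish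
  (\<open>s3\<close>).\<close>

lemma cov2_trace:
  assumes \<psi>: "smooth_matrix U \<psi>" and skew: "\<And>y. y \<in> U \<Longrightarrow> transpose (\<psi> y) = - \<psi> y"
    and coclosed: "\<And>y j. y \<in> U \<Longrightarrow> (\<Sum>m\<in>UNIV. partial m (\<lambda>y. raised g \<psi> y $ m $ j) y) = 0" and x: "x \<in> U"
  shows "(\<Sum>m\<in>UNIV. \<Sum>i\<in>UNIV. matrix_inv (g x) $ m $ i * cov2 g n m \<psi> x $ i $ j) = 0"
proof -
  let ?h = "\<lambda>y. matrix_inv (g y)"
  define h where "h = ?h x"
  define G where "G = gam g n x"
  define c where "c m = cov g m \<psi> x" for m
  have Z: "(\<Sum>m\<in>UNIV. \<Sum>i\<in>UNIV. matrix_inv (g y) $ m $ i * cov g m \<psi> y $ i $ j) = 0" if "y \<in> U" for y j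
    by (rule cov_trace[OF \<psi>]) (simp_all add: skew coclosed that)
  note dc = smooth_matrix_differentiable[OF cov_smooth[OF \<psi>] x]
  note dh = smooth_matrix_differentiable[OF inv_smooth x]
  have "partial n (\<lambda>y. \<Sum>m\<in>UNIV. \<Sum>i\<in>UNIV. ?h y $ m $ i * cov g m \<psi> y $ i $ j) x = partial n (\<lambda>z. 0) x"
    by (rule partial_cong_open[OF U x]) (rule Z)
  moreover have "partial n (\<lambda>y. \<Sum>m\<in>UNIV. \<Sum>i\<in>UNIV. ?h y $ m $ i * cov g m \<psi> y $ i $ j) x =
     (\<Sum>m\<in>UNIV. \<Sum>i\<in>UNIV. pd n ?h x $ m $ i * c m $ i $ j + h $ m $ i * partial n (\<lambda>y. cov g m \<psi> y $ i $ j) x)"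
  proof -
    have "partial n (\<lambda>y. \<Sum>m\<in>UNIV. \<Sum>i\<in>UNIV. ?h y $ m $ i * cov g m \<psi> y $ i $ j) x =
      (\<Sum>m\<in>UNIV. \<Sum>i\<in>UNIV. partial n (\<lambda>y. ?h y $ m $ i * cov g m \<psi> y $ i $ j) x)"
      by (intro partial_sum2 differentiable_mult dh dc)
    also have "\<dots> = (\<Sum>m\<in>UNIV. \<Sum>i\<in>UNIV. pd n ?h x $ m $ i * c m $ i $ j + h $ m $ i * partial n (\<lambda>y. cov g m \<psi> y $ i $ j) x)"
      unfolding pd_def vec_lambda_beta h_def c_def by (intro sum.cong refl partial_mult dh dc)
    finally show ?thesis .
  qed
  ultimately have e: "(\<Sum>m\<in>UNIV. \<Sum>i\<in>UNIV. pd n ?h x $ m $ i * c m $ i $ j)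
      + (\<Sum>m\<in>UNIV. \<Sum>i\<in>UNIV. h $ m $ i * partial n (\<lambda>y. cov g m \<psi> y $ i $ j) x) = 0"
    by (simp add: sum.distrib)
  have ph: "(\<Sum>m\<in>UNIV. \<Sum>i\<in>UNIV. pd n ?h x $ m $ i * c m $ i $ j) =
      - (\<Sum>m\<in>UNIV. \<Sum>i\<in>UNIV. \<Sum>a\<in>UNIV. G $ m $ a * h $ a $ i * c m $ i $ j)
      - (\<Sum>m\<in>UNIV. \<Sum>i\<in>UNIV. \<Sum>a\<in>UNIV. h $ m $ a * G $ i $ a * c m $ i $ j)"
    unfolding pd_inv[OF x] h_def[symmetric] G_def[symmetric]
    by (simp add: matrix_matrix_mult_def transpose_def sum_negf sum_subtractf algebra_simps sum_distrib_left sum.distrib)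
  have s1: "(\<Sum>m\<in>UNIV. \<Sum>i\<in>UNIV. \<Sum>a\<in>UNIV. G $ m $ a * h $ a $ i * c m $ i $ j) =
      (\<Sum>m\<in>UNIV. \<Sum>i\<in>UNIV. \<Sum>a\<in>UNIV. h $ m $ i * (G $ a $ m * c a $ i $ j))"
  proof -
    have "(\<Sum>m\<in>UNIV. \<Sum>i\<in>UNIV. \<Sum>a\<in>UNIV. h $ m $ i * (G $ a $ m * c a $ i $ j)) =
        (\<Sum>a\<in>UNIV. \<Sum>m\<in>UNIV. \<Sum>i\<in>UNIV. h $ m $ i * (G $ a $ m * c a $ i $ j))" by (rule sum_pull2)
    also have "\<dots> = (\<Sum>a\<in>UNIV. \<Sum>i\<in>UNIV. \<Sum>m\<in>UNIV. h $ m $ i * (G $ a $ m * c a $ i $ j))"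
      by (rule sum.cong[OF refl sum.swap])
    finally show ?thesis by (simp add: mult_ac)
  qed
  have s2: "(\<Sum>m\<in>UNIV. \<Sum>i\<in>UNIV. \<Sum>a\<in>UNIV. h $ m $ a * G $ i $ a * c m $ i $ j) =
      (\<Sum>m\<in>UNIV. \<Sum>i\<in>UNIV. \<Sum>a\<in>UNIV. h $ m $ i * (G $ a $ i * c m $ a $ j))"
    by (rule sum.cong[OF refl]) (subst sum.swap, simp add: mult_ac)
  have s3: "(\<Sum>m\<in>UNIV. \<Sum>i\<in>UNIV. \<Sum>a\<in>UNIV. h $ m $ i * (G $ a $ j * c m $ i $ a)) = 0"
  proof -
    have "(\<Sum>m\<in>UNIV. \<Sum>i\<in>UNIV. \<Sum>a\<in>UNIV. h $ m $ i * (G $ a $ j * c m $ i $ a)) =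
        (\<Sum>a\<in>UNIV. G $ a $ j * (\<Sum>m\<in>UNIV. \<Sum>i\<in>UNIV. h $ m $ i * c m $ i $ a))"
      by (subst sum_pull2) (simp add: sum_distrib_left mult_ac)
    then show ?thesis using Z[OF x] by (simp add: h_def c_def)
  qed
  have "(\<Sum>m\<in>UNIV. \<Sum>i\<in>UNIV. ?h x $ m $ i * cov2 g n m \<psi> x $ i $ j) =
      (\<Sum>m\<in>UNIV. \<Sum>i\<in>UNIV. h $ m $ i * partial n (\<lambda>y. cov g m \<psi> y $ i $ j) x)
      - (\<Sum>m\<in>UNIV. \<Sum>i\<in>UNIV. \<Sum>a\<in>UNIV. h $ m $ i * (G $ a $ i * c m $ a $ j))
      - (\<Sum>m\<in>UNIV. \<Sum>i\<in>UNIV. \<Sum>a\<in>UNIV. h $ m $ i * (G $ a $ j * c m $ i $ a))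
      - (\<Sum>m\<in>UNIV. \<Sum>i\<in>UNIV. \<Sum>a\<in>UNIV. h $ m $ i * (G $ a $ m * c a $ i $ j))"
    unfolding cov2_component h_def[symmetric] G_def[symmetric] c_def[symmetric]
    by (simp add: right_diff_distrib sum_subtractf sum_distrib_left)
  then show ?thesis using e ph s1 s2 s3 by linarith
qed

text \<open>In the expansion \<open>e\<close>, the terms with derivatives of \<psi> and those with
  \<psi> between two Christoffel matrices are symmetric in n and m. Only derivatives and products of
  Christoffel matrices standing on one side of \<psi> survive the difference.\<close>

lemma ricci_identity:
  assumes \<psi>: "smooth_matrix U \<psi>" and x: "x \<in> U"
  shows "cov g n (cov g m \<psi>) x - cov g m (cov g n \<psi>) x =
    - (transpose (curv g n m x) ** \<psi> x) - \<psi> x ** curv g n m x"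
proof -
  have e: "cov g n (cov g m \<psi>) x = pd n (pd m \<psi>) x
      - (transpose (pd n (gam g m) x) ** \<psi> x + transpose (gam g m x) ** pd n \<psi> x)
      - (pd n \<psi> x ** gam g m x + \<psi> x ** pd n (gam g m) x)
      - transpose (gam g n x) ** (pd m \<psi> x - transpose (gam g m x) ** \<psi> x - \<psi> x ** gam g m x)
      - (pd m \<psi> x - transpose (gam g m x) ** \<psi> x - \<psi> x ** gam g m x) ** gam g n x" for n m
  proof -
    note s1 = smooth_matrix_pd[OF \<psi>] smooth_matrix_mult[OF U smooth_matrix_transpose[OF gam_smooth] \<psi>]
      smooth_matrix_mult[OF U \<psi> gam_smooth]
    have "pd n (cov g m \<psi>) x = pd n (pd m \<psi>) x
      - (transpose (pd n (gam g m) x) ** \<psi> x + transpose (gam g m x) ** pd n \<psi> x)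
      - (pd n \<psi> x ** gam g m x + \<psi> x ** pd n (gam g m) x)"
      unfolding cov_def[abs_def]
      by (subst pd_diff[OF smooth_matrix_diff[OF U s1(1,2)] s1(3) x], subst pd_diff[OF s1(1,2) x],
          subst pd_mult[OF smooth_matrix_transpose[OF gam_smooth] \<psi> x], subst pd_mult[OF \<psi> gam_smooth x],
          subst pd_transpose, rule refl)
    then show ?thesis unfolding cov_def[of g n] by (simp add: cov_def)
  qed
  show ?thesis
    unfolding e curv_def transpose_linear matrix_transpose_mul pd_commute[OF U \<psi> x, of m n]
    by (simp add: matrix_distribs matrix_mul_assoc)
qed

lemma cov2_commute:
  assumes \<psi>: "smooth_matrix U \<psi>" and x: "x \<in> U"
  shows "cov2 g n m \<psi> x - cov2 g m n \<psi> x = - (transpose (curv g n m x) ** \<psi> x) - \<psi> x ** curv g n m x"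
  unfolding ricci_identity[OF assms, symmetric] cov2_def using gam_sym[OF x, of n _ m] by simp

text \<open>The Ricci identity applied to the metric itself, whose covariant derivatives
  vanish.\<close>

lemma curv_skew_metric:
  assumes x: "x \<in> U"
  shows "transpose (curv g n m x) ** g x + g x ** curv g n m x = 0"
proof -
  have "cov g n (cov g m g) x = 0" for n m
    using cov_cong[OF x, of "cov g m g" "\<lambda>y. 0" n] cov_metric cov_zero by simp
  with ricci_identity[OF gs x, of n m] show ?thesis by (simp add: algebra_simps eq_neg_iff_add_eq_0)
qed

lemma curv_swap: "curv g m n x = - curv g n m x"
  by (simp add: curv_def)

text \<open>Torsion-freeness makes the derivative terms and the product terms of the cyclic sum
  cancel in pairs.\<close>

lemma curv_bianchi:
  assumes x: "x \<in> U"
  shows "curv g n m x $ a $ k + curv g m k x $ a $ n + curv g k n x $ a $ m = 0"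
proof -
  have p: "pd n (gam g m) x $ a $ k = pd n (gam g k) x $ a $ m" for n m k
    unfolding pd_def vec_lambda_beta by (rule partial_cong_open[OF U x]) (rule gam_sym)
  have q: "(gam g n x ** gam g m x) $ a $ k = (gam g n x ** gam g k x) $ a $ m" for n m k
    unfolding matrix_matrix_mult_def vec_lambda_beta
    by (intro sum.cong refl arg_cong2[where f = "(*)"] gam_sym[OF x])
  show ?thesis
    unfolding curv_def vector_add_component vector_minus_component
    using p[of n m k] p[of m k n] p[of k n m] q[of n m k] q[of m k n] q[of k n m] by linarith
qed

end

section \<open>The Bochner formula\<close>

text \<open>Here t stands for the second covariant derivative in an orthonormal basis, its first
  index being the outer derivative. \<open>cyc\<close> expresses the rough Laplacian through
  contractions of the outer derivative with a form index. Exchanging the two derivatives by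
  \<open>com\<close> turns these into divergences, which \<open>tr\<close> removes, so only
  curvature is left.\<close>

lemma weitzenboeck_algebra:
  fixes t \<rho> :: "4 \<Rightarrow> 4 \<Rightarrow> 4 \<Rightarrow> 4 \<Rightarrow> real" and s :: real
  assumes skew: "\<And>p q i j. t p q i j = - t p q j i"
    and cyc: "\<And>p q i j. t p q i j + t p i j q + t p j q i = 0"
    and tr: "\<And>p j. (\<Sum>q\<in>UNIV. t p q q j) = 0"
    and com: "\<And>p q i j. t p q i j - t q p i j =
      - (\<Sum>k\<in>UNIV. \<rho> p q i k * \<Psi> k j) - (\<Sum>k\<in>UNIV. \<rho> p q j k * \<Psi> i k)"
    and r1: "\<And>p q i k. \<rho> p q i k = - \<rho> q p i k"
    and r2: "\<And>p q i k. \<rho> p q i k = - \<rho> p q k i"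
    and r3: "\<And>p q i k. \<rho> p q i k + \<rho> q i p k + \<rho> i p q k = 0"
    and s: "s = 1 \<or> s = -1"
    and \<Psi>: "\<And>p q. \<Psi> p q = ((if p = 1 \<and> q = 2 then 1 else 0) - (if p = 2 \<and> q = 1 then 1 else 0))
      + s * ((if p = 3 \<and> q = 4 then 1 else 0) - (if p = 4 \<and> q = 3 then 1 else 0))"
  shows "(\<Sum>p\<in>UNIV. t p p 1 2) = - (\<rho> 1 3 1 3 + \<rho> 1 4 1 4 + \<rho> 2 3 2 3 + \<rho> 2 4 2 4) + 2 * s * \<rho> 1 2 3 4"
    and "(\<Sum>p\<in>UNIV. t p p 3 4) = - s * (\<rho> 1 3 1 3 + \<rho> 1 4 1 4 + \<rho> 2 3 2 3 + \<rho> 2 4 2 4) + 2 * \<rho> 1 2 3 4"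
proof -
  have z: "\<rho> p p i k = 0" "\<rho> p q i i = 0" for p q i k
    using r1[of p p i k] r2[of p q i i] by simp_all
  note n = r1[of 2 1] r1[of 3 1] r1[of 4 1] r1[of 3 2] r1[of 4 2] r1[of 4 3]
    r2[of _ _ 2 1] r2[of _ _ 3 1] r2[of _ _ 4 1] r2[of _ _ 3 2] r2[of _ _ 4 2] r2[of _ _ 4 3] z
  \<comment> \<open>The four Bianchi identities in four distinct indices. Together they contain the
    pair symmetries, such as \<rho> 1 2 3 4 = \<rho> 3 4 1 2, that merge the mixed curvature terms
    into one.\<close>
  have b: "\<rho> 1 2 3 4 - \<rho> 1 3 2 4 + \<rho> 2 3 1 4 = 0" "\<rho> 2 3 1 4 - \<rho> 2 4 1 3 + \<rho> 3 4 1 2 = 0"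
    "\<rho> 3 4 1 2 + \<rho> 1 4 2 3 - \<rho> 1 3 2 4 = 0" "\<rho> 1 4 2 3 - \<rho> 2 4 1 3 + \<rho> 1 2 3 4 = 0"
    using r3[of 1 2 3 4] r3[of 2 3 4 1] r3[of 3 4 1 2] r3[of 4 1 2 3] by (simp_all add: n)
  have c1: "t p 1 2 p - t 1 p 2 p = - (\<Sum>k\<in>UNIV. \<rho> p 1 2 k * \<Psi> k p) - (\<Sum>k\<in>UNIV. \<rho> p 1 p k * \<Psi> 2 k)"
    and c2: "t p 2 p 1 - t 2 p p 1 = - (\<Sum>k\<in>UNIV. \<rho> p 2 p k * \<Psi> k 1) - (\<Sum>k\<in>UNIV. \<rho> p 2 1 k * \<Psi> p k)"
    and c3: "t p 3 4 p - t 3 p 4 p = - (\<Sum>k\<in>UNIV. \<rho> p 3 4 k * \<Psi> k p) - (\<Sum>k\<in>UNIV. \<rho> p 3 p k * \<Psi> 4 k)"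
    and c4: "t p 4 p 3 - t 4 p p 3 = - (\<Sum>k\<in>UNIV. \<rho> p 4 p k * \<Psi> k 3) - (\<Sum>k\<in>UNIV. \<rho> p 4 3 k * \<Psi> p k)" for p
    by (rule com)+
  note e = sum_4 \<Psi>
  have "(\<Sum>p\<in>UNIV. t p 1 2 p) = (\<Sum>p\<in>UNIV. t p 1 2 p - t 1 p 2 p)"
    using tr[of 1 2] skew[of 1 _ _ 2] by (simp add: sum_subtractf sum_negf)
  also have "\<dots> = (\<rho> 1 3 1 3 + \<rho> 1 4 1 4) - s * \<rho> 1 2 3 4"
    unfolding c1 e using b s by (auto simp: n algebra_simps)
  finally have s1: "(\<Sum>p\<in>UNIV. t p 1 2 p) = (\<rho> 1 3 1 3 + \<rho> 1 4 1 4) - s * \<rho> 1 2 3 4" .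
  have "(\<Sum>p\<in>UNIV. t p 2 p 1) = (\<Sum>p\<in>UNIV. t p 2 p 1 - t 2 p p 1)"
    using tr[of 2 1] by (simp add: sum_subtractf)
  also have "\<dots> = (\<rho> 2 3 2 3 + \<rho> 2 4 2 4) - s * \<rho> 1 2 3 4"
    unfolding c2 e using b s by (auto simp: n algebra_simps)
  finally have s2: "(\<Sum>p\<in>UNIV. t p 2 p 1) = (\<rho> 2 3 2 3 + \<rho> 2 4 2 4) - s * \<rho> 1 2 3 4" .
  have "(\<Sum>p\<in>UNIV. t p 3 4 p) = (\<Sum>p\<in>UNIV. t p 3 4 p - t 3 p 4 p)"
    using tr[of 3 4] skew[of 3 _ _ 4] by (simp add: sum_subtractf sum_negf)
  also have "\<dots> = s * (\<rho> 1 3 1 3 + \<rho> 2 3 2 3) - \<rho> 1 2 3 4"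
    unfolding c3 e using b s by (auto simp: n algebra_simps)
  finally have s3: "(\<Sum>p\<in>UNIV. t p 3 4 p) = s * (\<rho> 1 3 1 3 + \<rho> 2 3 2 3) - \<rho> 1 2 3 4" .
  have "(\<Sum>p\<in>UNIV. t p 4 p 3) = (\<Sum>p\<in>UNIV. t p 4 p 3 - t 4 p p 3)"
    using tr[of 4 3] by (simp add: sum_subtractf)
  also have "\<dots> = s * (\<rho> 1 4 1 4 + \<rho> 2 4 2 4) - \<rho> 1 2 3 4"
    unfolding c4 e using b s by (auto simp: n algebra_simps)
  finally have s4: "(\<Sum>p\<in>UNIV. t p 4 p 3) = s * (\<rho> 1 4 1 4 + \<rho> 2 4 2 4) - \<rho> 1 2 3 4" .
  have "(\<Sum>p\<in>UNIV. t p p i j) + (\<Sum>p\<in>UNIV. t p i j p) + (\<Sum>p\<in>UNIV. t p j p i) = 0" for i j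
    unfolding sum.distrib[symmetric] using cyc by simp
  from this[of 1 2] this[of 3 4] s1 s2 s3 s4
  show "(\<Sum>p\<in>UNIV. t p p 1 2) = - (\<rho> 1 3 1 3 + \<rho> 1 4 1 4 + \<rho> 2 3 2 3 + \<rho> 2 4 2 4) + 2 * s * \<rho> 1 2 3 4"
    "(\<Sum>p\<in>UNIV. t p p 3 4) = - s * (\<rho> 1 3 1 3 + \<rho> 1 4 1 4 + \<rho> 2 3 2 3 + \<rho> 2 4 2 4) + 2 * \<rho> 1 2 3 4"
    by (simp_all add: algebra_simps)
qed

text \<open>Contraction of two coordinate indices with vectors. Values in any real vector space
  allow matrix-valued families such as \<open>cov2\<close> and \<open>curv\<close>.\<close>

definition lin2 :: "(4 \<Rightarrow> 4 \<Rightarrow> 'b::real_vector) \<Rightarrow> real^4 \<Rightarrow> real^4 \<Rightarrow> 'b" where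
  "lin2 M u v = (\<Sum>n\<in>UNIV. \<Sum>m\<in>UNIV. (u $ n * v $ m) *\<^sub>R M n m)"

lemma lin2_linear: "linear f \<Longrightarrow> f (lin2 M u v) = lin2 (\<lambda>n m. f (M n m)) u v"
  by (simp add: lin2_def linear_sum linear_scale)

lemma lin2_swap: "lin2 (\<lambda>n m. M m n) u v = lin2 M v u"
  unfolding lin2_def by (subst sum.swap) (simp add: mult.commute)

lemma lin2_diff: "lin2 M u v - lin2 N u v = lin2 (\<lambda>n m. M n m - N n m) u v"
  by (simp add: lin2_def sum_subtractf scaleR_diff_right)

lemma lin2_minus: "lin2 (\<lambda>n m. - M n m) u v = - lin2 M u v"
  by (simp add: lin2_def sum_negf)

lemma linear_matrix_maps:
  "linear (\<lambda>M::real^4^4. M *v w)" "linear (\<lambda>M::real^4^4. z \<bullet> (M *v w))"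
  "linear (\<lambda>M::real^4^4. - (transpose M ** b) - b ** M)"
  "linear (\<lambda>M::real^4^4. transpose M ** b + b ** M)"
  "linear (\<lambda>M::real^4^4. inner2 G M b)"
  "linear (\<lambda>M::real^4^4. transpose M)"
proof -
  have t: "transpose (r *\<^sub>R M) = r *\<^sub>R transpose M" for r and M :: "real^4^4"
    by (simp add: vec_eq_iff transpose_def)
  show "linear (\<lambda>M::real^4^4. M *v w)" "linear (\<lambda>M::real^4^4. z \<bullet> (M *v w))"
    by (rule linearI; simp add: matrix_vector_add_scaleR inner_add_right)+
  show "linear (\<lambda>M::real^4^4. - (transpose M ** b) - b ** M)" "linear (\<lambda>M::real^4^4. transpose M ** b + b ** M)"
    by (rule linearI; simp add: transpose_linear matrix_distribs t scaleR_matrix_mult algebra_simps)+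
  show "linear (\<lambda>M::real^4^4. inner2 G M b)" "linear (\<lambda>M::real^4^4. transpose M)"
    by (rule linearI; simp add: inner2_linear_left transpose_linear t)+
qed

lemma orthonormal_expansion:
  assumes "orthonormal_basis G e" "posdef G"
  shows "w = (\<Sum>k\<in>UNIV. (w \<bullet> (G *v e k)) *\<^sub>R e k)"
proof -
  have "frame_matrix e ** transpose (frame_matrix e) ** G = mat 1"
    using frame_matrix_orthonormal(2,3)[OF assms(1)] by simp
  then have "w = frame_matrix e *v (transpose (frame_matrix e) *v (G *v w))"
    by (simp add: matrix_vector_mul_assoc matrix_mul_assoc del: transpose_matrix_vector)
  also have "transpose (frame_matrix e) *v (G *v w) = (\<chi> k. w \<bullet> (G *v e k))"
    unfolding posdef_commute[OF assms(2), of w]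
    by (simp add: vec_eq_iff frame_matrix_def transpose_def matrix_vector_mult_def[of _ "G *v w"] inner_vec_def del: transpose_matrix_vector)
  also have "frame_matrix e *v (\<chi> k. w \<bullet> (G *v e k)) = (\<Sum>k\<in>UNIV. (w \<bullet> (G *v e k)) *\<^sub>R e k)"
    by (simp add: vec_eq_iff frame_matrix_def matrix_vector_mult_def mult.commute)
  finally show ?thesis .
qed

section \<open>Curvature, covariant derivatives of forms and the Laplacian of the norm\<close>

context metric_patch
begin

lemma nabla_const: "nabla g (\<lambda>_. v) (\<lambda>_. w) y = lin2 (\<lambda>i j. christoffel g y i j) v w"
  unfolding nabla_def lin2_def by (simp add: frechet_derivative_const)

text \<open>Even for constant fields the inner derivative has the variable components v^i w^j times
  Christoffel symbols. Differentiating these gives the derivative term, and the outer connection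
  gives the product term.\<close>

lemma nabla_nabla_const:
  assumes x: "x \<in> U"
  shows "nabla g (\<lambda>_. u) (nabla g (\<lambda>_. v) (\<lambda>_. w)) x =
    lin2 (\<lambda>n i. (pd n (gam g i) x + gam g n x ** gam g i x) *v w) u v"
proof -
  define N where "N = nabla g (\<lambda>_. v) (\<lambda>_. w)"
  have N: "N y $ k = (\<Sum>i\<in>UNIV. \<Sum>j\<in>UNIV. (v $ i * w $ j) * gam g i y $ k $ j)" for y k
    unfolding N_def nabla_const lin2_def by (simp add: gam_def)
  note dg = smooth_matrix_differentiable[OF gam_smooth x]
  have dN: "(\<lambda>y. N y $ k) differentiable (at x)" for k
    unfolding N by (intro differentiable_sum differentiable_mult differentiable_const finite ballI dg)
  have pN: "partial n (\<lambda>y. N y $ k) x = (\<Sum>i\<in>UNIV. \<Sum>j\<in>UNIV. (v $ i * w $ j) * pd n (gam g i) x $ k $ j)" for n k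
  proof -
    have "partial n (\<lambda>y. N y $ k) x =
        (\<Sum>i\<in>UNIV. \<Sum>j\<in>UNIV. partial n (\<lambda>y. (v $ i * w $ j) * gam g i y $ k $ j) x)"
      unfolding N by (intro partial_sum2 differentiable_mult differentiable_const dg)
    also have "\<dots> = (\<Sum>i\<in>UNIV. \<Sum>j\<in>UNIV. (v $ i * w $ j) * pd n (gam g i) x $ k $ j)"
      unfolding pd_def vec_lambda_beta by (intro sum.cong refl partial_cmult dg)
    finally show ?thesis .
  qed
  have fd: "frechet_derivative N (at x) u = (\<chi> a. \<Sum>n\<in>UNIV. u $ n * partial n (\<lambda>y. N y $ a) x)"
    by (subst frechet_derivative_at[symmetric, OF differentiable_vec[OF dN]]) (rule refl)
  have "nabla g (\<lambda>_. u) N x $ k = lin2 (\<lambda>n i. (pd n (gam g i) x + gam g n x ** gam g i x) *v w) u v $ k" for k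
  proof -
    have "nabla g (\<lambda>_. u) N x $ k = (\<Sum>n\<in>UNIV. u $ n * partial n (\<lambda>y. N y $ k) x)
        + (\<Sum>n\<in>UNIV. \<Sum>l\<in>UNIV. u $ n * N x $ l * gam g n x $ k $ l)"
      unfolding nabla_def fd by (simp add: gam_def)
    also have "(\<Sum>n\<in>UNIV. u $ n * partial n (\<lambda>y. N y $ k) x) =
        (\<Sum>n\<in>UNIV. \<Sum>i\<in>UNIV. u $ n * v $ i * (pd n (gam g i) x *v w) $ k)"
      unfolding pN by (simp add: matrix_vector_mult_def sum_distrib_left mult_ac)
    also have "(\<Sum>n\<in>UNIV. \<Sum>l\<in>UNIV. u $ n * N x $ l * gam g n x $ k $ l) =
        (\<Sum>n\<in>UNIV. \<Sum>i\<in>UNIV. u $ n * v $ i * ((gam g n x ** gam g i x) *v w) $ k)"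
    proof (rule sum.cong[OF refl])
      fix n
      have "(\<Sum>i\<in>UNIV. u $ n * v $ i * ((gam g n x ** gam g i x) *v w) $ k) =
          (\<Sum>i\<in>UNIV. \<Sum>l\<in>UNIV. \<Sum>j\<in>UNIV. u $ n * (v $ i * w $ j * gam g i x $ l $ j) * gam g n x $ k $ l)"
        unfolding matrix_vector_mul_assoc[symmetric]
        by (simp add: matrix_vector_mult_def sum_distrib_left mult_ac)
      also have "\<dots> = (\<Sum>l\<in>UNIV. \<Sum>i\<in>UNIV. \<Sum>j\<in>UNIV. u $ n * (v $ i * w $ j * gam g i x $ l $ j) * gam g n x $ k $ l)"
        by (rule sum.swap)
      also have "\<dots> = (\<Sum>l\<in>UNIV. u $ n * N x $ l * gam g n x $ k $ l)"
        unfolding N by (simp add: sum_distrib_left sum_distrib_right)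
      finally show "(\<Sum>l\<in>UNIV. u $ n * N x $ l * gam g n x $ k $ l) =
          (\<Sum>i\<in>UNIV. u $ n * v $ i * ((gam g n x ** gam g i x) *v w) $ k)" ..
    qed
    finally show ?thesis
      by (simp add: lin2_def matrix_vector_add_scaleR distrib_left sum.distrib)
  qed
  then show ?thesis by (simp add: vec_eq_iff N_def)
qed

text \<open>Constant fields commute, so the bracket term drops out, and antisymmetrising
  \<open>nabla_nabla_const\<close> produces \<open>curv\<close> with the opposite sign.\<close>

lemma Riem_curv:
  assumes x: "x \<in> U"
  shows "Riem g x u v w z = - ((lin2 (\<lambda>n m. curv g n m x) u v *v w) \<bullet> (g x *v z))"
proof -
  let ?E = "\<lambda>n i. (pd n (gam g i) x + gam g n x ** gam g i x) *v w"
  have lb: "lie_bracket (\<lambda>_. u) (\<lambda>_. v) = (\<lambda>_. 0)"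
    by (rule ext) (simp add: lie_bracket_def frechet_derivative_const)
  have "curvature g (\<lambda>_. u) (\<lambda>_. v) (\<lambda>_. w) x = - (lin2 ?E u v - lin2 (\<lambda>n m. ?E m n) u v)"
    unfolding curvature_def lb nabla_nabla_const[OF x] nabla_const lin2_swap[of ?E] by (simp add: lin2_def)
  also have "lin2 ?E u v - lin2 (\<lambda>n m. ?E m n) u v = lin2 (\<lambda>n m. curv g n m x *v w) u v"
    unfolding lin2_diff curv_def
    by (intro arg_cong[where f = "\<lambda>M. lin2 M u v"] ext)
      (simp add: matrix_vector_add_scaleR matrix_vector_mult_diff_rdistrib)
  also have "\<dots> = lin2 (\<lambda>n m. curv g n m x) u v *v w"
    by (rule lin2_linear[OF linear_matrix_maps(1), symmetric])
  finally show ?thesis unfolding Riem_def by simp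
qed

lemma nabla_form2_cov:
  assumes \<psi>: "smooth_matrix U \<psi>" and x: "x \<in> U"
  shows "nabla_form2 g u \<psi> x = (\<Sum>m\<in>UNIV. u $ m *\<^sub>R cov g m \<psi> x)"
proof -
  have nab: "nabla g (\<lambda>_. u) (\<lambda>_. axis i 1) x $ k = (\<Sum>m\<in>UNIV. u $ m * gam g m x $ k $ i)" for i k
  proof -
    have "nabla g (\<lambda>_. u) (\<lambda>_. axis i 1) x $ k =
        (\<Sum>m\<in>UNIV. \<Sum>j\<in>UNIV. if j = i then u $ m * gam g m x $ k $ j else 0)"
      unfolding nabla_const lin2_def sum_component by (intro sum.cong refl) (simp add: axis_def gam_def)
    then show ?thesis by simp
  qed
  have "nabla_form2 g u \<psi> x $ i $ j = (\<Sum>m\<in>UNIV. u $ m *\<^sub>R cov g m \<psi> x) $ i $ j" for i j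
  proof -
    have 1: "nabla g (\<lambda>_. u) (\<lambda>_. axis i 1) x \<bullet> (\<psi> x *v axis j 1) =
        (\<Sum>m\<in>UNIV. u $ m * (\<Sum>a\<in>UNIV. gam g m x $ a $ i * \<psi> x $ a $ j))"
      unfolding inner_vec_def matrix_vector_mult_basis column_def nab
      by (simp add: sum_distrib_left sum_distrib_right mult_ac, rule sum.swap)
    have 2: "axis i 1 \<bullet> (\<psi> x *v nabla g (\<lambda>_. u) (\<lambda>_. axis j 1) x) =
        (\<Sum>m\<in>UNIV. u $ m * (\<Sum>a\<in>UNIV. gam g m x $ a $ j * \<psi> x $ i $ a))"
      unfolding inner_axis' matrix_vector_mult_def vec_lambda_beta nab
      by (simp add: sum_distrib_left mult_ac, rule sum.swap)
    show ?thesis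
      unfolding nabla_form2_def vec_lambda_beta 1 2
        frechet_derivative_partial[OF smooth_matrix_differentiable[OF \<psi> x]]
      by (simp add: cov_component right_diff_distrib sum_subtractf)
  qed
  then show ?thesis by (simp add: vec_eq_iff)
qed

lemma inner2_smooth:
  assumes "smooth_matrix U a" "smooth_matrix U b"
  shows "smooth_on U (\<lambda>y. inner2 (g y) (a y) (b y))"
  unfolding inner2_def
  by (intro smooth_intros U smooth_matrix_component[OF inv_smooth] smooth_matrix_component assms)

text \<open>Two uses of metric compatibility give second covariant derivatives paired with \<psi>
  plus products of first ones. The Hessian correction of the Laplacian is the correction contained
  in \<open>cov2\<close>, and the inverse metric is the sum of the tensor squares of the basis
  vectors.\<close>

lemma laplacian_half_norm:
  assumes \<psi>: "smooth_matrix U \<psi>" and x: "x \<in> U" and e: "orthonormal_basis (g x) e"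
  shows "laplacian g (\<lambda>y. 1/2 * inner2 (g y) (\<psi> y) (\<psi> y)) x =
    inner2 (g x) (\<Sum>p\<in>UNIV. lin2 (\<lambda>n m. cov2 g n m \<psi> x) (e p) (e p)) (\<psi> x)
    + norm2_nabla_form2 g e \<psi> x"
proof -
  define f where "f y = 1/2 * inner2 (g y) (\<psi> y) (\<psi> y)" for y
  have sf: "smooth_on U f"
    unfolding f_def[abs_def] by (intro smooth_on_mult smooth_on_const U inner2_smooth \<psi>)
  have p1: "partial m f y = inner2 (g y) (cov g m \<psi> y) (\<psi> y)" if y: "y \<in> U" for m y
  proof -
    have "partial m f y = 1/2 * partial m (\<lambda>y. inner2 (g y) (\<psi> y) (\<psi> y)) y"
      unfolding f_def[abs_def]
      by (rule partial_cmult[OF smooth_on_differentiable[OF inner2_smooth[OF \<psi> \<psi>] y]])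
    then show ?thesis
      unfolding partial_inner2[OF \<psi> \<psi> y] inner2_commute[OF gp[OF y], of "\<psi> y"] by simp
  qed
  have p2: "partial n (partial m f) x = inner2 (g x) (cov g n (cov g m \<psi>) x) (\<psi> x)
      + inner2 (g x) (cov g m \<psi> x) (cov g n \<psi> x)" for n m
  proof -
    have "partial n (partial m f) x = partial n (\<lambda>y. inner2 (g y) (cov g m \<psi> y) (\<psi> y)) x"
      by (rule partial_cong_open[OF U x]) (rule p1)
    then show ?thesis unfolding partial_inner2[OF cov_smooth[OF \<psi>] \<psi> x] .
  qed
  have c2: "inner2 (g x) (cov2 g n m \<psi> x) (\<psi> x) = inner2 (g x) (cov g n (cov g m \<psi>) x) (\<psi> x)
      - (\<Sum>a\<in>UNIV. gam g n x $ a $ m * partial a f x)" for n m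
    unfolding cov2_def inner2_linear_left inner2_sum_left p1[OF x] ..
  have "laplacian g f x = (\<Sum>n\<in>UNIV. \<Sum>m\<in>UNIV. \<Sum>p\<in>UNIV. e p $ n * e p $ m *
      (inner2 (g x) (cov2 g n m \<psi> x) (\<psi> x) + inner2 (g x) (cov g m \<psi> x) (cov g n \<psi> x)))"
    unfolding laplacian_formula[OF sf x] p2 c2 matrix_inv_orthonormal[OF e] sum_distrib_right
    by (simp add: algebra_simps)
  also have "\<dots> = (\<Sum>p\<in>UNIV. \<Sum>n\<in>UNIV. \<Sum>m\<in>UNIV. e p $ n * e p $ m *
      (inner2 (g x) (cov2 g n m \<psi> x) (\<psi> x) + inner2 (g x) (cov g m \<psi> x) (cov g n \<psi> x)))"
    by (rule sum_pull2)
  also have "\<dots> = (\<Sum>p\<in>UNIV. \<Sum>n\<in>UNIV. \<Sum>m\<in>UNIV. e p $ n * e p $ m * inner2 (g x) (cov2 g n m \<psi> x) (\<psi> x))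
      + (\<Sum>p\<in>UNIV. \<Sum>n\<in>UNIV. \<Sum>m\<in>UNIV. e p $ n * e p $ m * inner2 (g x) (cov g m \<psi> x) (cov g n \<psi> x))"
    by (simp add: distrib_left sum.distrib)
  also have "(\<Sum>p\<in>UNIV. \<Sum>n\<in>UNIV. \<Sum>m\<in>UNIV. e p $ n * e p $ m * inner2 (g x) (cov2 g n m \<psi> x) (\<psi> x)) =
      inner2 (g x) (\<Sum>p\<in>UNIV. lin2 (\<lambda>n m. cov2 g n m \<psi> x) (e p) (e p)) (\<psi> x)"
    unfolding inner2_sum_left lin2_linear[OF linear_matrix_maps(5)] by (simp add: lin2_def)
  also have "(\<Sum>p\<in>UNIV. \<Sum>n\<in>UNIV. \<Sum>m\<in>UNIV. e p $ n * e p $ m * inner2 (g x) (cov g m \<psi> x) (cov g n \<psi> x)) =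
      norm2_nabla_form2 g e \<psi> x"
    unfolding norm2_nabla_form2_def nabla_form2_cov[OF \<psi> x]
  proof (rule sum.cong[OF refl])
    fix p
    have r: "inner2 (g x) b (\<Sum>n\<in>UNIV. e p $ n *\<^sub>R cov g n \<psi> x) = (\<Sum>n\<in>UNIV. e p $ n * inner2 (g x) b (cov g n \<psi> x))" for b
      unfolding inner2_commute[OF gp[OF x], of b] inner2_sum_left inner2_linear_left ..
    have "inner2 (g x) (\<Sum>m\<in>UNIV. e p $ m *\<^sub>R cov g m \<psi> x) (\<Sum>n\<in>UNIV. e p $ n *\<^sub>R cov g n \<psi> x) =
       (\<Sum>n\<in>UNIV. e p $ n * (\<Sum>m\<in>UNIV. e p $ m * inner2 (g x) (cov g m \<psi> x) (cov g n \<psi> x)))"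
      unfolding r unfolding inner2_sum_left inner2_linear_left ..
    then show "(\<Sum>n\<in>UNIV. \<Sum>m\<in>UNIV. e p $ n * e p $ m * inner2 (g x) (cov g m \<psi> x) (cov g n \<psi> x)) =
        inner2 (g x) (\<Sum>m\<in>UNIV. e p $ m *\<^sub>R cov g m \<psi> x) (\<Sum>m\<in>UNIV. e p $ m *\<^sub>R cov g m \<psi> x)"
      by (simp add: sum_distrib_left mult_ac)
  qed
  finally show ?thesis unfolding f_def[abs_def] .
qed

end

section \<open>Components in an orthonormal basis at a point\<close>

definition ev4 :: "(4 \<Rightarrow> 4 \<Rightarrow> 4 \<Rightarrow> 4 \<Rightarrow> real) \<Rightarrow> real^4 \<Rightarrow> real^4 \<Rightarrow> real^4 \<Rightarrow> real^4 \<Rightarrow> real" where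
  "ev4 X u v w z = (\<Sum>n\<in>UNIV. \<Sum>m\<in>UNIV. \<Sum>a\<in>UNIV. \<Sum>b\<in>UNIV. u $ n * v $ m * w $ a * z $ b * X n m a b)"

lemma ev4_swap23: "ev4 (\<lambda>n m a b. X n a m b) u v w z = ev4 X u w v z"
  unfolding ev4_def by (rule sum.cong[OF refl]) (subst sum.swap, simp add: mult_ac)

lemma ev4_swap34: "ev4 (\<lambda>n m a b. X n m b a) u v w z = ev4 X u v z w"
  unfolding ev4_def by (rule sum.cong[OF refl], rule sum.cong[OF refl]) (subst sum.swap, simp add: mult_ac)

lemma ev4_cyclic:
  assumes "\<And>n m a b. X n m a b + X n a b m + X n b m a = 0"
  shows "ev4 X u v w z + ev4 X u w z v + ev4 X u z v w = 0"
proof -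
  have 1: "ev4 X u w z v = ev4 (\<lambda>n m a b. X n a b m) u v w z"
    using ev4_swap34[of X u w v z] ev4_swap23[of "\<lambda>n m a b. X n m b a" u v w z] by simp
  have 2: "ev4 X u z v w = ev4 (\<lambda>n m a b. X n b m a) u v w z"
    using ev4_swap23[of X u v z w] ev4_swap34[of "\<lambda>n m a b. X n a m b" u v w z] by simp
  have "ev4 X u v w z + ev4 X u w z v + ev4 X u z v w =
      ev4 (\<lambda>n m a b. X n m a b + X n a b m + X n b m a) u v w z"
    unfolding 1 2 by (simp add: ev4_def distrib_left sum.distrib)
  also have "\<dots> = 0" unfolding assms by (simp add: ev4_def)
  finally show ?thesis .
qed

lemma lin2_eval_ev4: "w \<bullet> (lin2 M u v *v z) = ev4 (\<lambda>n m a b. M n m $ a $ b) u v w z"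
  unfolding lin2_linear[OF linear_matrix_maps(2)] unfolding lin2_def ev4_def inner_matrix_sum
  by (simp add: sum_distrib_left mult_ac)

context metric_patch
begin

lemma cov2_skew:
  assumes \<psi>: "smooth_matrix U \<psi>" and skew: "\<And>y. y \<in> U \<Longrightarrow> transpose (\<psi> y) = - \<psi> y" and x: "x \<in> U"
  shows "transpose (cov2 g n m \<psi> x) = - cov2 g n m \<psi> x"
proof -
  have s1: "transpose (cov g m \<psi> y) = - cov g m \<psi> y" if "y \<in> U" for y m
    by (rule cov_skew[OF \<psi>]) (simp_all add: skew that)
  have s2: "transpose (cov g n (cov g m \<psi>) x) = - cov g n (cov g m \<psi>) x"
    by (rule cov_skew[OF cov_smooth[OF \<psi>]]) (simp_all add: s1 x)
  have l: "linear (\<lambda>M::real^4^4. transpose M)" by (rule linear_matrix_maps(6))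
  have "transpose (\<Sum>a\<in>UNIV. gam g n x $ a $ m *\<^sub>R cov g a \<psi> x) =
      (\<Sum>a\<in>UNIV. gam g n x $ a $ m *\<^sub>R transpose (cov g a \<psi> x))"
    unfolding linear_sum[OF l] linear_scale[OF l] ..
  then show ?thesis
    unfolding cov2_def transpose_linear s2 s1[OF x] by (simp add: sum_negf)
qed

text \<open>The coordinate identities for \<open>cov2\<close> and \<open>curv\<close> are
  multilinear and therefore hold for components in the basis \<open>e\<close> at \<open>x\<close>,
  where they become the hypotheses of \<open>weitzenboeck_algebra\<close>. Pairing with \<psi> sees
  only the 12 and 34 components of the rough Laplacian.\<close>

lemma weitzenboeck:
  assumes \<psi>: "smooth_matrix U \<psi>" and skew: "\<And>y. y \<in> U \<Longrightarrow> transpose (\<psi> y) = - \<psi> y"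
    and closed: "\<And>y. y \<in> U \<Longrightarrow> d2 \<psi> y = 0"
    and coclosed: "\<And>y j. y \<in> U \<Longrightarrow> (\<Sum>m\<in>UNIV. partial m (\<lambda>y. raised g \<psi> y $ m $ j) y) = 0"
    and x: "x \<in> U" and e: "orthonormal_basis (g x) e" and s: "s = 1 \<or> s = -1"
    and ev: "\<And>p q. e p \<bullet> (\<psi> x *v e q) =
      \<alpha> * (((if p = 1 \<and> q = 2 then 1 else 0) - (if p = 2 \<and> q = 1 then 1 else 0))
      + s * ((if p = 3 \<and> q = 4 then 1 else 0) - (if p = 4 \<and> q = 3 then 1 else 0)))"
  defines "R \<equiv> \<lambda>i j k l. Riem g x (e i) (e j) (e k) (e l)"
  shows "laplacian g (\<lambda>y. 1/2 * inner2 (g y) (\<psi> y) (\<psi> y)) x = norm2_nabla_form2 g e \<psi> x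
      + \<alpha> * \<alpha> * (2 * (R 1 3 1 3 + R 1 4 1 4 + R 2 3 2 3 + R 2 4 2 4) - 4 * s * R 1 2 3 4)"
    and "1/2 * inner2 (g x) (\<psi> x) (\<psi> x) = \<alpha> * \<alpha>"
proof -
  define \<Psi> where "\<Psi> p q = ((if p = 1 \<and> q = 2 then 1 else 0) - (if p = 2 \<and> q = 1 then 1 else 0))
      + s * ((if p = 3 \<and> q = 4 then 1 else 0) - (if p = 4 \<and> q = 3 then 1 else 0))" for p q :: 4
  have ev': "e p \<bullet> (\<psi> x *v e q) = \<alpha> * \<Psi> p q" for p q unfolding \<Psi>_def by (rule ev)
  define T where "T p q = lin2 (\<lambda>n m. cov2 g n m \<psi> x) (e p) (e q)" for p q
  define t where "t p q i j = e i \<bullet> (T p q *v e j)" for p q i j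
  define M where "M p q = lin2 (\<lambda>n m. curv g n m x) (e p) (e q)" for p q
  define r where "r p q i k = (M p q *v e i) \<bullet> (g x *v e k)" for p q i k
  have t_ev4: "t p q i j = ev4 (\<lambda>n m a b. cov2 g n m \<psi> x $ a $ b) (e p) (e q) (e i) (e j)" for p q i j
    unfolding t_def T_def by (rule lin2_eval_ev4)
  have Tskew: "transpose (T p q) = - T p q" for p q
  proof -
    have "transpose (cov2 g n m \<psi> x) = - cov2 g n m \<psi> x" for n m
      by (rule cov2_skew[OF \<psi>]) (simp_all add: skew x)
    then show ?thesis unfolding T_def lin2_linear[OF linear_matrix_maps(6)] lin2_minus[symmetric] by simp
  qed
  have t_skew: "t p q i j = - t p q j i" for p q i j
    unfolding t_def by (rule skew_eval[OF Tskew])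
  have t_cyc: "t p q i j + t p i j q + t p j q i = 0" for p q i j
    unfolding t_ev4
  proof (rule ev4_cyclic)
    fix n m a b
    show "cov2 g n m \<psi> x $ a $ b + cov2 g n a \<psi> x $ b $ m + cov2 g n b \<psi> x $ m $ a = 0"
      by (rule cov2_cyclic[OF \<psi>]) (simp_all add: skew closed x)
  qed
  have t_tr: "(\<Sum>q\<in>UNIV. t p q q j) = 0" for p j
  proof -
    have "(\<Sum>q\<in>UNIV. t p q q j) = (\<Sum>n\<in>UNIV. \<Sum>m\<in>UNIV. \<Sum>a\<in>UNIV. \<Sum>b\<in>UNIV. \<Sum>q\<in>UNIV.
        e p $ n * e q $ m * e q $ a * e j $ b * cov2 g n m \<psi> x $ a $ b)"
      unfolding t_ev4 ev4_def by (rule sum_pull4[symmetric])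
    also have "\<dots> = (\<Sum>n\<in>UNIV. \<Sum>m\<in>UNIV. \<Sum>a\<in>UNIV. \<Sum>b\<in>UNIV.
        e p $ n * e j $ b * (matrix_inv (g x) $ m $ a * cov2 g n m \<psi> x $ a $ b))"
      unfolding matrix_inv_orthonormal[OF e] by (simp add: sum_distrib_left sum_distrib_right mult_ac)
    also have "\<dots> = (\<Sum>n\<in>UNIV. \<Sum>b\<in>UNIV. \<Sum>m\<in>UNIV. \<Sum>a\<in>UNIV.
        e p $ n * e j $ b * (matrix_inv (g x) $ m $ a * cov2 g n m \<psi> x $ a $ b))"
      by (intro sum.cong[OF refl] sum_pull2)
    also have "\<dots> = (\<Sum>n\<in>UNIV. \<Sum>b\<in>UNIV. e p $ n * e j $ b *
        (\<Sum>m\<in>UNIV. \<Sum>a\<in>UNIV. matrix_inv (g x) $ m $ a * cov2 g n m \<psi> x $ a $ b))"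
      by (simp add: sum_distrib_left)
    also have "\<dots> = 0"
    proof -
      have "(\<Sum>m\<in>UNIV. \<Sum>a\<in>UNIV. matrix_inv (g x) $ m $ a * cov2 g n m \<psi> x $ a $ b) = 0" for n b
        by (rule cov2_trace[OF \<psi>]) (simp_all add: skew coclosed x)
      then show ?thesis by simp
    qed
    finally show ?thesis .
  qed
  \<comment> \<open>The scalar \<alpha> is absorbed into the curvature, since normalising \<psi> by
    division would fail at points where it vanishes.\<close>
  have t_com: "t p q i j - t q p i j =
      - (\<Sum>k\<in>UNIV. (\<alpha> * r p q i k) * \<Psi> k j) - (\<Sum>k\<in>UNIV. (\<alpha> * r p q j k) * \<Psi> i k)" for p q i j
  proof -
    have "T p q - T q p = lin2 (\<lambda>n m. - (transpose (curv g n m x) ** \<psi> x) - \<psi> x ** curv g n m x) (e p) (e q)"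
      unfolding T_def lin2_swap[of "\<lambda>n m. cov2 g n m \<psi> x" "e p" "e q", symmetric] lin2_diff cov2_commute[OF \<psi> x] ..
    also have "\<dots> = - (transpose (M p q) ** \<psi> x) - \<psi> x ** M p q"
      unfolding M_def by (rule lin2_linear[OF linear_matrix_maps(3), symmetric])
    finally have T: "T p q - T q p = - (transpose (M p q) ** \<psi> x) - \<psi> x ** M p q" .
    have w: "M p q *v e i = (\<Sum>k\<in>UNIV. r p q i k *\<^sub>R e k)" for i
      unfolding r_def by (rule orthonormal_expansion[OF e gp[OF x]])
    have "t p q i j - t q p i j = e i \<bullet> ((T p q - T q p) *v e j)"
      unfolding t_def by (simp add: matrix_vector_mult_diff_rdistrib inner_diff_right)
    also have "\<dots> = - ((M p q *v e i) \<bullet> (\<psi> x *v e j)) - e i \<bullet> (\<psi> x *v (M p q *v e j))"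
    proof -
      have "e i \<bullet> (transpose (M p q) ** \<psi> x *v e j) = (M p q *v e i) \<bullet> (\<psi> x *v e j)"
        by (metis dot_lmul_matrix matrix_vector_mul_assoc vector_transpose_matrix transpose_transpose inner_commute)
      moreover have "(- a) *v v = - (a *v v)" for a :: "real^4^4" and v
        by (simp add: vec_eq_iff matrix_vector_mult_def sum_negf)
      ultimately show ?thesis
        unfolding T matrix_vector_mult_diff_rdistrib inner_diff_right by (simp add: matrix_vector_mul_assoc)
    qed
    also have "(M p q *v e i) \<bullet> (\<psi> x *v e j) = (\<Sum>k\<in>UNIV. (\<alpha> * r p q i k) * \<Psi> k j)"
      unfolding w inner_sum_left inner_scaleR_left ev' by (simp add: mult_ac)
    also have "e i \<bullet> (\<psi> x *v (M p q *v e j)) = (\<Sum>k\<in>UNIV. (\<alpha> * r p q j k) * \<Psi> i k)"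
    proof -
      have l: "linear ((*v) (\<psi> x))" by simp
      show ?thesis
        unfolding w linear_sum[OF l] linear_scale[OF l] inner_sum_right inner_scaleR_right ev' by (simp add: mult_ac)
    qed
    finally show ?thesis .
  qed
  have M_swap: "M p q = - M q p" for p q
  proof -
    have "(\<lambda>n m. curv g n m x) = (\<lambda>n m. - curv g m n x)" by (intro ext) (rule curv_swap)
    then have "M p q = lin2 (\<lambda>n m. - curv g m n x) (e p) (e q)" unfolding M_def by (rule arg_cong)
    also have "\<dots> = - M q p"
      unfolding M_def lin2_minus by (rule arg_cong[OF lin2_swap[of "\<lambda>n m. curv g n m x"]])
    finally show ?thesis .
  qed
  have r1: "r p q i k = - r q p i k" for p q i k
  proof -
    have "(- a) *v v = - (a *v v)" for a :: "real^4^4" and v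
      by (simp add: vec_eq_iff matrix_vector_mult_def sum_negf)
    then show ?thesis unfolding r_def M_swap[of p q] by simp
  qed
  have r2: "r p q i k = - r p q k i" for p q i k
  proof -
    have "transpose (M p q) ** g x + g x ** M p q = lin2 (\<lambda>n m. transpose (curv g n m x) ** g x + g x ** curv g n m x) (e p) (e q)"
      unfolding M_def by (rule lin2_linear[OF linear_matrix_maps(4)])
    also have "\<dots> = 0" unfolding curv_skew_metric[OF x] by (simp add: lin2_def)
    finally have z: "e i \<bullet> ((transpose (M p q) ** g x + g x ** M p q) *v e k) = 0" by simp
    have "e i \<bullet> (transpose (M p q) ** g x *v e k) = r p q i k"
      unfolding r_def
      by (metis dot_lmul_matrix matrix_vector_mul_assoc vector_transpose_matrix transpose_transpose inner_commute)
    moreover have "e i \<bullet> (g x ** M p q *v e k) = r p q k i"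
      unfolding r_def matrix_vector_mul_assoc[symmetric] by (rule posdef_commute[OF gp[OF x]])
    ultimately show ?thesis using z by (simp add: matrix_vector_add_scaleR inner_add_right)
  qed
  have r3: "r p q i k + r q i p k + r i p q k = 0" for p q i k
  proof -
    have c: "(lin2 (\<lambda>n m. curv g n m x) u v *v w) $ a =
        (\<Sum>n\<in>UNIV. \<Sum>m\<in>UNIV. \<Sum>k\<in>UNIV. u $ n * v $ m * w $ k * curv g n m x $ a $ k)" for u v w a
      unfolding lin2_linear[OF linear_matrix_maps(1)] lin2_def sum_component
      by (simp add: matrix_vector_mult_def sum_distrib_left mult_ac) (rule sum_pull2[symmetric])
    have "(M p q *v e i + M q i *v e p + M i p *v e q) $ a = 0" for a
    proof -
      have "(M q i *v e p) $ a = (\<Sum>n\<in>UNIV. \<Sum>m\<in>UNIV. \<Sum>k\<in>UNIV. e p $ n * e q $ m * e i $ k * curv g m k x $ a $ n)"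
        unfolding M_def c by (rule trans[OF sum_pull2]) (simp add: mult_ac)
      moreover have "(M i p *v e q) $ a = (\<Sum>n\<in>UNIV. \<Sum>m\<in>UNIV. \<Sum>k\<in>UNIV. e p $ n * e q $ m * e i $ k * curv g k n x $ a $ m)"
        unfolding M_def c by (rule trans[OF _ sum_pull2[symmetric]]) (simp add: mult_ac)
      moreover have "(M p q *v e i) $ a = (\<Sum>n\<in>UNIV. \<Sum>m\<in>UNIV. \<Sum>k\<in>UNIV. e p $ n * e q $ m * e i $ k * curv g n m x $ a $ k)"
        unfolding M_def c ..
      ultimately have "(M p q *v e i + M q i *v e p + M i p *v e q) $ a =
          (\<Sum>n\<in>UNIV. \<Sum>m\<in>UNIV. \<Sum>k\<in>UNIV. e p $ n * e q $ m * e i $ k *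
            (curv g n m x $ a $ k + curv g m k x $ a $ n + curv g k n x $ a $ m))"
        by (simp add: distrib_left sum.distrib)
      then show ?thesis unfolding curv_bianchi[OF x] by simp
    qed
    then have "M p q *v e i + M q i *v e p + M i p *v e q = 0" by (simp only: vec_eq_iff) simp
    then have "(M p q *v e i + M q i *v e p + M i p *v e q) \<bullet> (g x *v e k) = 0" by simp
    then show ?thesis unfolding r_def inner_add_left .
  qed
  have ar1: "\<alpha> * r p q i k = - (\<alpha> * r q p i k)" and ar2: "\<alpha> * r p q i k = - (\<alpha> * r p q k i)" for p q i k
    using r1[of p q i k] r2[of p q i k] by simp_all
  have ar3: "\<alpha> * r p q i k + \<alpha> * r q i p k + \<alpha> * r i p q k = 0" for p q i k
    unfolding distrib_left[symmetric] r3 by simp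
  note S = weitzenboeck_algebra[of t "\<lambda>p q i k. \<alpha> * r p q i k" \<Psi> s, OF t_skew t_cyc t_tr t_com ar1 ar2 ar3 s \<Psi>_def]
  show "1/2 * inner2 (g x) (\<psi> x) (\<psi> x) = \<alpha> * \<alpha>"
    unfolding inner2_orthonormal[OF e] ev' sum_4 \<Psi>_def using s by auto
  have "inner2 (g x) (\<Sum>p\<in>UNIV. T p p) (\<psi> x) =
      1/2 * (\<Sum>i\<in>UNIV. \<Sum>j\<in>UNIV. (\<Sum>p\<in>UNIV. t p p i j) * (\<alpha> * \<Psi> i j))"
  proof -
    have l: "linear (\<lambda>M::real^4^4. e i \<bullet> (M *v e j))" for i j by (rule linear_matrix_maps(2))
    show ?thesis unfolding inner2_orthonormal[OF e] ev' linear_sum[OF l] t_def ..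
  qed
  also have "\<dots> = 1/2 * \<alpha> * ((\<Sum>p\<in>UNIV. t p p 1 2) - (\<Sum>p\<in>UNIV. t p p 2 1)
      + s * ((\<Sum>p\<in>UNIV. t p p 3 4) - (\<Sum>p\<in>UNIV. t p p 4 3)))"
  proof -
    have "1/2 * (\<Sum>i\<in>UNIV. \<Sum>j\<in>UNIV. S i j * (\<alpha> * \<Psi> i j)) =
        1/2 * \<alpha> * (S 1 2 - S 2 1 + s * (S 3 4 - S 4 3))" for S :: "4 \<Rightarrow> 4 \<Rightarrow> real"
      unfolding sum_4 \<Psi>_def by (simp add: algebra_simps)
    then show ?thesis .
  qed
  also have "(\<Sum>p\<in>UNIV. t p p 2 1) = - (\<Sum>p\<in>UNIV. t p p 1 2)"
    unfolding sum_negf[symmetric] by (rule sum.cong[OF refl]) (rule t_skew)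
  also have "(\<Sum>p\<in>UNIV. t p p 4 3) = - (\<Sum>p\<in>UNIV. t p p 3 4)"
    unfolding sum_negf[symmetric] by (rule sum.cong[OF refl]) (rule t_skew)
  finally have I: "inner2 (g x) (\<Sum>p\<in>UNIV. T p p) (\<psi> x) =
      \<alpha> * ((\<Sum>p\<in>UNIV. t p p 1 2) + s * (\<Sum>p\<in>UNIV. t p p 3 4))" by (simp add: algebra_simps)
  \<comment> \<open>The opposite sign conventions of \<open>Riem\<close> and \<open>curv\<close>
    make the sectional curvatures enter the final formula with a plus sign.\<close>
  have Rr: "R i j k l = - r i j k l" for i j k l
    unfolding R_def r_def M_def by (rule Riem_curv[OF x])
  have "inner2 (g x) (\<Sum>p\<in>UNIV. T p p) (\<psi> x) =
      \<alpha> * \<alpha> * (2 * (R 1 3 1 3 + R 1 4 1 4 + R 2 3 2 3 + R 2 4 2 4) - 4 * s * R 1 2 3 4)"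
    unfolding I S Rr using s by (auto simp: algebra_simps)
  then show "laplacian g (\<lambda>y. 1/2 * inner2 (g y) (\<psi> y) (\<psi> y)) x = norm2_nabla_form2 g e \<psi> x
      + \<alpha> * \<alpha> * (2 * (R 1 3 1 3 + R 1 4 1 4 + R 2 3 2 3 + R 2 4 2 4) - 4 * s * R 1 2 3 4)"
    unfolding laplacian_half_norm[OF \<psi> x e] T_def by simp
qed

text \<open>Second derivatives of the product give two cross terms; symmetry of the inverse metric
  identifies each with the inner product of the gradients.\<close>

lemma laplacian_mult:
  assumes F: "smooth_on U F" and G: "smooth_on U G" and x: "x \<in> U"
  shows "laplacian g (\<lambda>y. F y * G y) x =
    F x * laplacian g G x + G x * laplacian g F x + 2 * (grad g F x \<bullet> (g x *v grad g G x))"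
proof -
  note dF = smooth_on_differentiable[OF F] and dG = smooth_on_differentiable[OF G]
  note dpF = smooth_on_differentiable[OF smooth_on_partial[OF F]]
    and dpG = smooth_on_differentiable[OF smooth_on_partial[OF G]]
  have p1: "partial m (\<lambda>y. F y * G y) y = partial m F y * G y + F y * partial m G y" if "y \<in> U" for y m
    by (rule partial_mult[OF dF[OF that] dG[OF that]])
  have p2: "partial n (partial m (\<lambda>y. F y * G y)) x = partial n (partial m F) x * G x + partial m F x * partial n G x
      + (partial n F x * partial m G x + F x * partial n (partial m G) x)" for n m
  proof -
    have "partial n (partial m (\<lambda>y. F y * G y)) x = partial n (\<lambda>y. partial m F y * G y + F y * partial m G y) x"
      by (rule partial_cong_open[OF U x]) (rule p1)
    also have "\<dots> = partial n (\<lambda>y. partial m F y * G y) x + partial n (\<lambda>y. F y * partial m G y) x"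
      by (intro partial_add differentiable_mult dF dG dpF dpG x)
    finally show ?thesis
      unfolding partial_mult[OF dpF[OF x] dG[OF x]] partial_mult[OF dF[OF x] dpG[OF x]] .
  qed
  define h where "h = matrix_inv (g x)"
  have hs: "h $ i $ j = h $ j $ i" for i j
    using arg_cong[OF posdef_inv(4)[OF gp[OF x]], of "\<lambda>m. m $ j $ i"] by (simp add: transpose_def h_def)
  have gr: "grad g F x \<bullet> (g x *v grad g G x) = (\<Sum>n\<in>UNIV. \<Sum>m\<in>UNIV. h $ n $ m * (partial m F x * partial n G x))"
  proof -
    have "g x *v grad g G x = (\<chi> i. partial i G x)"
      unfolding grad_def matrix_vector_mul_assoc posdef_inv(3)[OF gp[OF x]] by simp
    then show ?thesis
      unfolding grad_def h_def inner_vec_def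
      by (simp add: matrix_vector_mult_def sum_distrib_left sum_distrib_right mult_ac)
  qed
  have gr': "grad g F x \<bullet> (g x *v grad g G x) = (\<Sum>n\<in>UNIV. \<Sum>m\<in>UNIV. h $ n $ m * (partial n F x * partial m G x))"
    unfolding gr by (subst sum.swap) (intro sum.cong refl arg_cong2[where f = "(*)"] hs)
  have "laplacian g (\<lambda>y. F y * G y) x = (\<Sum>n\<in>UNIV. \<Sum>m\<in>UNIV.
      F x * (h $ n $ m * (partial n (partial m G) x - (\<Sum>a\<in>UNIV. gam g n x $ a $ m * partial a G x)))
      + G x * (h $ n $ m * (partial n (partial m F) x - (\<Sum>a\<in>UNIV. gam g n x $ a $ m * partial a F x)))
      + h $ n $ m * (partial m F x * partial n G x) + h $ n $ m * (partial n F x * partial m G x))"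
    unfolding laplacian_formula[OF smooth_on_mult[OF U F G] x] p2 p1[OF x] h_def[symmetric]
    by (intro sum.cong refl) (simp add: algebra_simps sum.distrib sum_distrib_left)
  also have "\<dots> = F x * laplacian g G x + G x * laplacian g F x
      + grad g F x \<bullet> (g x *v grad g G x) + grad g F x \<bullet> (g x *v grad g G x)"
    unfolding laplacian_formula[OF F x] laplacian_formula[OF G x] h_def[symmetric] sum.distrib
    unfolding gr[symmetric] gr'[symmetric] sum_distrib_left ..
  finally show ?thesis by simp
qed

end

text \<open>The Euclidean star exchanges the index pairs 12 and 34. Each pair is counted in both
  orders, which cancels the factor 1/2 in \<open>hodge_frame\<close>.\<close>

lemma hodge_adapted:
  assumes e: "orthonormal_basis G e"
    and a: "\<And>p q. e p \<bullet> (a *v e q) =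
     l1 * ((if p = 1 \<and> q = 2 then 1 else 0) - (if p = 2 \<and> q = 1 then 1 else 0))
     + l2 * ((if p = 3 \<and> q = 4 then 1 else 0) - (if p = 4 \<and> q = 3 then 1 else 0))"
  shows "e p \<bullet> (hodge G a *v e q) = orientation G e *
     (l2 * ((if p = 1 \<and> q = 2 then 1 else 0) - (if p = 2 \<and> q = 1 then 1 else 0))
     + l1 * ((if p = 3 \<and> q = 4 then 1 else 0) - (if p = 4 \<and> q = 3 then 1 else 0)))"
proof -
  have "\<forall>p q. dual2 (transpose (frame_matrix e) ** a ** frame_matrix e) $ p $ q =
     2 * (l2 * ((if p = 1 \<and> q = 2 then 1 else 0) - (if p = 2 \<and> q = 1 then 1 else 0))
     + l1 * ((if p = 3 \<and> q = 4 then 1 else 0) - (if p = 4 \<and> q = 3 then 1 else 0)))"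
    unfolding dual2_def frame_matrix_congruence a vec_lambda_beta forall_4 sum_4
    by (simp add: levi_civita_values levi_civita_eq0)
  then show ?thesis unfolding hodge_frame[OF e] by simp
qed

lemma d2_linear:
  assumes "smooth_matrix S a" "smooth_matrix S b" "x \<in> S"
  shows "d2 (\<lambda>y. a y + b y) x = d2 a x + d2 b x" "d2 (\<lambda>y. a y - b y) x = d2 a x - d2 b x"
  by (simp_all add: d2_def vec_eq_iff partial_add partial_diff smooth_matrix_differentiable[OF _ assms(3)] assms(1,2))

lemma raised_linear:
  "raised g (\<lambda>y. a y + b y) y = raised g a y + raised g b y"
  "raised g (\<lambda>y. a y - b y) y = raised g a y - raised g b y"
  by (simp_all add: raised_def matrix_distribs algebra_simps)

theorem theorem2p1:
  fixes A :: "('a::t2_space) chart set"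
    and g \<phi> :: "'a chart \<Rightarrow> real^4 \<Rightarrow> real^4^4"
  assumes "smooth_oriented_atlas A"
    and "compact (UNIV :: 'a set)"
    and "riemannian_metric A g"
    and "harmonic_form2 A g \<phi>"
  shows "\<forall>p. \<forall>c\<in>A. p \<in> chart_dom c \<longrightarrow>
    (let x = chart_map c p;
         \<phi>p = (\<lambda>y. \<phi> c y + hodge (g c y) (\<phi> c y));
         \<phi>m = (\<lambda>y. \<phi> c y - hodge (g c y) (\<phi> c y));
         F = (\<lambda>y. 1/2 * inner2 (g c y) (\<phi>p y) (\<phi>p y));
         G = (\<lambda>y. 1/2 * inner2 (g c y) (\<phi>m y) (\<phi>m y));
         R = (\<lambda>e i j k l. Riem (g c) x (e i) (e j) (e k) (e l));
         K = (\<lambda>e. 1/2 * (R e 1 3 1 3 + R e 1 4 1 4 + R e 2 3 2 3 + R e 2 4 2 4))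
     in (\<exists>e. adapted_basis (g c x) (\<phi> c x) e) \<and>
        (\<forall>e. adapted_basis (g c x) (\<phi> c x) e \<longrightarrow>
           laplacian (g c) (\<lambda>y. F y * G y) x =
             8 * K e * F x * G x
             + G x * norm2_nabla_form2 (g c) e \<phi>p x
             + F x * norm2_nabla_form2 (g c) e \<phi>m x
             + 2 * (grad (g c) F x \<bullet> (g c x *v grad (g c) G x))))"
proof (intro allI ballI impI)
  fix p c assume c: "c \<in> A" and p: "p \<in> chart_dom c"
  interpret oriented_riemannian A g by unfold_locales (fact assms)+
  define x where "x = chart_map c p"
  define V where "V = chart_img c"
  define \<psi> where "\<psi> y = hodge (g c y) (\<phi> c y)" for y
  define P where "P y = \<phi> c y + \<psi> y" for y
  define N where "N y = \<phi> c y - \<psi> y" for y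
  have x: "x \<in> V" unfolding x_def V_def by (rule chart_map_img[OF c p])
  have \<phi>: "form2 A \<phi>" using assms(4) unfolding harmonic_form2_def by (rule conjunct1)
  have V: "open V" unfolding V_def by (rule chart_open(2)[OF c])
  interpret metric_patch V "g c"
  proof
    show "open V" by (rule V)
    show "smooth_matrix V (g c)" unfolding smooth_matrix_def V_def using metric_smooth[OF c] by simp
    show "posdef (g c y)" if "y \<in> V" for y using metric_posdef[OF c] that by (simp add: V_def)
  qed
  have s\<phi>: "smooth_matrix V (\<phi> c)"
    unfolding smooth_matrix_def V_def using form2_smooth[OF \<phi> c] by simp
  have s\<psi>: "smooth_matrix V \<psi>"
    unfolding smooth_matrix_def V_def \<psi>_def using hodge_smooth[OF \<phi> c] by simp
  have sP: "smooth_matrix V P" unfolding P_def[abs_def] by (rule smooth_matrix_add[OF V s\<phi> s\<psi>])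
  have sN: "smooth_matrix V N" unfolding N_def[abs_def] by (rule smooth_matrix_diff[OF V s\<phi> s\<psi>])
  have k\<phi>: "transpose (\<phi> c y) = - \<phi> c y" if "y \<in> V" for y
    using form2_skew[OF \<phi> c] that by (simp add: V_def)
  have k\<psi>: "transpose (\<psi> y) = - \<psi> y" for y unfolding \<psi>_def by (rule hodge_skew)
  have kP: "transpose (P y) = - P y" and kN: "transpose (N y) = - N y" if "y \<in> V" for y
    unfolding P_def N_def transpose_linear k\<psi> k\<phi>[OF that] by simp_all
  have d\<phi>: "d2 (\<phi> c) y = 0" and d\<psi>: "d2 \<psi> y = 0" if "y \<in> V" for y
    using harmonic_closed_coclosed(1)[OF assms(4) c] hodge_closed[OF assms(4) c] that
    by (simp_all add: V_def \<psi>_def[abs_def])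
  have dP: "d2 P y = 0" and dN: "d2 N y = 0" if "y \<in> V" for y
    unfolding P_def[abs_def] N_def[abs_def] d2_linear[OF s\<phi> s\<psi> that] d\<phi>[OF that] d\<psi>[OF that] by simp_all
  have r\<phi>: "(\<Sum>m\<in>UNIV. partial m (\<lambda>y. raised (g c) (\<phi> c) y $ m $ j) y) = 0"
    and r\<psi>: "(\<Sum>m\<in>UNIV. partial m (\<lambda>y. raised (g c) \<psi> y $ m $ j) y) = 0" if "y \<in> V" for y j
    using coclosed[OF assms(4) c] hodge_coclosed[OF assms(4) c] that
    by (simp_all add: V_def \<psi>_def[abs_def])
  have dr: "(\<lambda>y. raised (g c) a y $ m $ j) differentiable (at y)" if "smooth_matrix V a" "y \<in> V" for a m j y
    using smooth_on_differentiable[OF raised_smooth[OF c]] that by (simp add: V_def smooth_matrix_def)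
  have rP: "(\<Sum>m\<in>UNIV. partial m (\<lambda>y. raised (g c) P y $ m $ j) y) = 0"
    and rN: "(\<Sum>m\<in>UNIV. partial m (\<lambda>y. raised (g c) N y $ m $ j) y) = 0" if y: "y \<in> V" for y j
    unfolding P_def[abs_def] N_def[abs_def] raised_linear vector_add_component vector_minus_component
      partial_add[OF dr[OF s\<phi> y] dr[OF s\<psi> y]] partial_diff[OF dr[OF s\<phi> y] dr[OF s\<psi> y]]
      sum.distrib sum_subtractf r\<phi>[OF y] r\<psi>[OF y] by simp_all
  define F where "F y = 1/2 * inner2 (g c y) (P y) (P y)" for y
  define G where "G y = 1/2 * inner2 (g c y) (N y) (N y)" for y
  have sF: "smooth_on V F" and sG: "smooth_on V G"
    unfolding F_def[abs_def] G_def[abs_def]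
    by (intro smooth_on_mult smooth_on_const V inner2_smooth sP sN)+
  have ex: "\<exists>e. adapted_basis (g c x) (\<phi> c x) e"
    by (rule exists_adapted_basis[OF gp[OF x] k\<phi>[OF x]])
  have main: "laplacian (g c) (\<lambda>y. F y * G y) x =
      8 * (1/2 * (Riem (g c) x (e 1) (e 3) (e 1) (e 3) + Riem (g c) x (e 1) (e 4) (e 1) (e 4)
        + Riem (g c) x (e 2) (e 3) (e 2) (e 3) + Riem (g c) x (e 2) (e 4) (e 2) (e 4))) * F x * G x
      + G x * norm2_nabla_form2 (g c) e P x + F x * norm2_nabla_form2 (g c) e N x
      + 2 * (grad (g c) F x \<bullet> (g c x *v grad (g c) G x))"
    if ad: "adapted_basis (g c x) (\<phi> c x) e" for e
  proof -
    have e: "orthonormal_basis (g c x) e" using ad unfolding adapted_basis_def by (rule conjunct1)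
    obtain l1 l2 where l: "\<And>p q. e p \<bullet> (\<phi> c x *v e q) =
       l1 * ((if p = 1 \<and> q = 2 then 1 else 0) - (if p = 2 \<and> q = 1 then 1 else 0))
       + l2 * ((if p = 3 \<and> q = 4 then 1 else 0) - (if p = 4 \<and> q = 3 then 1 else 0))"
      using adapted_basis_eval[OF ad] by metis
    define s where "s = orientation (g c x) e"
    have s2: "s * s = 1" unfolding s_def by (rule orientation_square[OF e posdef_inv(5)[OF gp[OF x]]])
    then have s: "s = 1 \<or> s = -1" by (simp add: square_eq_1_iff)
    have s': "- s = 1 \<or> - s = -1" using s by auto
    note h = hodge_adapted[OF e l, folded \<psi>_def s_def]
    \<comment> \<open>As s * s = 1, the coefficient \<open>l2 + s * l1\<close> of the second block
      equals \<open>s * (l1 + s * l2)\<close>. For the difference below the same computation gives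
      the opposite sign.\<close>
    have evP: "e p \<bullet> (P x *v e q) = (l1 + s * l2) *
       (((if p = 1 \<and> q = 2 then 1 else 0) - (if p = 2 \<and> q = 1 then 1 else 0))
       + s * ((if p = 3 \<and> q = 4 then 1 else 0) - (if p = 4 \<and> q = 3 then 1 else 0)))" for p q
      unfolding P_def matrix_vector_mult_add_rdistrib inner_add_right l h using s by auto
    have evN: "e p \<bullet> (N x *v e q) = (l1 - s * l2) *
       (((if p = 1 \<and> q = 2 then 1 else 0) - (if p = 2 \<and> q = 1 then 1 else 0))
       + (- s) * ((if p = 3 \<and> q = 4 then 1 else 0) - (if p = 4 \<and> q = 3 then 1 else 0)))" for p q
      unfolding N_def matrix_vector_mult_diff_rdistrib inner_diff_right l h using s by auto
    have LF: "laplacian (g c) F x = norm2_nabla_form2 (g c) e P x + F x * (2 *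
        (Riem (g c) x (e 1) (e 3) (e 1) (e 3) + Riem (g c) x (e 1) (e 4) (e 1) (e 4)
        + Riem (g c) x (e 2) (e 3) (e 2) (e 3) + Riem (g c) x (e 2) (e 4) (e 2) (e 4))
        - 4 * s * Riem (g c) x (e 1) (e 2) (e 3) (e 4))"
    proof -
      have "F x = (l1 + s * l2) * (l1 + s * l2)" unfolding F_def
        by (rule weitzenboeck(2)[OF sP _ _ _ x e s evP]) (erule kP dP rP)+
      then show ?thesis unfolding F_def[abs_def]
        by (simp only:) (rule weitzenboeck(1)[OF sP _ _ _ x e s evP], (erule kP dP rP)+)
    qed
    have LG: "laplacian (g c) G x = norm2_nabla_form2 (g c) e N x + G x * (2 *
        (Riem (g c) x (e 1) (e 3) (e 1) (e 3) + Riem (g c) x (e 1) (e 4) (e 1) (e 4)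
        + Riem (g c) x (e 2) (e 3) (e 2) (e 3) + Riem (g c) x (e 2) (e 4) (e 2) (e 4))
        - 4 * (- s) * Riem (g c) x (e 1) (e 2) (e 3) (e 4))"
    proof -
      have "G x = (l1 - s * l2) * (l1 - s * l2)" unfolding G_def
        by (rule weitzenboeck(2)[OF sN _ _ _ x e s' evN]) (erule kN dN rN)+
      then show ?thesis unfolding G_def[abs_def]
        by (simp only:) (rule weitzenboeck(1)[OF sN _ _ _ x e s' evN], (erule kN dN rN)+)
    qed
    \<comment> \<open>The four sectional curvatures add up to 2 K, so each Laplacian contributes 4
      K, and the product rule brings in two of them with the common factor
      \<open>F x * G x\<close>.\<close>
    show ?thesis
      unfolding laplacian_mult[OF sF sG x] LF LG by (simp add: algebra_simps)
  qed
  show "let x = chart_map c p;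
         \<phi>p = (\<lambda>y. \<phi> c y + hodge (g c y) (\<phi> c y));
         \<phi>m = (\<lambda>y. \<phi> c y - hodge (g c y) (\<phi> c y));
         F = (\<lambda>y. 1/2 * inner2 (g c y) (\<phi>p y) (\<phi>p y));
         G = (\<lambda>y. 1/2 * inner2 (g c y) (\<phi>m y) (\<phi>m y));
         R = (\<lambda>e i j k l. Riem (g c) x (e i) (e j) (e k) (e l));
         K = (\<lambda>e. 1/2 * (R e 1 3 1 3 + R e 1 4 1 4 + R e 2 3 2 3 + R e 2 4 2 4))
     in (\<exists>e. adapted_basis (g c x) (\<phi> c x) e) \<and>
        (\<forall>e. adapted_basis (g c x) (\<phi> c x) e \<longrightarrow>
           laplacian (g c) (\<lambda>y. F y * G y) x =
             8 * K e * F x * G x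
             + G x * norm2_nabla_form2 (g c) e \<phi>p x
             + F x * norm2_nabla_form2 (g c) e \<phi>m x
             + 2 * (grad (g c) F x \<bullet> (g c x *v grad (g c) G x)))"
    using ex main unfolding Let_def F_def[abs_def] G_def[abs_def] P_def[abs_def] N_def[abs_def] \<psi>_def x_def
    by blast
qed

end
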